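(* Let $n\ge 1$ be an integer, $q\in\mathbb Z/4\mathbb Z$, $s\in\mathbb C$. (1) The space of $K$-finite vectors in $\ker(\Omega''-2\lambda)\subset I''(q,-\tfrac n2,s)$ is non-zero if and only if $\lambda$ is admissible. (2) In this case, the space of $K$-finite vectors in $\ker(\Omega''-2\lambda)\subset I''(q,-\tfrac n2,s)$ is spanned by the functions $F_{m,l,k}(\theta,y)$ of the form $$F_{m,l,k}(\theta,y)=e^{-im\theta/2}\,e^{-is\rho^2}\,\rho^{2l}\,h_k(y)\;{}_1F_1\!\Big(\tfrac{m+4l+2k+n}{4},\,2l+k+\tfrac n2,\,2is\rho^2\Big),$$ where the pair $(l,k)$ is $\lambda$-admissible, $h_k\in\mathcal H_k(\mathbb R^n)$, and $m\in\mathbb Z$ satisfies $m\equiv 2k+q \pmod 4$.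
   Context: Coordinates are $\theta\in\mathbb R$, $y\in\mathbb R^n$, $\rho=\|y\|$. Let $$I''(q,-\tfrac n2,s)=\{F\in C^\infty(\mathbb R^{n+1})\;|\;F(\theta+j\pi,(-1)^jy)=i^{-jq}F(\theta,y)\},$$ ($j\in\mathbb Z$, complex-valued functions of $(\theta,y)$) and let $\Omega''$ be the differential operator $$\Omega''=\|y\|^2\big(4s\,\partial_\theta+4s^2\|y\|^2+\Delta_n\big),$$ where $\Delta_n$ is the Laplacian in $y$. Let $K=K_2\times O(n)$, where $K_2\cong\mathbb R/4\pi\mathbb Z$ acts by $(\alpha.F)(\theta,y)=F(\theta-\alpha,y)$ and $u\in O(n)$ acts by $(u.F)(\theta,y)=F(\theta,u^{-1}y)$. A vector is $K$-finite if its $K$-translates span a finite-dimensional space. $\mathcal H_k(\mathbb R^n)$ is the space of harmonic polynomials of homogeneous degree $k$ on $\mathbb R^n$; the index $k$ runs over $\mathbb Z^{\ge0}$ for $n\ge3$, over $\mathbb Z$ for $n=2$, and over $\{0,1\}$ for $n=1$, these being the indices in the decomposition $C^\infty(S^{n-1})_{O(n)\text{-finite}}=\bigoplus_k\mathcal H_k(S^{n-1})$, with $\mathcal H_k(S^{n-1})$ the restrictions to the sphere. ${}_1F_1(a,b,z)=\sum_{j\ge0}\frac{(a)_j}{(b)_j}\frac{z^j}{j!}$ is the confluent hypergeometric function of the first kind. Admissible eigenvalues: for $n=1$, $\lambda$ is admissible iff $\lambda=\frac12l(l-1)$ for some $l\in\mathbb Z^{\ge0}$. For $n\ge2$, let $A_n=\{l(n+2j)\mid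 l,j\in\mathbb Z,\ 1\le l\le j+1\}$; $\lambda$ is admissible iff $\lambda\in A_n\cup\{0\}$. Admissible pairs: for $n\ge3$, a pair $(l,k)\in\mathbb Z^{\ge1}\times\mathbb Z^{\ge0}$ is $\lambda$-admissible iff $\lambda=l(2l+2k+n-2)$. For $n=2$, a pair $(l,k)\in\mathbb Z^{\ge1}\times\mathbb Z$ is $\lambda$-admissible iff $\lambda=l(2l+2k+n-2)$. (For $n\ge2$ and $\lambda=0$, the value $l=0$ is also allowed.) For $n=1$, a pair $(l,0)$, $l\in\mathbb Z^{\ge0}$, is $\lambda$-admissible iff $\lambda=\frac{l(l-1)}2$.
   Formalization: For n=1 the printed admissible pairs make (2) false (q=s=λ=m=0, l=1, k=0 gives F=y², Ω''F=2y²≠0); here (l,k) with l≥0, k∈{0,1} is admissible iff λ=L(L−1)/2, L=2l+k. For n=2, H_k is read literally, so it is zero for k<0. *)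

theory Defs
  imports "HOL-Analysis.Analysis" "HOL-Library.Function_Algebras"
begin

definition dderiv :: "'a::real_normed_vector \<Rightarrow> ('a \<Rightarrow> 'b::real_normed_vector) \<Rightarrow> 'a \<Rightarrow> 'b" where
  "dderiv v f = (\<lambda>x. frechet_derivative f (at x) v)"

fun times_cont_diff :: "nat \<Rightarrow> ('a::euclidean_space \<Rightarrow> 'b::real_normed_vector) \<Rightarrow> bool" where
  "times_cont_diff 0 f \<longleftrightarrow> continuous_on UNIV f"
| "times_cont_diff (Suc k) f \<longleftrightarrow>
     (\<forall>x. f differentiable (at x)) \<and> (\<forall>v. times_cont_diff k (dderiv v f))"

definition smooth :: "('a::euclidean_space \<Rightarrow> 'b::real_normed_vector) \<Rightarrow> bool" where
  "smooth f \<longleftrightarrow> (\<forall>k. times_cont_diff k f)"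

definition laplacian :: "('a::euclidean_space \<Rightarrow> complex) \<Rightarrow> 'a \<Rightarrow> complex" where
  "laplacian f y = (\<Sum>b\<in>Basis. dderiv b (dderiv b f) y)"

definition Omega :: "complex \<Rightarrow> (real \<times> (real^'n) \<Rightarrow> complex) \<Rightarrow> real \<times> (real^'n) \<Rightarrow> complex" where
  "Omega s F = (\<lambda>(\<theta>, y). of_real ((norm y)\<^sup>2) *
     (4 * s * dderiv (1, 0) F (\<theta>, y) + 4 * s\<^sup>2 * of_real ((norm y)\<^sup>2) * F (\<theta>, y)
      + laplacian (\<lambda>z. F (\<theta>, z)) y))"

text \<open>The complex vector space of all complex-valued functions on a set; the library only provides
  real spans.\<close>

definition cscale :: "complex \<Rightarrow> ('a \<Rightarrow> complex) \<Rightarrow> 'a \<Rightarrow> complex" where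
  "cscale c f = (\<lambda>x. c * f x)"

interpretation cfun: vector_space cscale
  by unfold_locales (auto simp: cscale_def fun_eq_iff algebra_simps)

text \<open>A class \<open>q\<close> modulo 4 is given by any integer representative: the equation below depends
  only on \<open>q mod 4\<close>. The other two parameters of \<open>I''(q, -n/2, s)\<close> do not enter its
  description as a space of functions.\<close>

definition I_space :: "int \<Rightarrow> (real \<times> (real^'n) \<Rightarrow> complex) set" where
  "I_space q = {F. smooth F \<and>
     (\<forall>j::int. \<forall>\<theta> y. F (\<theta> + of_int j * pi, ((-1) powi j) *\<^sub>R y) = \<i> powi (- j * q) * F (\<theta>, y))}"

definition Omega_kernel :: "int \<Rightarrow> complex \<Rightarrow> complex \<Rightarrow> (real \<times> (real^'n) \<Rightarrow> complex) set" where
  "Omega_kernel q s lam = {F \<in> I_space q. \<forall>p. Omega s F p - 2 * lam * F p = 0}"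

text \<open>Elements of \<open>\<real>/4\<pi>\<int>\<close> are represented by real numbers; elements of \<open>I_space q\<close> have period
  \<open>4\<pi>\<close> in \<open>\<theta>\<close>.\<close>

definition K_act ::
  "real \<Rightarrow> (real^'n \<Rightarrow> real^'n) \<Rightarrow> (real \<times> (real^'n) \<Rightarrow> complex) \<Rightarrow> real \<times> (real^'n) \<Rightarrow> complex" where
  "K_act \<alpha> u F = (\<lambda>(\<theta>, y). F (\<theta> - \<alpha>, inv u y))"

definition K_finite :: "(real \<times> (real^'n) \<Rightarrow> complex) \<Rightarrow> bool" where
  "K_finite F \<longleftrightarrow>
     (\<exists>B. finite B \<and> cfun.span {K_act \<alpha> u F | \<alpha> u. orthogonal_transformation u} = cfun.span B)"

definition K_finite_kernel :: "int \<Rightarrow> complex \<Rightarrow> complex \<Rightarrow> (real \<times> (real^'n) \<Rightarrow> complex) set" where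
  "K_finite_kernel q s lam = {F \<in> Omega_kernel q s lam. K_finite F}"

text \<open>Harmonic polynomial functions of homogeneous degree \<open>k\<close>. The degree is an integer because for
  \<open>n = 2\<close> the index ranges over \<open>\<int>\<close>; for \<open>k < 0\<close> only the zero polynomial qualifies, and
  for \<open>n = 2\<close>, \<open>k > 0\<close> the space is spanned by \<open>(y\<^sub>1 + \<i> y\<^sub>2)^k\<close> and \<open>(y\<^sub>1 - \<i> y\<^sub>2)^k\<close>.\<close>

definition harmonic_poly :: "int \<Rightarrow> (real^'n \<Rightarrow> complex) set" where
  "harmonic_poly k = {h. polynomial_function h \<and> (\<forall>y. laplacian h y = 0) \<and>
     (\<forall>t y. t \<noteq> 0 \<longrightarrow> h (t *\<^sub>R y) = of_real t powi k * h y)}"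

definition hyp1F1 :: "complex \<Rightarrow> complex \<Rightarrow> complex \<Rightarrow> complex" where
  "hyp1F1 a b z = (\<Sum>j. pochhammer a j / pochhammer b j * (z ^ j / fact j))"

definition F_fun ::
  "complex \<Rightarrow> int \<Rightarrow> int \<Rightarrow> int \<Rightarrow> (real^'n \<Rightarrow> complex) \<Rightarrow> real \<times> (real^'n) \<Rightarrow> complex" where
  "F_fun s m l k h = (\<lambda>(\<theta>, y).
     exp (- \<i> * of_int m * of_real \<theta> / 2) * exp (- \<i> * s * of_real ((norm y)\<^sup>2))
     * of_real (norm y powi (2 * l)) * h y
     * hyp1F1 (of_int (m + 4 * l + 2 * k + int CARD('n)) / 4)
              (2 * of_int l + of_int k + of_nat CARD('n) / 2)
              (2 * \<i> * s * of_real ((norm y)\<^sup>2)))"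

definition A_set :: "nat \<Rightarrow> int set" where
  "A_set n = {l * (int n + 2 * j) | l j. 1 \<le> l \<and> l \<le> j + 1}"

definition admissible :: "nat \<Rightarrow> complex \<Rightarrow> bool" where
  "admissible n lam \<longleftrightarrow>
     (if n = 1 then \<exists>l::int. l \<ge> 0 \<and> lam = of_int (l * (l - 1)) / 2
      else lam \<in> of_int ` A_set n \<union> {0})"

text \<open>For \<open>n = 1\<close> the function \<open>F_fun s m l k h\<close> vanishes at \<open>y = 0\<close> to order \<open>L = 2l + k\<close>, and it
  is this order, an arbitrary natural number as \<open>l \<ge> 0\<close> and \<open>k \<in> {0, 1}\<close> vary, that is tied to the
  eigenvalue by \<open>lam = L(L - 1)/2\<close>; this is again \<open>lam = l(2l + 2k + n - 2)\<close>.\<close>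

definition admissible_pair :: "nat \<Rightarrow> complex \<Rightarrow> int \<Rightarrow> int \<Rightarrow> bool" where
  "admissible_pair n lam l k \<longleftrightarrow>
     (if n = 1 then l \<ge> 0 \<and> k \<in> {0, 1} \<and> lam = of_int ((2 * l + k) * (2 * l + k - 1)) / 2
      else (l \<ge> 1 \<or> lam = 0 \<and> l = 0) \<and> (n \<ge> 3 \<longrightarrow> k \<ge> 0) \<and>
           lam = of_int (l * (2 * l + 2 * k + int n - 2)))"

end

theory Submission
  imports Defs "HOL-Complex_Analysis.Cauchy_Integral_Formula"
    "HOL-Computational_Algebra.Fundamental_Theorem_Algebra"
begin

text \<open>
  No harmonic analysis on the sphere is needed. The span of the \<open>K\<close>-orbit of a \<open>K\<close>-finite \<open>F\<close> is finite
  dimensional, hence closed under pointwise limits, so the infinitesimal generators of \<open>K\<close> act on it.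
  Consequently \<open>F\<close> is annihilated by nonzero polynomials in \<open>\<partial>\<^sub>\<theta>\<close> and in the Casimir operator \<open>C\<close> of the
  rotations, that is, it is a sum of generalised eigenvectors of these operators. Jordan blocks of \<open>\<partial>\<^sub>\<theta>\<close>
  contradict periodicity in \<open>\<theta>\<close>.

  As \<open>\<rho>\<^sup>2\<Delta> = E\<^sup>2 + (n - 2)E + C\<close> with the Euler operator \<open>E\<close>, an eigenvector \<open>G(y)\<close> of \<open>C\<close> satisfies on every ray
  through the origin the same ordinary differential equation with a regular singular point at 0. A smooth
  solution that is flat at 0 vanishes, and parity leaves at most one admissible indicial root \<open>d\<close>.
  Jordan blocks of \<open>C\<close> would be resonances, and
  \<open>G = h(y) exp(-is\<rho>\<^sup>2) \<^sub>1F\<^sub>1((m + 2d + n)/4, d + n/2, 2is\<rho>\<^sup>2)\<close> with \<open>h\<close> the Taylor polynomial of \<open>G\<close> of degree \<open>d\<close>.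
  Kummer's equation then yields \<open>\<rho>\<^sup>2\<Delta>h = 2\<lambda>h\<close>; dividing by \<open>\<rho>\<^sup>2\<close> as often as possible gives \<open>h = \<rho>\<^sup>2\<^sup>l h\<^sub>k\<close> with \<open>h\<^sub>k\<close>
  harmonic of degree \<open>k\<close>, \<open>d = 2l + k\<close> and \<open>\<lambda> = l(2l + 2k + n - 2)\<close>.
\<close>

section \<open>Smooth functions\<close>

text \<open>The two indicial roots on a ray add up to 2 - n. Distinct natural numbers can do so only
  for n = 1, where they are 0 and 1. There the sign i^(m - q) of G under y -> -y, which is
  equivariance for j = 1, selects one of them. This is why parity accompanies every statement about
  slices. Comparing this sign with (-1)^k also produces the congruence m = 2k + q modulo 4.

  The eigenvalue \<mu> of the Casimir operator is never expressed through k; it enters only the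
  indicial equation. The value of \<lambda> is read off from h: the radial factor absorbs the
  potential 4s^2\<rho>^2 - 2ims completely, so the partial differential equation shrinks to an
  eigenvalue equation for a polynomial.

  The operators are linear only on smooth functions, so diagonalisation is carried out relative to a
  subspace on which the operator acts.

  For the converse, linear substitutions keep a polynomial in a finite-dimensional space, which
  gives finiteness under \<open>K\<close>, and powers of an isotropic linear form provide nonzero
  harmonic polynomials.\<close>

lemma dderiv_eq: "(f has_derivative f') (at x) \<Longrightarrow> dderiv v f x = f' v"
  by (metis dderiv_def frechet_derivative_at)

lemma has_derivative_dderiv:
  "f differentiable (at x) \<Longrightarrow> (f has_derivative (\<lambda>v. dderiv v f x)) (at x)"
  unfolding dderiv_def using frechet_derivative_works by blast

lemma times_cont_diff_mono: "times_cont_diff (Suc k) f \<Longrightarrow> times_cont_diff k f"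
  by (induction k arbitrary: f)
    (auto intro!: continuous_at_imp_continuous_on differentiable_imp_continuous_within)

lemma smooth_differentiable: "smooth f \<Longrightarrow> f differentiable (at x)"
  unfolding smooth_def by (metis times_cont_diff.simps(2))

lemma smooth_dderiv [intro]: "smooth f \<Longrightarrow> smooth (dderiv v f)"
  unfolding smooth_def by (metis times_cont_diff.simps(2))

lemma smooth_continuous_on: "smooth f \<Longrightarrow> continuous_on S f"
  using smooth_differentiable
  by (auto intro!: continuous_at_imp_continuous_on differentiable_imp_continuous_within)

lemma smooth_has_derivative:
  "smooth f \<Longrightarrow> (f has_derivative (\<lambda>v. dderiv v f x)) (at x)"
  by (simp add: has_derivative_dderiv smooth_differentiable)

lemma dderiv_const [simp]: "dderiv v (\<lambda>x. c) = (\<lambda>x. 0)"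
  by (rule ext, rule dderiv_eq) simp

lemma times_cont_diff_const: "times_cont_diff k (\<lambda>x. c)"
  by (induction k arbitrary: c) auto

lemma smooth_const [intro]: "smooth (\<lambda>x. c)"
  by (simp add: smooth_def times_cont_diff_const)

lemma dderiv_bounded_linear: "bounded_linear f \<Longrightarrow> dderiv v f = (\<lambda>x. f v)"
  by (rule ext, rule dderiv_eq) (simp add: bounded_linear_imp_has_derivative)

lemma smooth_bounded_linear:
  assumes "bounded_linear f" shows "smooth f"
proof -
  have "times_cont_diff k f" for k
    using assms by (cases k) (auto simp: dderiv_bounded_linear times_cont_diff_const
        bounded_linear_imp_differentiable linear_continuous_on)
  then show ?thesis by (simp add: smooth_def)
qed

lemma dderiv_add:
  assumes "f differentiable (at x)" "g differentiable (at x)"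
  shows "dderiv v (\<lambda>x. f x + g x) x = dderiv v f x + dderiv v g x"
  by (rule dderiv_eq) (intro has_derivative_add has_derivative_dderiv assms)

lemma dderiv_mult:
  fixes f g :: "'a::real_normed_vector \<Rightarrow> complex"
  assumes "f differentiable (at x)" "g differentiable (at x)"
  shows "dderiv v (\<lambda>x. f x * g x) x = f x * dderiv v g x + dderiv v f x * g x"
  by (rule dderiv_eq) (intro has_derivative_mult has_derivative_dderiv assms)

lemma times_cont_diff_add:
  "times_cont_diff k f \<Longrightarrow> times_cont_diff k g \<Longrightarrow> times_cont_diff k (\<lambda>x. f x + g x)"
proof (induction k arbitrary: f g)
  case (Suc k)
  then have "dderiv v (\<lambda>x. f x + g x) = (\<lambda>x. dderiv v f x + dderiv v g x)" for v
    by (intro ext dderiv_add) auto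
  with Suc show ?case by auto
qed (auto intro: continuous_intros)

lemma times_cont_diff_mult:
  fixes f g :: "'a::euclidean_space \<Rightarrow> complex"
  shows "times_cont_diff k f \<Longrightarrow> times_cont_diff k g \<Longrightarrow> times_cont_diff k (\<lambda>x. f x * g x)"
proof (induction k arbitrary: f g)
  case (Suc k)
  then have "dderiv v (\<lambda>x. f x * g x) = (\<lambda>x. f x * dderiv v g x + dderiv v f x * g x)" for v
    by (intro ext dderiv_mult) auto
  moreover have "times_cont_diff k f" "times_cont_diff k g"
    using Suc.prems times_cont_diff_mono by blast+
  ultimately show ?case
    using Suc by (auto intro!: times_cont_diff_add differentiable_mult)
qed (auto intro: continuous_intros)

lemma smooth_add [intro]: "smooth f \<Longrightarrow> smooth g \<Longrightarrow> smooth (\<lambda>x. f x + g x)"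
  by (simp add: smooth_def times_cont_diff_add)

lemma smooth_mult [intro]:
  fixes f g :: "'a::euclidean_space \<Rightarrow> complex"
  shows "smooth f \<Longrightarrow> smooth g \<Longrightarrow> smooth (\<lambda>x. f x * g x)"
  by (simp add: smooth_def times_cont_diff_mult)

lemma smooth_minus [intro]:
  fixes f g :: "'a::euclidean_space \<Rightarrow> complex"
  shows "smooth f \<Longrightarrow> smooth g \<Longrightarrow> smooth (\<lambda>x. f x - g x)"
  using smooth_add[OF _ smooth_mult[OF smooth_const[of "-1"]], of f g] by simp

lemma smooth_sum [intro]:
  fixes f :: "'i \<Rightarrow> 'a::euclidean_space \<Rightarrow> 'b::real_normed_vector"
  shows "(\<And>i. i \<in> A \<Longrightarrow> smooth (f i)) \<Longrightarrow> smooth (\<lambda>x. \<Sum>i\<in>A. f i x)"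
  by (induction A rule: infinite_finite_induct) auto

lemma smooth_power [intro]:
  fixes f :: "'a::euclidean_space \<Rightarrow> complex"
  shows "smooth f \<Longrightarrow> smooth (\<lambda>x. f x ^ k)"
  by (induction k) auto

lemma dderiv_holomorphic:
  fixes g :: "'a::real_normed_vector \<Rightarrow> complex"
  assumes "\<phi> holomorphic_on UNIV" "g differentiable (at x)"
  shows "dderiv v (\<lambda>x. \<phi> (g x)) x = deriv \<phi> (g x) * dderiv v g x"
  using assms
  by (intro dderiv_eq has_derivative_compose[OF has_derivative_dderiv])
    (auto simp: has_field_derivative_imp_has_derivative holomorphic_derivI)

text \<open>Entire functions are closed under \<open>deriv\<close>, and by the chain rule
  \<open>deriv \<phi>\<close> takes the place of \<phi> in the induction step. The exponential and
  the radial factor become smooth through this lemma.\<close>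

lemma times_cont_diff_holomorphic:
  fixes g :: "'a::euclidean_space \<Rightarrow> complex"
  shows "\<phi> holomorphic_on UNIV \<Longrightarrow> times_cont_diff k g \<Longrightarrow> times_cont_diff k (\<lambda>x. \<phi> (g x))"
proof (induction k arbitrary: \<phi>)
  case 0
  then show ?case
    by (auto intro!: continuous_on_compose2[OF holomorphic_on_imp_continuous_on[OF 0(1)]])
next
  case (Suc k)
  have d: "(\<lambda>x. \<phi> (g x)) differentiable (at x)" for x
    using Suc.prems has_derivative_compose[OF has_derivative_dderiv,
        of g x \<phi> "(*) (deriv \<phi> (g x))"]
    by (auto simp: differentiable_def has_field_derivative_imp_has_derivative holomorphic_derivI)
  have "dderiv v (\<lambda>x. \<phi> (g x)) = (\<lambda>x. deriv \<phi> (g x) * dderiv v g x)" for v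
    using Suc.prems by (intro ext dderiv_holomorphic) auto
  moreover have "times_cont_diff k g" using Suc.prems(2) by (rule times_cont_diff_mono)
  moreover have "deriv \<phi> holomorphic_on UNIV"
    using Suc.prems(1) by (intro holomorphic_deriv) auto
  ultimately show ?case using Suc d by (auto intro!: times_cont_diff_mult)
qed

lemma smooth_holomorphic:
  fixes g :: "'a::euclidean_space \<Rightarrow> complex"
  shows "\<phi> holomorphic_on UNIV \<Longrightarrow> smooth g \<Longrightarrow> smooth (\<lambda>x. \<phi> (g x))"
  by (simp add: smooth_def times_cont_diff_holomorphic)

lemma dderiv_affine:
  assumes "bounded_linear A" "f differentiable (at (c + A x))"
  shows "dderiv v (\<lambda>x. f (c + A x)) x = dderiv (A v) f (c + A x)"
proof -
  have "((\<lambda>x. c + A x) has_derivative A) (at x)"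
    using assms(1) by (auto intro!: derivative_eq_intros bounded_linear_imp_has_derivative)
  from has_derivative_compose[OF this has_derivative_dderiv[OF assms(2)]]
  show ?thesis by (rule dderiv_eq)
qed

lemma times_cont_diff_affine:
  "bounded_linear A \<Longrightarrow> times_cont_diff k f \<Longrightarrow> times_cont_diff k (\<lambda>x. f (c + A x))"
proof (induction k arbitrary: f)
  case 0
  then show ?case
    using continuous_on_compose2[of UNIV f UNIV "\<lambda>x. c + A x"]
    by (simp add: continuous_on_add linear_continuous_on)
next
  case (Suc k)
  have "((\<lambda>x. c + A x) has_derivative A) (at x)" for x
    using Suc.prems(1) by (auto intro!: derivative_eq_intros bounded_linear_imp_has_derivative)
  then have "(\<lambda>x. f (c + A x)) differentiable (at x)" for x
    using Suc.prems(2) has_derivative_compose has_derivative_dderiv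
    unfolding differentiable_def by (metis differentiable_def times_cont_diff.simps(2))
  moreover have "dderiv v (\<lambda>x. f (c + A x)) = (\<lambda>x. dderiv (A v) f (c + A x))" for v
    using Suc.prems by (intro ext dderiv_affine) auto
  ultimately show ?case using Suc by auto
qed

text \<open>Restriction to a fixed angle and the action of \<open>K\<close> are both affine
  substitutions.\<close>

lemma smooth_affine:
  "bounded_linear A \<Longrightarrow> smooth f \<Longrightarrow> smooth (\<lambda>x. f (c + A x))"
  by (simp add: smooth_def times_cont_diff_affine)

lemma smooth_linear:
  "bounded_linear A \<Longrightarrow> smooth f \<Longrightarrow> smooth (\<lambda>x. f (A x))"
  using smooth_affine[of A f 0] by simp

lemma dderiv_linear:
  assumes "bounded_linear A" "smooth f"
  shows "dderiv v (\<lambda>x. f (A x)) = (\<lambda>x. dderiv (A v) f (A x))"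
  using dderiv_affine[of A f 0] assms smooth_differentiable by (auto simp: fun_eq_iff)

lemma dderiv_sum:
  assumes "\<And>i. i \<in> A \<Longrightarrow> f i differentiable (at x)"
  shows "dderiv v (\<lambda>x. \<Sum>i\<in>A. f i x) x = (\<Sum>i\<in>A. dderiv v (f i) x)"
  by (rule dderiv_eq) (intro has_derivative_sum has_derivative_dderiv assms)

lemma dderiv_cmult:
  fixes f :: "'a::real_normed_vector \<Rightarrow> complex"
  assumes "f differentiable (at x)"
  shows "dderiv v (\<lambda>x. c * f x) x = c * dderiv v f x"
  using dderiv_mult[of "\<lambda>x. c" x f v] assms by simp

lemma smooth_dderiv_add:
  "smooth f \<Longrightarrow> smooth g \<Longrightarrow> dderiv v (\<lambda>x. f x + g x) = (\<lambda>x. dderiv v f x + dderiv v g x)"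
  by (intro ext dderiv_add smooth_differentiable)

lemma smooth_dderiv_mult:
  fixes f g :: "'a::euclidean_space \<Rightarrow> complex"
  shows "smooth f \<Longrightarrow> smooth g \<Longrightarrow>
    dderiv v (\<lambda>x. f x * g x) = (\<lambda>x. f x * dderiv v g x + dderiv v f x * g x)"
  by (intro ext dderiv_mult smooth_differentiable)

lemma smooth_dderiv_cmult:
  fixes f :: "'a::euclidean_space \<Rightarrow> complex"
  shows "smooth f \<Longrightarrow> dderiv v (\<lambda>x. c * f x) = (\<lambda>x. c * dderiv v f x)"
  by (intro ext dderiv_cmult smooth_differentiable)

lemma smooth_dderiv_sum:
  fixes f :: "'i \<Rightarrow> 'a::euclidean_space \<Rightarrow> 'b::real_normed_vector"
  shows "(\<And>i. i \<in> A \<Longrightarrow> smooth (f i)) \<Longrightarrow>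
    dderiv v (\<lambda>x. \<Sum>i\<in>A. f i x) = (\<lambda>x. \<Sum>i\<in>A. dderiv v (f i) x)"
  by (intro ext dderiv_sum smooth_differentiable)

lemma dderiv_expand:
  assumes "f differentiable (at x)"
  shows "dderiv v f x = (\<Sum>b\<in>Basis. (v \<bullet> b) *\<^sub>R dderiv b f x)"
proof -
  have "linear (\<lambda>v. dderiv v f x)"
    using has_derivative_dderiv[OF assms] has_derivative_linear by blast
  from linear_sum[OF this, of "\<lambda>b. (v \<bullet> b) *\<^sub>R b" Basis]
  have "dderiv (\<Sum>b\<in>Basis. (v \<bullet> b) *\<^sub>R b) f x = (\<Sum>b\<in>Basis. (v \<bullet> b) *\<^sub>R dderiv b f x)"
    by (simp add: linear_cmul[OF \<open>linear (\<lambda>v. dderiv v f x)\<close>])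
  then show ?thesis by (simp add: euclidean_representation)
qed

lemma dderiv_scaleR:
  assumes "f differentiable (at x)"
  shows "dderiv (r *\<^sub>R v) f x = r *\<^sub>R dderiv v f x"
  using has_derivative_dderiv[OF assms] has_derivative_linear linear_cmul by blast

section \<open>Spaces of functions spanned by finite sets\<close>

lemma cscale_apply: "cscale c f x = c * f x"
  by (simp add: cscale_def)

text \<open>Carries finite-dimensionality along rotations, restrictions and multiplications;
  \<open>R\<close> is often the image of a finite \<open>S\<close>.\<close>

lemma cfun_span_image:
  fixes T :: "('a \<Rightarrow> complex) \<Rightarrow> 'b \<Rightarrow> complex"
  assumes add: "\<And>f g. T (f + g) = T f + T g" and scale: "\<And>c f. T (cscale c f) = cscale c (T f)"
    and "f \<in> cfun.span S" "\<And>f. f \<in> S \<Longrightarrow> T f \<in> cfun.span R"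
  shows "T f \<in> cfun.span R"
proof -
  have "T 0 = 0"
    using scale[of 0 0] by (simp add: fun_eq_iff cscale_apply)
  then have "cfun.subspace {f. T f \<in> cfun.span R}"
    by (auto simp: cfun.subspace_def add scale cfun.span_zero cfun.span_add cfun.span_scale)
  moreover have "S \<subseteq> {f. T f \<in> cfun.span R}"
    using assms(4) by auto
  ultimately have "cfun.span S \<subseteq> {f. T f \<in> cfun.span R}"
    by (intro cfun.span_minimal)
  with assms(3) show ?thesis by auto
qed

text \<open>Pointwise convergence suffices because the coefficients with respect to finitely many
  functions can be read off from values at finitely many points. One generator is eliminated per
  such point.\<close>

lemma cfun_span_pointwise_limit:
  fixes f :: "nat \<Rightarrow> 'a \<Rightarrow> complex"
  assumes "finite B" "\<And>n. f n \<in> cfun.span B" "\<And>x. (\<lambda>n. f n x) \<longlonglongrightarrow> g x"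
  shows "g \<in> cfun.span B"
  using assms
proof (induction "card B" arbitrary: B f g rule: less_induct)
  case less
  show ?case
  proof (cases "\<exists>b\<in>B. b \<noteq> 0")
    case False
    then have "cfun.span B \<subseteq> cfun.span {}"
      by (intro cfun.span_minimal) auto
    then have "f n = 0" for n using less.prems(2) by auto
    then have "g x = 0" for x
      using less.prems(3)[of x] by (simp add: LIMSEQ_const_iff)
    then have "g = 0" by (simp add: fun_eq_iff cscale_apply)
    then show ?thesis by (simp add: cfun.span_zero)
  next
    case True
    then obtain b x0 where b: "b \<in> B" "b x0 \<noteq> 0" by (auto simp: cscale_apply fun_eq_iff)
    define B0 where "B0 = B - {b}"
    have B: "B = insert b B0" "finite B0" using b less.prems(1) by (auto simp: B0_def)
    \<comment> \<open>\<open>T\<close> annihilates \<open>b\<close> and only evaluates at \<open>x0\<close>, so it commutes with pointwise limits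
      and reduces the size of the spanning set.\<close>
    define T where "T h = h - cscale (h x0 / b x0) b" for h :: "'a \<Rightarrow> complex"
    have "T b = 0" using b(2) by (simp add: T_def fun_eq_iff cscale_apply)
    have T_add: "T (h + k) = T h + T k" and T_scale: "T (cscale c h) = cscale c (T h)" for h k c
      by (auto simp: T_def fun_eq_iff cscale_apply add_divide_distrib algebra_simps)
    have Tspan: "T h \<in> cfun.span (T ` B0)" if "h \<in> cfun.span B" for h
    proof (rule cfun_span_image[OF T_add T_scale that])
      show "T k \<in> cfun.span (T ` B0)" if "k \<in> B" for k
        using that \<open>T b = 0\<close> by (cases "k = b") (auto simp: B0_def cfun.span_zero intro: cfun.span_base)
    qed
    have "T g \<in> cfun.span (T ` B0)"
    proof (rule less.hyps)
      have "card (T ` B0) \<le> card B0" using B(2) by (rule card_image_le)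
      also have "\<dots> < card B" using b less.prems(1) unfolding B0_def by (intro psubset_card_mono) auto
      finally show "card (T ` B0) < card B" .
      show "(\<lambda>n. T (f n) x) \<longlonglongrightarrow> T g x" for x
        unfolding T_def fun_diff_def cscale_apply using b
        by (intro tendsto_intros less.prems) auto
    qed (use B(2) Tspan less.prems(2) in auto)
    moreover have "T ` B0 \<subseteq> cfun.span B"
      using B by (auto simp: T_def intro!: cfun.span_diff cfun.span_scale intro: cfun.span_base)
    ultimately have "T g \<in> cfun.span B"
      using cfun.span_minimal[OF _ cfun.subspace_span] by blast
    then have "T g + cscale (g x0 / b x0) b \<in> cfun.span B"
      by (rule cfun.span_add[OF _ cfun.span_scale[OF cfun.span_base[OF b(1)]]])
    then show ?thesis by (simp add: T_def)
  qed
qed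

section \<open>Annihilating polynomials and diagonalisation\<close>

definition poly_apply ::
  "complex poly \<Rightarrow> (('a \<Rightarrow> complex) \<Rightarrow> 'a \<Rightarrow> complex) \<Rightarrow> ('a \<Rightarrow> complex) \<Rightarrow> 'a \<Rightarrow> complex" where
  "poly_apply p T v = (\<Sum>i\<le>degree p. cscale (coeff p i) ((T ^^ i) v))"

lemma poly_apply_eq:
  "degree p \<le> N \<Longrightarrow> poly_apply p T v = (\<Sum>i\<le>N. cscale (coeff p i) ((T ^^ i) v))"
  unfolding poly_apply_def
  by (intro sum.mono_neutral_left) (auto simp: coeff_eq_0)

text \<open>The first \<open>card B + 1\<close> iterates are too many to be independent. Dependence
  is a property of sets and does not see repetitions, so a coincidence of two iterates is treated
  separately; it gives the polynomial x^i - x^j.\<close>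

lemma exists_poly_annihilator:
  fixes T :: "('a \<Rightarrow> complex) \<Rightarrow> 'a \<Rightarrow> complex"
  assumes "finite B" and span: "\<And>i. (T ^^ i) v \<in> cfun.span B"
  shows "\<exists>p. p \<noteq> 0 \<and> poly_apply p T v = 0"
proof (cases "inj_on (\<lambda>i. (T ^^ i) v) {..card B}")
  case False
  then obtain i j where ij: "i < j" "(T ^^ i) v = (T ^^ j) v"
    unfolding inj_on_def by (metis linorder_neqE_nat)
  define p :: "complex poly" where "p = monom 1 i - monom 1 j"
  have deg: "degree p \<le> j"
    unfolding p_def using ij(1) by (intro degree_diff_le) (auto intro: degree_monom_le order_trans)
  have "coeff p i \<noteq> 0" using ij(1) by (simp add: p_def)
  then have "p \<noteq> 0" by auto
  moreover have "cscale (coeff p k) ((T ^^ k) v)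
      = (if k = i then (T ^^ i) v else 0) - (if k = j then (T ^^ j) v else 0)" for k
    using ij(1) by (auto simp: p_def fun_eq_iff cscale_apply)
  then have "poly_apply p T v = 0"
    using ij by (simp add: poly_apply_eq[OF deg] sum_subtractf sum.delta)
  ultimately show ?thesis by blast
next
  case True
  define A where "A = (\<lambda>i. (T ^^ i) v) ` {..card B}"
  have "cfun.dependent A"
  proof (rule ccontr)
    assume "\<not> cfun.dependent A"
    then have "card A \<le> card B"
      using cfun.independent_span_bound[of B A] assms unfolding A_def by blast
    then show False using True by (simp add: A_def card_image)
  qed
  then obtain u a where u: "(\<Sum>a\<in>A. cscale (u a) a) = 0" "a \<in> A" "u a \<noteq> 0"
    using cfun.dependent_finite[of A] by (auto simp: A_def)
  then obtain i where i: "i \<le> card B" "a = (T ^^ i) v" by (auto simp: A_def)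
  define p :: "complex poly" where "p = (\<Sum>i\<le>card B. monom (u ((T ^^ i) v)) i)"
  have c: "coeff p k = (if k \<le> card B then u ((T ^^ k) v) else 0)" for k
    by (simp add: p_def coeff_sum)
  have deg: "degree p \<le> card B" by (rule degree_le) (simp add: c)
  have "coeff p i \<noteq> 0" using i u by (simp add: c)
  then have "p \<noteq> 0" by auto
  moreover have "poly_apply p T v = (\<Sum>i\<le>card B. cscale (u ((T ^^ i) v)) ((T ^^ i) v))"
    by (simp add: poly_apply_eq[OF deg] c)
  then have "poly_apply p T v = 0"
    using u(1) True by (simp add: A_def sum.reindex)
  ultimately show ?thesis by blast
qed

text \<open>The last assumption excludes Jordan blocks of size two: if (T - a)^2 v = 0, then (T - a)
  v = 0. Linearity is required only on \<open>X\<close>, since differential operators are linear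
  only on differentiable functions.\<close>

locale semisimple_operator =
  fixes X :: "('a \<Rightarrow> complex) set" and T :: "('a \<Rightarrow> complex) \<Rightarrow> 'a \<Rightarrow> complex"
  assumes subspace: "cfun.subspace X"
    and closed: "v \<in> X \<Longrightarrow> T v \<in> X"
    and add: "v \<in> X \<Longrightarrow> w \<in> X \<Longrightarrow> T (v + w) = T v + T w"
    and scale: "v \<in> X \<Longrightarrow> T (cscale c v) = cscale c (T v)"
    and semisimple: "v \<in> X \<Longrightarrow> T (T v - cscale a v) = cscale a (T v - cscale a v) \<Longrightarrow>
      T v = cscale a v"
begin

definition eigenvectors :: "('a \<Rightarrow> complex) set" where
  "eigenvectors = {v \<in> X. \<exists>a. T v = cscale a v}"

lemma eigenvectors_span_subset: "cfun.span eigenvectors \<subseteq> X"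
  using subspace by (intro cfun.span_minimal) (auto simp: eigenvectors_def)

lemma diff: "v \<in> X \<Longrightarrow> w \<in> X \<Longrightarrow> T (v - w) = T v - T w"
  using add[of "v - w" w] cfun.subspace_diff[OF subspace] by simp

lemma funpow_closed: "v \<in> X \<Longrightarrow> (T ^^ i) v \<in> X"
  by (induction i) (auto intro: closed)

lemma funpow_shift:
  assumes "v \<in> X"
  shows "(T ^^ i) (T v - cscale a v) = (T ^^ Suc i) v - cscale a ((T ^^ i) v)"
proof (induction i)
  case (Suc i)
  have X: "(T ^^ i) v \<in> X" "(T ^^ Suc i) v \<in> X"
    using assms funpow_closed by blast+
  have "(T ^^ Suc i) (T v - cscale a v) = T ((T ^^ Suc i) v - cscale a ((T ^^ i) v))"
    by (simp only: funpow.simps o_apply Suc[simplified funpow.simps o_apply])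
  also have "\<dots> = T ((T ^^ Suc i) v) - cscale a (T ((T ^^ i) v))"
    by (simp only: diff scale X cfun.subspace_scale[OF subspace])
  finally show ?case by (simp only: funpow.simps o_apply)
qed simp

lemma poly_apply_linear_factor:
  assumes "v \<in> X"
  shows "poly_apply ([:- a, 1:] * r) T v = poly_apply r T (T v - cscale a v)"
proof -
  let ?S = "\<lambda>c N. \<Sum>i\<le>N. cscale (c i) ((T ^^ i) v)"
  let ?d = "Suc (degree r)"
  have c: "coeff ([:- a, 1:] * r) i = (case i of 0 \<Rightarrow> 0 | Suc i \<Rightarrow> coeff r i) - a * coeff r i" for i
    by (simp add: coeff_pCons split: nat.split)
  have "degree ([:- a, 1:] * r) \<le> ?d"
    using degree_mult_le[of "[:- a, 1:]" r] by simp
  then have "poly_apply ([:- a, 1:] * r) T v = ?S (coeff ([:- a, 1:] * r)) ?d"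
    by (rule poly_apply_eq)
  also have "\<dots> = ?S (\<lambda>i. case i of 0 \<Rightarrow> 0 | Suc i \<Rightarrow> coeff r i) ?d - ?S (\<lambda>i. a * coeff r i) ?d"
    unfolding c by (simp only: cfun.scale_left_diff_distrib sum_subtractf)
  also have "?S (\<lambda>i. case i of 0 \<Rightarrow> 0 | Suc i \<Rightarrow> coeff r i) ?d
      = (\<Sum>i\<le>degree r. cscale (coeff r i) ((T ^^ Suc i) v))"
    by (simp only: sum.atMost_Suc_shift) simp
  also have "?S (\<lambda>i. a * coeff r i) ?d = (\<Sum>i\<le>degree r. cscale (a * coeff r i) ((T ^^ i) v))"
    by (simp add: coeff_eq_0)
  also have "(\<Sum>i\<le>degree r. cscale (coeff r i) ((T ^^ Suc i) v)) - \<dots>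
     = (\<Sum>i\<le>degree r. cscale (coeff r i) ((T ^^ i) (T v - cscale a v)))"
    unfolding funpow_shift[OF assms] sum_subtractf[symmetric]
    by (intro sum.cong) (auto simp: cscale_apply fun_eq_iff algebra_simps)
  finally show ?thesis by (simp add: poly_apply_def)
qed

text \<open>On an eigenvector for b \<noteq> a the operator T - a is division-invertible with factor
  b - a, so such a part of \<open>w\<close> is in the image of T - a. Only the part with eigenvalue
  a is left over as \<open>x\<close>.\<close>

lemma split_resonant:
  assumes "w \<in> cfun.span eigenvectors"
  shows "\<exists>u x. u \<in> cfun.span eigenvectors \<and> x \<in> X \<and> T x = cscale a x \<and> w = x + (T u - cscale a u)"
proof -
  define Q where "Q = {w. \<exists>u x. u \<in> cfun.span eigenvectors \<and> x \<in> X \<and> T x = cscale a x \<and>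
    w = x + (T u - cscale a u)}"
  have QI: "w \<in> Q" if "u \<in> cfun.span eigenvectors" "x \<in> X" "T x = cscale a x"
    "w = x + (T u - cscale a u)" for w u x
    using that unfolding Q_def by blast
  note cl = cfun.subspace_scale[OF subspace] cfun.subspace_add[OF subspace]
  have E: "u \<in> X" if "u \<in> cfun.span eigenvectors" for u
    using eigenvectors_span_subset that by blast
  have T0: "T 0 = 0" using scale[of 0 0] cfun.subspace_0[OF subspace]
    by (simp add: fun_eq_iff cscale_apply)
  have "cfun.subspace Q"
  proof (rule cfun.subspaceI)
    show "0 \<in> Q"
      by (rule QI[OF cfun.span_zero cfun.subspace_0[OF subspace]])
        (simp_all add: T0 cfun.scale_zero_right)
  next
    fix w w' assume "w \<in> Q" "w' \<in> Q"
    then obtain u x u' x' where u: "u \<in> cfun.span eigenvectors" "x \<in> X" "T x = cscale a x"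
      "w = x + (T u - cscale a u)" and u': "u' \<in> cfun.span eigenvectors" "x' \<in> X"
      "T x' = cscale a x'" "w' = x' + (T u' - cscale a u')"
      unfolding Q_def by blast
    show "w + w' \<in> Q"
      by (rule QI[of "u + u'" "x + x'"])
        (use u u' in \<open>simp_all add: add cl E cfun.span_add cfun.scale_right_distrib\<close>)
  next
    fix c w assume "w \<in> Q"
    then obtain u x where u: "u \<in> cfun.span eigenvectors" "x \<in> X" "T x = cscale a x"
      "w = x + (T u - cscale a u)"
      unfolding Q_def by blast
    show "cscale c w \<in> Q"
      by (rule QI[of "cscale c u" "cscale c x"])
        (use u in \<open>simp_all add: scale cl E cfun.span_scale cfun.scale_right_distrib
          cfun.scale_right_diff_distrib mult.commute\<close>)
  qed
  moreover have "eigenvectors \<subseteq> Q"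
  proof
    fix e assume ev: "e \<in> eigenvectors"
    then obtain b where e: "e \<in> X" "T e = cscale b e" by (auto simp: eigenvectors_def)
    show "e \<in> Q"
    proof (cases "b = a")
      case True
      show ?thesis
        by (rule QI[of 0 e]) (use e True in \<open>simp_all add: cfun.span_zero T0 cfun.scale_zero_right\<close>)
    next
      case False
      have "T (cscale (1 / (b - a)) e) - cscale a (cscale (1 / (b - a)) e) = e"
        using e False by (simp add: scale fun_eq_iff cscale_apply)
          (simp add: divide_simps, simp add: algebra_simps)
      then show ?thesis
        by (intro QI[of "cscale (1 / (b - a)) e" 0])
          (simp_all add: cfun.span_scale cfun.span_base ev T0 cfun.scale_zero_right
            cfun.subspace_0[OF subspace])
    qed
  qed
  ultimately have "cfun.span eigenvectors \<subseteq> Q"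
    by (intro cfun.span_minimal)
  with assms show ?thesis unfolding Q_def by blast
qed

text \<open>Splitting off a linear factor puts (T - a) v into the span by induction. Writing it as x
  + (T - a) u leaves (T - a)(v - u) = x with x an eigenvector for a. Hence (T - a)^2 annihilates v -
  u, and semisimplicity makes v - u an eigenvector itself.\<close>

lemma in_span_eigenvectors_if_annihilated:
  assumes "v \<in> X" "p \<noteq> 0" "poly_apply p T v = 0"
  shows "v \<in> cfun.span eigenvectors"
  using assms
proof (induction "degree p" arbitrary: p v)
  case 0
  then obtain c where "p = [:c:]" "c \<noteq> 0" by (metis degree_eq_zeroE pCons_0_0)
  then have "v = 0" using 0 by (simp add: poly_apply_def fun_eq_iff cscale_apply)
  then show ?case by (metis cfun.span_zero)
next
  case (Suc d)
  have "\<not> constant (poly p)" using Suc.hyps(2) by (simp add: constant_degree)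
  then obtain a where "poly p a = 0" using fundamental_theorem_of_algebra by blast
  then obtain r where r: "p = [:- a, 1:] * r" by (auto simp: poly_eq_0_iff_dvd)
  have "r \<noteq> 0" using Suc.prems(2) r by auto
  then have "degree p = degree [:- a, 1:] + degree r" unfolding r by (intro degree_mult_eq) auto
  then have "degree r = d" using Suc.hyps(2) by simp
  moreover have "poly_apply r T (T v - cscale a v) = 0"
    using Suc.prems poly_apply_linear_factor[of v a r] r by simp
  moreover have "T v - cscale a v \<in> X"
    using Suc.prems(1) subspace by (intro cfun.subspace_diff cfun.subspace_scale closed)
  ultimately have "T v - cscale a v \<in> cfun.span eigenvectors"
    using Suc.hyps(1) \<open>r \<noteq> 0\<close> by blast
  from split_resonant[OF this, of a] obtain u x where u: "u \<in> cfun.span eigenvectors" "x \<in> X"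
    "T x = cscale a x" "T v - cscale a v = x + (T u - cscale a u)" by blast
  have "u \<in> X" using u eigenvectors_span_subset by auto
  then have vu: "v - u \<in> X" using Suc.prems(1) cfun.subspace_diff[OF subspace] by blast
  have eq: "T (v - u) - cscale a (v - u) = x"
    using u(4) Suc.prems(1) \<open>u \<in> X\<close> by (simp add: diff fun_eq_iff cscale_apply algebra_simps)
  have "T (v - u) = cscale a (v - u)"
    by (rule semisimple[OF vu]) (simp only: eq u(3))
  with vu have "v - u \<in> cfun.span eigenvectors"
    by (auto simp: eigenvectors_def intro: cfun.span_base)
  then have "(v - u) + u \<in> cfun.span eigenvectors" using u(1) by (rule cfun.span_add)
  then show ?case by simp
qed

lemma in_span_eigenvectors:
  assumes "v \<in> X" "finite B" "\<And>i. (T ^^ i) v \<in> cfun.span B"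
  shows "v \<in> cfun.span eigenvectors"
  using exists_poly_annihilator[OF assms(2,3)] in_span_eigenvectors_if_annihilated[OF assms(1)]
  by blast

end

section \<open>The Laplacian in polar coordinates\<close>

definition coord :: "'a::euclidean_space \<Rightarrow> 'a \<Rightarrow> complex" where
  "coord b y = of_real (y \<bullet> b)"

definition euler :: "('a::euclidean_space \<Rightarrow> complex) \<Rightarrow> 'a \<Rightarrow> complex" where
  "euler f y = (\<Sum>b\<in>Basis. coord b y * dderiv b f y)"

text \<open>The vector field generating the rotations in the plane of \<open>b\<close> and
  \<open>c\<close>. It is zero for b = c, so sums may run over all pairs.\<close>

definition rot_gen :: "'a::euclidean_space \<Rightarrow> 'a \<Rightarrow> ('a \<Rightarrow> complex) \<Rightarrow> 'a \<Rightarrow> complex" where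
  "rot_gen b c f y = coord b y * dderiv c f y - coord c y * dderiv b f y"

definition norm_sq :: "'a::euclidean_space \<Rightarrow> complex" where
  "norm_sq y = of_real ((norm y)\<^sup>2)"

text \<open>The angular part of \<open>\<rho>\<^sup>2\<Delta>\<close> in polar coordinates, written without reference to the sphere;
  by \<open>sph_laplacian_eq_rot_gen\<close> it is the Casimir operator of the rotation group.\<close>

definition sph_laplacian :: "('a::euclidean_space \<Rightarrow> complex) \<Rightarrow> 'a \<Rightarrow> complex" where
  "sph_laplacian f y = norm_sq y * laplacian f y - euler (euler f) y - (of_nat DIM('a) - 2) * euler f y"

lemma bounded_linear_coord: "bounded_linear (coord b)"
  unfolding coord_def using bounded_linear_compose[OF bounded_linear_of_real bounded_linear_inner_left] .

lemma smooth_coord [intro]: "smooth (coord b)"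
  by (intro smooth_bounded_linear bounded_linear_coord)

lemma dderiv_coord [simp]: "dderiv v (coord b) = (\<lambda>x. coord b v)"
  by (intro dderiv_bounded_linear bounded_linear_coord)

lemma coord_Basis: "b \<in> Basis \<Longrightarrow> c \<in> Basis \<Longrightarrow> coord b c = (if b = c then 1 else 0)"
  by (auto simp: coord_def inner_Basis)

lemma norm_sq_eq: "norm_sq y = (\<Sum>b\<in>Basis. coord b y * coord b y)"
  by (simp add: norm_sq_def coord_def power2_norm_eq_inner euclidean_inner[of y y])

lemma smooth_norm_sq [intro]: "smooth norm_sq"
  unfolding norm_sq_eq[abs_def] by (intro smooth_sum smooth_mult smooth_coord)

lemma dderiv_norm_sq: "dderiv v norm_sq x = 2 * of_real (x \<bullet> v)"
proof -
  have "(norm_sq has_derivative (\<lambda>h. of_real (2 * (x \<bullet> h)))) (at x)"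
    unfolding norm_sq_def[abs_def] power2_norm_eq_inner
    by (auto intro!: derivative_eq_intros simp: inner_commute)
  from dderiv_eq[OF this] show ?thesis by simp
qed

lemma smooth_euler [intro]: "smooth f \<Longrightarrow> smooth (euler f)"
  unfolding euler_def[abs_def] by (intro smooth_sum smooth_mult smooth_coord smooth_dderiv)

lemma smooth_laplacian [intro]: "smooth f \<Longrightarrow> smooth (laplacian f)"
  unfolding laplacian_def[abs_def] by (intro smooth_sum smooth_dderiv)

lemma smooth_rot_gen [intro]: "smooth f \<Longrightarrow> smooth (rot_gen b c f)"
  unfolding rot_gen_def[abs_def] by (intro smooth_minus smooth_mult smooth_coord smooth_dderiv)

lemma euler_eq_dderiv: "smooth f \<Longrightarrow> euler f y = dderiv y f y"
  unfolding euler_def coord_def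
  by (subst dderiv_expand[OF smooth_differentiable]) (auto simp: scaleR_conv_of_real)

lemma dderiv_euler:
  assumes "smooth f" "b \<in> Basis"
  shows "dderiv b (euler f) y = dderiv b f y + (\<Sum>c\<in>Basis. coord c y * dderiv b (dderiv c f) y)"
proof -
  have "dderiv b (euler f) y = (\<Sum>c\<in>Basis. dderiv b (\<lambda>y. coord c y * dderiv c f y) y)"
    unfolding euler_def[abs_def] using assms(1)
    by (intro dderiv_sum smooth_differentiable smooth_mult smooth_coord smooth_dderiv)
  also have "\<dots> = (\<Sum>c\<in>Basis. coord c y * dderiv b (dderiv c f) y + coord c b * dderiv c f y)"
    using assms(1) by (intro sum.cong refl) (simp add: smooth_dderiv_mult smooth_coord smooth_dderiv)
  also have "\<dots> = (\<Sum>c\<in>Basis. coord c y * dderiv b (dderiv c f) y) + (\<Sum>c\<in>Basis. if c = b then dderiv c f y else 0)"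
    unfolding sum.distrib using assms(2) by (intro arg_cong2[of _ _ _ _ "(+)"] sum.cong) (auto simp: coord_Basis)
  finally show ?thesis using assms(2) by simp
qed

lemma euler_euler:
  assumes "smooth f"
  shows "euler (euler f) y
    = euler f y + (\<Sum>b\<in>Basis. \<Sum>c\<in>Basis. coord b y * coord c y * dderiv b (dderiv c f) y)"
proof -
  have "euler (euler f) y = (\<Sum>b\<in>Basis. coord b y * dderiv b f y
      + (\<Sum>c\<in>Basis. coord b y * coord c y * dderiv b (dderiv c f) y))"
    unfolding euler_def[of "euler f"]
    by (intro sum.cong) (simp_all add: dderiv_euler assms algebra_simps sum_distrib_left)
  then show ?thesis by (simp add: sum.distrib euler_def)
qed

text \<open>The two orders of mixed differentiation are kept apart; they are matched only after
  summation. For b = c the last term cancels everything else.\<close>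

lemma rot_gen_rot_gen:
  assumes f: "smooth f" and bc: "b \<in> Basis" "c \<in> Basis"
  shows "rot_gen b c (rot_gen b c f) y =
    coord b y * coord b y * dderiv c (dderiv c f) y + coord c y * coord c y * dderiv b (dderiv b f) y
    - coord b y * coord c y * dderiv c (dderiv b f) y - coord b y * coord c y * dderiv b (dderiv c f) y
    - coord b y * dderiv b f y - coord c y * dderiv c f y
    + (if b = c then coord b y * dderiv b f y + coord c y * dderiv c f y else 0)"
proof -
  have d: "dderiv v (rot_gen b c f) y = coord b y * dderiv v (dderiv c f) y + coord b v * dderiv c f y
    - (coord c y * dderiv v (dderiv b f) y + coord c v * dderiv b f y)" for v
  proof (rule dderiv_eq)
    have D: "(g has_derivative (\<lambda>v. dderiv v g y)) (at y)" if "smooth g" for g :: "'a \<Rightarrow> complex"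
      using that by (rule smooth_has_derivative)
    show "(rot_gen b c f has_derivative (\<lambda>v. coord b y * dderiv v (dderiv c f) y + coord b v * dderiv c f y
      - (coord c y * dderiv v (dderiv b f) y + coord c v * dderiv b f y))) (at y)"
      unfolding rot_gen_def[abs_def]
      using has_derivative_diff[OF has_derivative_mult[OF D[OF smooth_coord[of b]] D[OF smooth_dderiv[OF f, of c]]]
          has_derivative_mult[OF D[OF smooth_coord[of c]] D[OF smooth_dderiv[OF f, of b]]]]
      by simp
  qed
  show ?thesis
    unfolding rot_gen_def[of b c "rot_gen b c f"] d using bc
    by (auto simp: coord_Basis algebra_simps)
qed

text \<open>Every coordinate plane is counted twice, hence the factor 2. The two mixed terms become
  equal on exchanging the summation indices, and by \<open>euler_euler\<close> each of them is E^2 -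
  E.\<close>

lemma sph_laplacian_eq_rot_gen:
  fixes f :: "'a::euclidean_space \<Rightarrow> complex"
  assumes "smooth f"
  shows "2 * sph_laplacian f y = (\<Sum>b\<in>Basis. \<Sum>c\<in>Basis. rot_gen b c (rot_gen b c f) y)"
proof -
  let ?x = "\<lambda>b. coord b y" and ?d = "\<lambda>b. dderiv b f y" and ?h = "\<lambda>b c. dderiv b (dderiv c f) y"
  have "(\<Sum>b\<in>Basis. \<Sum>c\<in>Basis. rot_gen b c (rot_gen b c f) y)
    = (\<Sum>b\<in>Basis. \<Sum>c\<in>Basis. ?x b * ?x b * ?h c c) + (\<Sum>b\<in>Basis. \<Sum>c\<in>Basis. ?x c * ?x c * ?h b b)
      - (\<Sum>b\<in>Basis. \<Sum>c\<in>Basis. ?x b * ?x c * ?h c b) - (\<Sum>b\<in>Basis. \<Sum>c\<in>Basis. ?x b * ?x c * ?h b c)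
      - (\<Sum>b\<in>Basis. \<Sum>c\<in>(Basis::'a set). ?x b * ?d b) - (\<Sum>b\<in>(Basis::'a set). \<Sum>c\<in>Basis. ?x c * ?d c)
      + (\<Sum>b\<in>Basis. \<Sum>c\<in>Basis. if b = c then ?x b * ?d b + ?x c * ?d c else 0)"
    by (simp add: rot_gen_rot_gen assms sum.distrib sum_subtractf cong: sum.cong)
  also have "(\<Sum>b\<in>Basis. \<Sum>c\<in>Basis. ?x b * ?x b * ?h c c) = norm_sq y * laplacian f y"
    by (simp add: norm_sq_eq laplacian_def sum_product)
  also have "(\<Sum>b\<in>Basis. \<Sum>c\<in>Basis. ?x c * ?x c * ?h b b) = norm_sq y * laplacian f y"
    by (subst sum.swap) (simp add: norm_sq_eq laplacian_def sum_product)
  also have "(\<Sum>b\<in>Basis. \<Sum>c\<in>Basis. ?x b * ?x c * ?h c b) = (\<Sum>b\<in>Basis. \<Sum>c\<in>Basis. ?x b * ?x c * ?h b c)"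
    by (subst sum.swap) (simp add: mult.commute)
  also have "\<dots> = euler (euler f) y - euler f y"
    using euler_euler[OF assms, of y] by simp
  also have "(\<Sum>b\<in>Basis. \<Sum>c\<in>(Basis::'a set). ?x b * ?d b) = of_nat DIM('a) * euler f y"
    by (simp add: euler_def sum_distrib_left)
  also have "(\<Sum>b\<in>(Basis::'a set). \<Sum>c\<in>Basis. ?x c * ?d c) = of_nat DIM('a) * euler f y"
    by (simp add: euler_def)
  also have "(\<Sum>b\<in>Basis. \<Sum>c\<in>Basis. if b = c then ?x b * ?d b + ?x c * ?d c else 0) = 2 * euler f y"
    by (simp add: euler_def sum.distrib sum_distrib_left cong: sum.cong)
  finally show ?thesis by (simp add: sph_laplacian_def algebra_simps)
qed

text \<open>With one basis vector only \<open>rot_gen b b\<close> is left, which is 0. For n = 1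
  this limits the degree of harmonic polynomials.\<close>

lemma sph_laplacian_dim1:
  fixes f :: "'a::euclidean_space \<Rightarrow> complex"
  assumes "smooth f" "DIM('a) = 1"
  shows "sph_laplacian f y = 0"
proof -
  obtain b :: 'a where "Basis = {b}" using assms(2) by (auto simp: card_1_singleton_iff)
  note B = this
  have "rot_gen b b g y = 0" for g by (simp add: rot_gen_def)
  then have "2 * sph_laplacian f y = 0"
    unfolding sph_laplacian_eq_rot_gen[OF assms(1), of y] B by simp
  then show ?thesis by simp
qed

section \<open>Product rules and rotation invariance of the Laplacian\<close>

lemma laplacian_mult:
  assumes f: "smooth f" and g: "smooth g"
  shows "laplacian (\<lambda>y. f y * g y) y
    = f y * laplacian g y + 2 * (\<Sum>b\<in>Basis. dderiv b f y * dderiv b g y) + laplacian f y * g y"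
proof -
  have "dderiv b (dderiv b (\<lambda>y. f y * g y)) y
    = f y * dderiv b (dderiv b g) y + 2 * (dderiv b f y * dderiv b g y) + dderiv b (dderiv b f) y * g y" for b
  proof -
    have "dderiv b (dderiv b (\<lambda>y. f y * g y)) y = dderiv b (\<lambda>x. f x * dderiv b g x + dderiv b f x * g x) y"
      using f g by (simp add: smooth_dderiv_mult)
    also have "\<dots> = dderiv b (\<lambda>x. f x * dderiv b g x) y + dderiv b (\<lambda>x. dderiv b f x * g x) y"
      using f g by (intro dderiv_add smooth_differentiable) auto
    finally show ?thesis using f g by (simp add: smooth_dderiv_mult smooth_dderiv algebra_simps)
  qed
  then show ?thesis by (simp add: laplacian_def sum.distrib sum_distrib_left sum_distrib_right)
qed

lemma euler_mult:
  assumes f: "smooth f" and g: "smooth g"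
  shows "euler (\<lambda>y. f y * g y) y = f y * euler g y + euler f y * g y"
  using assms by (simp add: euler_def smooth_dderiv_mult sum.distrib algebra_simps sum_distrib_left)

text \<open>The images \<open>u b\<close> again form an orthonormal basis. Expanding both
  derivatives along \<open>u b\<close> in the old basis, the coefficients add up to c \<bullet> d by
  \<open>delta\<close>, which leaves the trace of the Hessian.\<close>

lemma laplacian_orthogonal:
  fixes f :: "'a::euclidean_space \<Rightarrow> complex" and u :: "'a \<Rightarrow> 'a"
  assumes f: "smooth f" and u: "orthogonal_transformation u"
  shows "laplacian (\<lambda>z. f (u z)) y = laplacian f (u y)"
proof -
  have bl: "bounded_linear u"
    using u by (simp add: linear_conv_bounded_linear[symmetric] orthogonal_transformation_linear)
  define u' where "u' = inv u"
  have u': "orthogonal_transformation u'" "u (u' x) = x" for x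
    using u by (simp_all add: u'_def orthogonal_transformation_inv orthogonal_transformation_surj surj_f_inv_f)
  have delta: "(\<Sum>b\<in>Basis. (u b \<bullet> c) * (u b \<bullet> d)) = c \<bullet> d" for c d
  proof -
    have *: "u b \<bullet> c = u' c \<bullet> b" for b c
      using u u' unfolding orthogonal_transformation_def by (metis inner_commute)
    have "(\<Sum>b\<in>Basis. (u b \<bullet> c) * (u b \<bullet> d)) = u' c \<bullet> u' d"
      unfolding * by (rule euclidean_inner[symmetric])
    then show ?thesis using u' by (simp add: orthogonal_transformation_def)
  qed
  have D: "dderiv v (dderiv v f) x = (\<Sum>c\<in>Basis. \<Sum>d\<in>Basis. of_real ((v \<bullet> c) * (v \<bullet> d)) * dderiv c (dderiv d f) x)"
    for v x
  proof -
    have "dderiv v f = (\<lambda>x. \<Sum>d\<in>Basis. of_real (v \<bullet> d) * dderiv d f x)"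
      using f by (intro ext) (simp add: dderiv_expand[of f _ v] smooth_differentiable scaleR_conv_of_real)
    then have "dderiv c (dderiv v f) x = (\<Sum>d\<in>Basis. of_real (v \<bullet> d) * dderiv c (dderiv d f) x)" for c
      using f by (simp add: smooth_dderiv_sum smooth_dderiv_cmult smooth_mult smooth_const smooth_dderiv)
    moreover have "dderiv v (dderiv v f) x = (\<Sum>c\<in>Basis. of_real (v \<bullet> c) * dderiv c (dderiv v f) x)"
      using f by (simp add: dderiv_expand[of "dderiv v f" _ v] smooth_differentiable smooth_dderiv scaleR_conv_of_real)
    ultimately show ?thesis by (simp add: sum_distrib_left mult.assoc)
  qed
  have "laplacian (\<lambda>z. f (u z)) y = (\<Sum>b\<in>Basis. dderiv (u b) (dderiv (u b) f) (u y))"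
    using f bl by (simp add: laplacian_def dderiv_linear smooth_dderiv)
  also have "\<dots> = (\<Sum>b\<in>Basis. \<Sum>c\<in>Basis. \<Sum>d\<in>Basis. of_real ((u b \<bullet> c) * (u b \<bullet> d)) * dderiv c (dderiv d f) (u y))"
    unfolding D ..
  also have "\<dots> = (\<Sum>c\<in>Basis. \<Sum>d\<in>Basis. \<Sum>b\<in>Basis. of_real ((u b \<bullet> c) * (u b \<bullet> d)) * dderiv c (dderiv d f) (u y))"
    by (subst sum.swap) (intro sum.cong refl sum.swap)
  also have "\<dots> = (\<Sum>c\<in>Basis. \<Sum>d\<in>Basis. of_real (c \<bullet> d) * dderiv c (dderiv d f) (u y))"
    by (simp only: sum_distrib_right[symmetric] of_real_sum[symmetric] delta)
  also have "\<dots> = (\<Sum>c\<in>Basis. \<Sum>d\<in>Basis. if c = d then dderiv c (dderiv d f) (u y) else 0)"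
    by (intro sum.cong refl) (auto simp: inner_Basis)
  finally show ?thesis by (simp add: laplacian_def)
qed

section \<open>Taylor expansion along rays\<close>

text \<open>Derivatives of all orders given as data. A chain is determined by \<open>g 0\<close>, so
  Taylor coefficients are computed by exhibiting any chain that starts with the right
  function.\<close>

definition derivative_chain :: "(nat \<Rightarrow> real \<Rightarrow> complex) \<Rightarrow> bool" where
  "derivative_chain g \<longleftrightarrow> (\<forall>j t. (g j has_vector_derivative g (Suc j) t) (at t))"

text \<open>The Taylor coefficient of order \<open>j\<close> on the ray through \<open>w\<close>,
  without the factor 1/j!. For smooth \<open>f\<close> it is a homogeneous polynomial in
  \<open>w\<close> of degree \<open>j\<close>.\<close>

definition jet :: "nat \<Rightarrow> ('a::euclidean_space \<Rightarrow> complex) \<Rightarrow> 'a \<Rightarrow> complex" where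
  "jet j f w = (dderiv w ^^ j) f 0"

lemma derivative_chainD: "derivative_chain g \<Longrightarrow> (g j has_vector_derivative g (Suc j) t) (at t)"
  by (simp add: derivative_chain_def)

lemma derivative_chain_unique:
  assumes "derivative_chain g" "derivative_chain h" "\<And>t. g 0 t = h 0 t"
  shows "g j t = h j t"
proof (induction j arbitrary: t)
  case (Suc j)
  then have "g j = h j" by (simp add: fun_eq_iff)
  then show ?case
    using derivative_chainD[OF assms(1), of j t] derivative_chainD[OF assms(2), of j t]
      vector_derivative_unique_at by metis
qed (rule assms(3))

lemma derivative_chain_add:
  "derivative_chain g \<Longrightarrow> derivative_chain h \<Longrightarrow> derivative_chain (\<lambda>j t. g j t + h j t)"
  by (auto simp: derivative_chain_def intro: has_vector_derivative_add)

lemma derivative_chain_cmult: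
  "derivative_chain g \<Longrightarrow> derivative_chain (\<lambda>j t. c * g j t)"
  by (auto simp: derivative_chain_def intro: has_vector_derivative_mult_right)

text \<open>Leibniz' rule for t g(t). At j = 0 the truncated index \<open>j - 1\<close> carries the
  factor 0.\<close>

lemma derivative_chain_times_id:
  assumes "derivative_chain g"
  shows "derivative_chain (\<lambda>j t. of_real t * g j t + of_nat j * g (j - 1) t)"
proof -
  have *: "((\<lambda>t. of_real t * g j t) has_vector_derivative of_real t * g (Suc j) t + g j t) (at t)" for j t
    using has_vector_derivative_mult[OF has_vector_derivative_of_real[OF DERIV_ident]
        derivative_chainD[OF assms]] by simp
  have "((\<lambda>t. of_nat j * g (j - 1) t) has_vector_derivative of_nat j * g j t) (at t)" for j t
    using derivative_chainD[OF assms, of "j - 1" t]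
    by (cases j) (auto intro!: has_vector_derivative_mult_right)
  from has_vector_derivative_add[OF * this] show ?thesis
    by (auto simp: derivative_chain_def algebra_simps)
qed

lemma smooth_funpow_dderiv: "smooth f \<Longrightarrow> smooth ((dderiv w ^^ j) f)"
  by (induction j) auto

lemma has_vector_derivative_ray:
  assumes "smooth f"
  shows "((\<lambda>t. f (t *\<^sub>R w)) has_vector_derivative dderiv w f (t *\<^sub>R w)) (at t)"
proof -
  have "((\<lambda>t. t *\<^sub>R w) has_derivative (\<lambda>h. h *\<^sub>R w)) (at t)"
    by (auto intro!: derivative_eq_intros)
  from has_derivative_compose[OF this smooth_has_derivative[OF assms]]
  show ?thesis
    by (simp add: has_vector_derivative_def dderiv_scaleR smooth_differentiable assms)
qed

lemma derivative_chain_ray: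
  "smooth f \<Longrightarrow> derivative_chain (\<lambda>j t. (dderiv w ^^ j) f (t *\<^sub>R w))"
  by (auto simp: derivative_chain_def intro: has_vector_derivative_ray[OF smooth_funpow_dderiv])

lemma jet_eq_chain:
  assumes "smooth f" "derivative_chain g" "\<And>t. g 0 t = f (t *\<^sub>R w)"
  shows "jet j f w = g j 0"
  using derivative_chain_unique[OF assms(2) derivative_chain_ray[OF assms(1), of w], of j 0] assms(3)
  by (simp add: jet_def)

lemma jet_0 [simp]: "jet 0 f w = f 0"
  by (simp add: jet_def)

lemma jet_add:
  "smooth f \<Longrightarrow> smooth g \<Longrightarrow> jet j (\<lambda>y. f y + g y) w = jet j f w + jet j g w"
  using jet_eq_chain[OF smooth_add[of f g] derivative_chain_add[OF derivative_chain_ray[of f w]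
      derivative_chain_ray[of g w]], of w j]
  by (simp add: jet_def)

lemma jet_cmult:
  "smooth f \<Longrightarrow> jet j (\<lambda>y. c * f y) w = c * jet j f w"
  using jet_eq_chain[OF smooth_mult[OF smooth_const[of c], of f]
      derivative_chain_cmult[OF derivative_chain_ray[of f w], of c], of w j]
  by (simp add: jet_def)

lemma jet_diff:
  "smooth f \<Longrightarrow> smooth g \<Longrightarrow> jet j (\<lambda>y. f y - g y) w = jet j f w - jet j g w"
  using jet_add[of f "\<lambda>y. (-1) * g y" j w] jet_cmult[of g j "-1" w] smooth_mult[OF smooth_const, of g "-1"]
  by simp

lemma jet_sum:
  "(\<And>i. i \<in> A \<Longrightarrow> smooth (f i)) \<Longrightarrow> jet j (\<lambda>y. \<Sum>i\<in>A. f i y) w = (\<Sum>i\<in>A. jet j (f i) w)"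
proof (induction A rule: infinite_finite_induct)
  case (insert x F)
  then show ?case by (simp add: jet_add smooth_sum)
qed (use jet_cmult[OF smooth_const, of j 0 0 w] in auto)

lemma jet_Suc: "jet (Suc j) f w = jet j (dderiv w f) w"
  by (simp add: jet_def funpow_swap1)

lemma jet_scaleR:
  "smooth f \<Longrightarrow> jet j f (r *\<^sub>R w) = of_real r ^ j * jet j f w"
proof (induction j arbitrary: f)
  case (Suc j)
  have "dderiv (r *\<^sub>R w) f = (\<lambda>y. of_real r * dderiv w f y)"
    using Suc.prems by (simp add: fun_eq_iff dderiv_scaleR smooth_differentiable scaleR_conv_of_real)
  then show ?case
    using Suc by (simp add: jet_Suc jet_cmult smooth_dderiv smooth_mult smooth_const)
qed simp

lemma polynomial_function_jet:
  \<comment> \<open>Here \<open>w\<close> is both the direction and the variable. Expanding one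
    derivative in the basis gives linear forms in \<open>w\<close> times jets of the partial
    derivatives of lower order.\<close>
  "smooth f \<Longrightarrow> polynomial_function (jet j f)"
proof (induction j arbitrary: f)
  case 0
  then show ?case by (simp add: jet_def[abs_def])
next
  case (Suc j)
  have "jet (Suc j) f w = (\<Sum>b\<in>Basis. (w \<bullet> b) *\<^sub>R jet j (dderiv b f) w)" for w
  proof -
    have "dderiv w f = (\<lambda>y. \<Sum>b\<in>Basis. of_real (w \<bullet> b) * dderiv b f y)"
      using Suc.prems by (intro ext) (simp add: dderiv_expand[of f _ w] smooth_differentiable scaleR_conv_of_real)
    then show ?thesis
      using Suc.prems
      by (simp add: jet_Suc jet_sum jet_cmult smooth_dderiv smooth_mult smooth_const scaleR_conv_of_real)
  qed
  then have "jet (Suc j) f = (\<lambda>w. \<Sum>b\<in>Basis. (w \<bullet> b) *\<^sub>R jet j (dderiv b f) w)" by (rule ext)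
  moreover have "polynomial_function (\<lambda>w. \<Sum>b\<in>Basis. (w \<bullet> b) *\<^sub>R jet j (dderiv b f) w)"
    using Suc.IH[OF smooth_dderiv[OF Suc.prems]]
    by (intro polynomial_function_sum polynomial_function_mult)
       (auto intro: polynomial_function_bounded_linear bounded_linear_inner_left)
  ultimately show ?case by simp
qed

text \<open>Reversing the ray multiplies the jet by (-1)^j. A jet that does not vanish therefore
  forces (-1)^j = \<epsilon>.\<close>

lemma jet_parity:
  assumes "smooth f" "\<And>y. f (- y) = \<epsilon> * f y"
  shows "(-1) ^ j * jet j f w = \<epsilon> * jet j f w"
proof -
  have z: "(dderiv (- w) ^^ 0) f (t *\<^sub>R (- w)) = \<epsilon> * f (t *\<^sub>R w)" for t
    using assms(2)[of "t *\<^sub>R w"] by simp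
  have "jet j (\<lambda>y. \<epsilon> * f y) w = (dderiv (- w) ^^ j) f 0"
    using jet_eq_chain[OF smooth_mult[OF smooth_const[of \<epsilon>] assms(1)]
        derivative_chain_ray[OF assms(1), of "- w"] z, of j]
    by simp
  also have "\<dots> = jet j f ((-1) *\<^sub>R w)" by (simp add: jet_def)
  finally show ?thesis using assms(1) by (simp only: jet_scaleR jet_cmult) simp
qed

lemma jet_times_param:
  assumes "smooth f" "smooth e" "\<And>t. e (t *\<^sub>R w) = of_real t * f (t *\<^sub>R w)"
  shows "jet j e w = of_nat j * jet (j - 1) f w"
  using jet_eq_chain[OF assms(2) derivative_chain_times_id[OF derivative_chain_ray[OF assms(1), of w]]] assms(3)
  by (simp add: jet_def)

lemma euler_ray:
  "smooth f \<Longrightarrow> euler f (t *\<^sub>R w) = of_real t * dderiv w f (t *\<^sub>R w)"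
  by (simp add: euler_eq_dderiv dderiv_scaleR smooth_differentiable scaleR_conv_of_real)

lemma jet_euler:
  assumes "smooth f"
  shows "jet j (euler f) w = of_nat j * jet j f w"
  using jet_times_param[OF smooth_dderiv[OF assms] smooth_euler[OF assms] euler_ray[OF assms]]
  by (cases j) (simp_all add: jet_Suc)

lemma norm_sq_0 [simp]: "norm_sq 0 = 0"
  by (simp add: norm_sq_def)

lemma norm_sq_scaleR: "norm_sq (t *\<^sub>R w) = of_real t ^ 2 * norm_sq w"
  by (simp add: norm_sq_def power_mult_distrib flip: of_real_power)

lemma coord_ray: "coord w (t *\<^sub>R w) = of_real t * norm_sq w"
  by (simp add: norm_sq_def coord_def power2_norm_eq_inner)

text \<open>On the ray, \<open>norm_sq y\<close> is t times \<open>coord w y\<close>, which is t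
  times the constant \<open>norm_sq w\<close>. Each factor t lowers the order by one, and the
  truncated differences are harmless as j(j - 1) vanishes there.\<close>

lemma jet_norm_sq_mult:
  assumes f: "smooth f"
  shows "jet j (\<lambda>y. norm_sq y * f y) w
    = norm_sq w * of_nat j * of_nat (j - 1) * jet (j - 2) f w"
proof -
  have s: "smooth (\<lambda>y. norm_sq w * f y)" "smooth (\<lambda>y. coord w y * f y)" "smooth (\<lambda>y. norm_sq y * f y)"
    using f by auto
  have "jet j (\<lambda>y. norm_sq y * f y) w = of_nat j * jet (j - 1) (\<lambda>y. coord w y * f y) w"
    using s by (intro jet_times_param)
      (auto simp: norm_sq_scaleR coord_ray power2_eq_square)
  also have "jet (j - 1) (\<lambda>y. coord w y * f y) w = of_nat (j - 1) * jet (j - 1 - 1) (\<lambda>y. norm_sq w * f y) w"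
    using s by (intro jet_times_param)
      (auto simp: norm_sq_scaleR coord_ray power2_eq_square)
  finally show ?thesis using f by (simp add: jet_cmult numeral_2_eq_2)
qed

text \<open>The indicial equation with an inhomogeneity \<open>H\<close>. The terms with \<alpha>
  and \<beta> carry powers of \<rho>^2 and hence see only jets of lower order.\<close>

lemma jet_leading:
  fixes G :: "'a::euclidean_space \<Rightarrow> complex"
  assumes G: "smooth G" and H: "smooth H"
    and ode: "\<And>y. euler (euler G) y + b * euler G y + H y
      = (\<kappa> + \<alpha> * norm_sq y + \<beta> * (norm_sq y)\<^sup>2) * G y"
    and low: "\<And>i. i < j \<Longrightarrow> jet i G w = 0"
  shows "(of_nat j * of_nat j + b * of_nat j - \<kappa>) * jet j G w + jet j H w = 0"
proof -
  have "jet j (\<lambda>y. (euler (euler G) y + b * euler G y) + H y) w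
    = (of_nat j * of_nat j + b * of_nat j) * jet j G w + jet j H w"
    using G H by (simp add: jet_add jet_cmult jet_euler smooth_euler smooth_mult smooth_const
        smooth_add algebra_simps)
  moreover have "jet j (\<lambda>y. \<kappa> * G y + (\<alpha> * (norm_sq y * G y) + \<beta> * (norm_sq y * (norm_sq y * G y)))) w
    = \<kappa> * jet j G w + (\<alpha> * jet j (\<lambda>y. norm_sq y * G y) w
      + \<beta> * jet j (\<lambda>y. norm_sq y * (norm_sq y * G y)) w)"
    using G by (simp add: jet_add jet_cmult smooth_mult smooth_const smooth_add smooth_norm_sq)
  moreover have "jet j (\<lambda>y. norm_sq y * G y) w = 0"
    using low[of "j - 2"] G by (cases "j = 0") (auto simp: jet_norm_sq_mult)
  moreover have "jet j (\<lambda>y. norm_sq y * (norm_sq y * G y)) w = 0"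
    using low[of "j - 2 - 2"] G
    by (cases "j = 0") (auto simp: jet_norm_sq_mult smooth_mult smooth_norm_sq)
  moreover have "(\<lambda>y. (euler (euler G) y + b * euler G y) + H y)
    = (\<lambda>y. \<kappa> * G y + (\<alpha> * (norm_sq y * G y) + \<beta> * (norm_sq y * (norm_sq y * G y))))"
    using ode by (simp add: fun_eq_iff algebra_simps power2_eq_square)
  ultimately show ?thesis by (simp add: algebra_simps)
qed

text \<open>Every use of the mean value inequality on [0, t] gains one power of t. The bound for
  \<open>g j\<close> rests on that for \<open>g (Suc j)\<close>, so all \<open>j\<close> are treated
  together.\<close>

lemma derivative_chain_flat_bound:
  assumes g: "derivative_chain g" and flat: "\<And>j. g j 0 = 0"
  shows "\<exists>C\<ge>0. \<forall>t\<in>{0..R}. norm (g j t) \<le> C * t ^ N"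
proof (induction N arbitrary: j)
  case 0
  have "continuous_on {0..R} (g j)"
    using derivative_chainD[OF g] has_vector_derivative_continuous
    by (intro continuous_at_imp_continuous_on) blast
  then have "bounded (g j ` {0..R})"
    by (intro compact_imp_bounded compact_continuous_image) auto
  then obtain C where "\<forall>t\<in>{0..R}. norm (g j t) \<le> C" by (auto simp: bounded_iff)
  then show ?case by (intro exI[of _ "max C 0"]) auto
next
  case (Suc N)
  then obtain C where C: "C \<ge> 0" "\<forall>t\<in>{0..R}. norm (g (Suc j) t) \<le> C * t ^ N" by blast
  have "norm (g j t) \<le> C * t ^ Suc N" if t: "t \<in> {0..R}" for t
  proof -
    have "norm (g j t - g j 0) \<le> (C * t ^ N) * norm (t - 0)"
    proof (rule differentiable_bound[of "{0..t}" _ "\<lambda>x h. h *\<^sub>R g (Suc j) x"])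
      show "(g j has_derivative (\<lambda>h. h *\<^sub>R g (Suc j) x)) (at x within {0..t})" for x
        using derivative_chainD[OF g, of j x]
        by (auto simp: has_vector_derivative_def intro: has_derivative_at_withinI)
      show "onorm (\<lambda>h. h *\<^sub>R g (Suc j) x) \<le> C * t ^ N" if "x \<in> {0..t}" for x
      proof (rule onorm_le)
        fix h :: real
        have "norm (g (Suc j) x) \<le> C * x ^ N" using C t that by auto
        also have "\<dots> \<le> C * t ^ N" using C that by (intro mult_left_mono power_mono) auto
        finally show "norm (h *\<^sub>R g (Suc j) x) \<le> C * t ^ N * norm h"
          by (simp add: mult.commute mult_left_mono)
      qed
    qed (use t in auto)
    then show ?thesis using t flat by (simp add: mult_ac)
  qed
  then show ?case using C(1) by blast
qed

text \<open>The energy \<open>e t = |g|\<^sup>2 + |t g'|\<^sup>2\<close> satisfies \<open>t e' \<le> K e\<close>, so \<open>e / t ^ K\<close> decreases; by flatness it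
  tends to 0 at the origin.\<close>

lemma flat_radial_solution_zero:
  fixes g :: "nat \<Rightarrow> real \<Rightarrow> complex" and W :: "real \<Rightarrow> complex"
  assumes g: "derivative_chain g" and flat: "\<And>j. g j 0 = 0"
    and W: "continuous_on UNIV W"
    and ode: "\<And>t. of_real (t\<^sup>2) * g 2 t + b * (of_real t * g 1 t) = W t * g 0 t"
    and R: "R > 0"
  shows "g 0 R = 0"
proof -
  have "bounded (W ` {0..R})"
    using W by (intro compact_imp_bounded compact_continuous_image) (auto intro: continuous_on_subset)
  then obtain M where "\<forall>z\<in>W ` {0..R}. norm z \<le> M" unfolding bounded_iff by blast
  then have M: "\<And>t. t \<in> {0..R} \<Longrightarrow> norm (W t) \<le> M" by blast
  have "0 \<le> norm (W 0)" by simp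
  also have "\<dots> \<le> M" using R by (intro M) auto
  finally have "M \<ge> 0" .
  \<comment> \<open>By 2AB \<le> A^2 + B^2, \<open>t * e' t\<close> is at most (1 + M) + (2 + 2|b|)
    times the energy; \<open>K\<close> rounds this up to an exponent.\<close>
  obtain K :: nat where K: "real K \<ge> 3 + M + 2 * norm b" using real_arch_simple by blast
  have "K > 0" using K \<open>M \<ge> 0\<close> norm_ge_zero[of b] by (cases K) auto
  define e where "e t = (norm (g 0 t))\<^sup>2 + t\<^sup>2 * (norm (g 1 t))\<^sup>2" for t
  define e' where "e' t = 2 * (g 0 t \<bullet> g 1 t) + (2 * t * (norm (g 1 t))\<^sup>2 + t\<^sup>2 * (2 * (g 1 t \<bullet> g 2 t)))" for t
  have d: "((\<lambda>t. (norm (g j t))\<^sup>2) has_real_derivative 2 * (g j t \<bullet> g (Suc j) t)) (at t)" for j t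
  proof -
    have "((\<lambda>t. g j t \<bullet> g j t) has_derivative (\<lambda>h. g j t \<bullet> (h *\<^sub>R g (Suc j) t) + (h *\<^sub>R g (Suc j) t) \<bullet> g j t)) (at t)"
      using derivative_chainD[OF g, of j t] unfolding has_vector_derivative_def
      by (intro has_derivative_inner) auto
    moreover have "(\<lambda>h. g j t \<bullet> (h *\<^sub>R g (Suc j) t) + (h *\<^sub>R g (Suc j) t) \<bullet> g j t)
        = (*) (2 * (g j t \<bullet> g (Suc j) t))"
      by (simp add: fun_eq_iff inner_commute)
    ultimately show ?thesis
      unfolding has_field_derivative_def power2_norm_eq_inner by simp
  qed
  have de: "(e has_real_derivative e' t) (at t)" for t
    unfolding e_def[abs_def] e'_def
    by (rule derivative_eq_intros d refl)+ (simp add: numeral_2_eq_2)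
  have bound: "t * e' t \<le> K * e t" if t: "t \<in> {0<..R}" for t
  proof -
    define A where "A = norm (g 0 t)"
    define B where "B = norm (of_real t * g 1 t)"
    have t0: "t > 0" using t by auto
    have AB: "A \<ge> 0" "B \<ge> 0" by (auto simp: A_def B_def)
    have B: "B = t * norm (g 1 t)" using t0 by (simp add: B_def norm_mult)
    have e: "e t = A\<^sup>2 + B\<^sup>2" by (simp add: e_def A_def B power_mult_distrib)
    have g2: "of_real (t\<^sup>2) * g 2 t = W t * g 0 t - b * (of_real t * g 1 t)"
      using ode[of t] by (simp add: algebra_simps)
    have "norm (of_real (t\<^sup>2) * g 2 t) \<le> norm (W t) * A + norm b * B"
      unfolding g2 A_def B_def norm_mult[symmetric] by (rule norm_triangle_ineq4)
    also have "\<dots> \<le> M * A + norm b * B"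
      using M[of t] t AB by (intro add_right_mono mult_right_mono) auto
    finally have n2: "norm (of_real (t\<^sup>2) * g 2 t) \<le> M * A + norm b * B" .
    have i1: "g 0 t \<bullet> (of_real t * g 1 t) \<le> A * B"
      unfolding A_def B_def by (rule norm_cauchy_schwarz)
    have "(of_real t * g 1 t) \<bullet> (of_real (t\<^sup>2) * g 2 t) \<le> B * norm (of_real (t\<^sup>2) * g 2 t)"
      unfolding B_def by (rule norm_cauchy_schwarz)
    also have "\<dots> \<le> B * (M * A + norm b * B)" using n2 AB by (intro mult_left_mono)
    finally have i2: "(of_real t * g 1 t) \<bullet> (of_real (t\<^sup>2) * g 2 t) \<le> B * (M * A + norm b * B)" .
    have "t * e' t = 2 * (g 0 t \<bullet> (of_real t * g 1 t)) + 2 * B\<^sup>2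
      + 2 * ((of_real t * g 1 t) \<bullet> (of_real (t\<^sup>2) * g 2 t))"
      by (simp add: e'_def B scaleR_conv_of_real[symmetric] power2_eq_square algebra_simps)
    also have "\<dots> \<le> 2 * (A * B) + 2 * B\<^sup>2 + 2 * (B * (M * A + norm b * B))"
      using i1 i2 by (intro add_mono mult_left_mono) auto
    also have "\<dots> = (1 + M) * (2 * A * B) + (2 + 2 * norm b) * B\<^sup>2"
      by (simp add: algebra_simps power2_eq_square)
    also have "\<dots> \<le> (1 + M) * (A\<^sup>2 + B\<^sup>2) + (2 + 2 * norm b) * (A\<^sup>2 + B\<^sup>2)"
      using \<open>M \<ge> 0\<close> by (intro add_mono mult_left_mono sum_squares_bound) auto
    also have "\<dots> = (3 + M + 2 * norm b) * e t" by (simp add: e algebra_simps)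
    also have "\<dots> \<le> K * e t" using K by (intro mult_right_mono) (auto simp: e)
    finally show ?thesis .
  qed
  obtain C0 where C0: "C0 \<ge> 0" "\<And>t. t \<in> {0..R} \<Longrightarrow> norm (g 0 t) \<le> C0 * t ^ K"
    using derivative_chain_flat_bound[OF g flat, of R 0 K] by blast
  obtain C1 where C1: "C1 \<ge> 0" "\<And>t. t \<in> {0..R} \<Longrightarrow> norm (g 1 t) \<le> C1 * t ^ K"
    using derivative_chain_flat_bound[OF g flat, of R 1 K] by blast
  \<comment> \<open>Flatness to order \<open>K\<close> makes the energy O(s^(2K)), so a factor s^K
    survives the division.\<close>
  have small: "e s / s ^ K \<le> (C0\<^sup>2 + R\<^sup>2 * C1\<^sup>2) * s ^ K" if s: "s \<in> {0<..R}" for s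
  proof -
    have "e s \<le> (C0 * s ^ K)\<^sup>2 + R\<^sup>2 * (C1 * s ^ K)\<^sup>2"
      unfolding e_def using s C0(2)[of s] C1(2)[of s]
      by (intro add_mono mult_mono power_mono) auto
    also have "\<dots> = (C0\<^sup>2 + R\<^sup>2 * C1\<^sup>2) * s ^ K * s ^ K"
      by (simp add: power_mult_distrib algebra_simps power2_eq_square)
    finally show ?thesis using s by (simp add: divide_simps)
  qed
  have dec: "e R / R ^ K \<le> e s / s ^ K" if s: "s \<in> {0<..R}" for s
  proof (rule DERIV_nonpos_imp_nonincreasing[of s R "\<lambda>t. e t / t ^ K"])
    fix t assume t: "s \<le> t" "t \<le> R"
    have t0: "t > 0" using s t by auto
    have "((\<lambda>t. e t / t ^ K) has_real_derivative
        (e' t * t ^ K - e t * (real K * t ^ (K - 1))) / (t ^ K * t ^ K)) (at t)"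
      using t0 by (auto intro!: derivative_eq_intros de)
    moreover have "(e' t * t ^ K - e t * (real K * t ^ (K - 1))) = (t * e' t - K * e t) * t ^ (K - 1)"
      using \<open>K > 0\<close> by (cases K) (auto simp: algebra_simps)
    moreover have "t * e' t - K * e t \<le> 0" using bound[of t] t0 t by auto
    ultimately show "\<exists>y. ((\<lambda>t. e t / t ^ K) has_real_derivative y) (at t) \<and> y \<le> 0"
      using t0 by (intro exI conjI) (assumption, auto simp: divide_le_0_iff mult_le_0_iff)
  qed (use s in auto)
  have "((\<lambda>s. (C0\<^sup>2 + R\<^sup>2 * C1\<^sup>2) * s ^ K) \<longlongrightarrow> (C0\<^sup>2 + R\<^sup>2 * C1\<^sup>2) * 0 ^ K) (at_right 0)"
    by (intro tendsto_intros)
  moreover have "eventually (\<lambda>s. e R / R ^ K \<le> (C0\<^sup>2 + R\<^sup>2 * C1\<^sup>2) * s ^ K) (at_right 0)"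
    unfolding eventually_at_right_field using R dec small by (intro exI[of _ R]) force
  ultimately have "e R / R ^ K \<le> (C0\<^sup>2 + R\<^sup>2 * C1\<^sup>2) * 0 ^ K"
    by (intro tendsto_lowerbound) auto
  then have "e R / R ^ K \<le> 0" using \<open>K > 0\<close> by (simp add: zero_power)
  then have "e R \<le> 0" using pos_divide_le_eq[of "R ^ K" "e R" 0] R by simp
  moreover have "(norm (g 0 R))\<^sup>2 \<le> e R" by (simp add: e_def)
  ultimately have "(norm (g 0 R))\<^sup>2 \<le> 0" by linarith
  then show ?thesis by simp
qed

lemma flat_solution_zero:
  fixes G :: "'a::euclidean_space \<Rightarrow> complex"
  assumes G: "smooth G"
    and ode: "\<And>y. euler (euler G) y + b * euler G y
      = (\<kappa> + \<alpha> * norm_sq y + \<beta> * (norm_sq y)\<^sup>2) * G y"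
    and flat: "\<And>j w. jet j G w = 0"
  shows "G y = 0"
proof -
  define g where "g j t = (dderiv y ^^ j) G (t *\<^sub>R y)" for j t
  have g: "derivative_chain g"
    unfolding g_def[abs_def] using G by (rule derivative_chain_ray)
  have E: "euler G (t *\<^sub>R y) = of_real t * g 1 t" for t
    using G by (simp add: euler_ray g_def)
  have "dderiv y (euler G) (t *\<^sub>R y) = of_real t * g 2 t + g 1 t" for t
  proof -
    have "((\<lambda>t. euler G (t *\<^sub>R y)) has_vector_derivative of_real t * g (Suc 1) t + g 1 t) (at t)"
      unfolding E using has_vector_derivative_mult[OF has_vector_derivative_of_real[OF DERIV_ident]
        derivative_chainD[OF g]] by simp
    then show ?thesis
      using has_vector_derivative_ray[OF smooth_euler[OF G]] vector_derivative_unique_at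
      by (metis Suc_1)
  qed
  then have EE: "euler (euler G) (t *\<^sub>R y) = of_real (t\<^sup>2) * g 2 t + of_real t * g 1 t" for t
    using G by (simp add: euler_ray smooth_euler power2_eq_square algebra_simps)
  \<comment> \<open>On the ray \<open>euler\<close> is t d/dt, and its square contributes t g'
    besides t^2 g''. The coefficient b therefore becomes 1 + b.\<close>
  have "g 0 1 = 0"
  proof (rule flat_radial_solution_zero[OF g, of "\<lambda>t. \<kappa> + \<alpha> * norm_sq (t *\<^sub>R y) + \<beta> * (norm_sq (t *\<^sub>R y))\<^sup>2" "1 + b"])
    show "of_real (t\<^sup>2) * g 2 t + (1 + b) * (of_real t * g 1 t)
      = (\<kappa> + \<alpha> * norm_sq (t *\<^sub>R y) + \<beta> * (norm_sq (t *\<^sub>R y))\<^sup>2) * g 0 t" for t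
      using ode[of "t *\<^sub>R y"] by (simp add: E EE algebra_simps) (simp add: g_def)
    show "g j 0 = 0" for j
      using flat[of j y] by (simp add: g_def jet_def)
    show "continuous_on UNIV (\<lambda>t. \<kappa> + \<alpha> * norm_sq (t *\<^sub>R y) + \<beta> * (norm_sq (t *\<^sub>R y))\<^sup>2)"
      unfolding norm_sq_def by (intro continuous_intros)
  qed simp
  then show ?thesis by (simp add: g_def)
qed

section \<open>Homogeneous polynomials\<close>

lemma real_polynomial_function_has_derivative:
  fixes p :: "'a::euclidean_space \<Rightarrow> real"
  assumes "real_polynomial_function p"
  shows "\<exists>p'. (\<forall>v. real_polynomial_function (p' v)) \<and> (\<forall>x. (p has_derivative (\<lambda>v. p' v x)) (at x))"
  using assms
proof induction
  case (linear f)
  then show ?case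
    by (intro exI[of _ "\<lambda>v x. f v"]) (auto intro: real_polynomial_function.intros bounded_linear_imp_has_derivative)
next
  case (const c)
  show ?case
    by (intro exI[of _ "\<lambda>v x. 0"]) (auto intro: real_polynomial_function.intros)
next
  case (add f g)
  then obtain f' g' where f': "\<And>v. real_polynomial_function (f' v)" "\<And>x. (f has_derivative (\<lambda>v. f' v x)) (at x)"
    and g': "\<And>v. real_polynomial_function (g' v)" "\<And>x. (g has_derivative (\<lambda>v. g' v x)) (at x)"
    by blast
  then show ?case
    by (intro exI[of _ "\<lambda>v x. f' v x + g' v x"])
      (auto intro: real_polynomial_function.intros(3) has_derivative_add)
next
  case (mult f g)
  then obtain f' g' where f': "\<And>v. real_polynomial_function (f' v)" "\<And>x. (f has_derivative (\<lambda>v. f' v x)) (at x)"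
    and g': "\<And>v. real_polynomial_function (g' v)" "\<And>x. (g has_derivative (\<lambda>v. g' v x)) (at x)"
    by blast
  then show ?case using mult.hyps
    by (intro exI[of _ "\<lambda>v x. f x * g' v x + f' v x * g x"])
      (auto intro: has_derivative_mult
        real_polynomial_function.intros(3)[OF real_polynomial_function.intros(4) real_polynomial_function.intros(4)])
qed

lemma polynomial_function_Complex:
  assumes "real_polynomial_function p" "real_polynomial_function q"
  shows "polynomial_function (\<lambda>x. Complex (p x) (q x))"
proof -
  have "polynomial_function (\<lambda>x. p x *\<^sub>R 1 + q x *\<^sub>R \<i>)"
    using assms by (intro polynomial_function_add polynomial_function_mult polynomial_function_const)
      (simp_all add: real_polynomial_function_eq)
  moreover have "(\<lambda>x. p x *\<^sub>R 1 + q x *\<^sub>R \<i>) = (\<lambda>x. Complex (p x) (q x))"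
    by (simp add: fun_eq_iff complex_eq_iff)
  ultimately show ?thesis by simp
qed

lemma polynomial_function_Re_Im:
  assumes "polynomial_function h"
  shows "real_polynomial_function (\<lambda>x. Re (h x))" "real_polynomial_function (\<lambda>x. Im (h x))"
  using assms bounded_linear_Re bounded_linear_Im unfolding polynomial_function_def
  by (auto simp: o_def)

lemma polynomial_function_dderiv:
  fixes h :: "'a::euclidean_space \<Rightarrow> complex"
  assumes "polynomial_function h"
  shows "h differentiable (at x)" "polynomial_function (dderiv v h)"
proof -
  obtain p' q' where p': "\<And>v. real_polynomial_function (p' v)"
      "\<And>x. ((\<lambda>x. Re (h x)) has_derivative (\<lambda>v. p' v x)) (at x)"
    and q': "\<And>v. real_polynomial_function (q' v)"
      "\<And>x. ((\<lambda>x. Im (h x)) has_derivative (\<lambda>v. q' v x)) (at x)"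
    using polynomial_function_Re_Im[OF assms, THEN real_polynomial_function_has_derivative] by blast
  have d: "(h has_derivative (\<lambda>v. Complex (p' v x) (q' v x))) (at x)" for x
  proof -
    have "((\<lambda>x. of_real (Re (h x)) + \<i> * of_real (Im (h x))) has_derivative
      (\<lambda>v. of_real (p' v x) + \<i> * of_real (q' v x))) (at x)"
      by (intro derivative_intros p' q')
    then show ?thesis by (simp add: complex_eq_iff Complex_eq flip: complex_eq)
  qed
  then show "h differentiable (at x)" by (auto simp: differentiable_def)
  have "dderiv v h = (\<lambda>x. Complex (p' v x) (q' v x))"
    by (intro ext dderiv_eq d)
  then show "polynomial_function (dderiv v h)"
    using p' q' by (simp add: polynomial_function_Complex)
qed

lemma smooth_polynomial_function:
  fixes h :: "'a::euclidean_space \<Rightarrow> complex"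
  assumes "polynomial_function h"
  shows "smooth h"
proof -
  have "times_cont_diff k h" for k
    using assms
    by (induction k arbitrary: h) (auto intro: polynomial_function_dderiv continuous_on_polymonial_function)
  then show ?thesis by (simp add: smooth_def)
qed

lemma polynomial_function_laplacian:
  fixes h :: "'a::euclidean_space \<Rightarrow> complex"
  assumes "polynomial_function h"
  shows "polynomial_function (laplacian h)"
  unfolding laplacian_def[abs_def]
  using assms by (intro polynomial_function_sum polynomial_function_dderiv) auto

text \<open>Integer degrees let the Laplacian lower the degree by 2 without a case distinction.
  Negative t is allowed, so the parity of the function is included.\<close>

definition homogeneous :: "int \<Rightarrow> ('a::real_normed_vector \<Rightarrow> complex) \<Rightarrow> bool" where
  "homogeneous k f \<longleftrightarrow> (\<forall>t y. t \<noteq> 0 \<longrightarrow> f (t *\<^sub>R y) = of_real t powi k * f y)"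

lemma homogeneousD: "homogeneous k f \<Longrightarrow> t \<noteq> 0 \<Longrightarrow> f (t *\<^sub>R y) = of_real t powi k * f y"
  by (simp add: homogeneous_def)

text \<open>f(y) = t^(-k) f(ty), and the right-hand side tends to 0 with t because f is continuous
  at the origin.\<close>

lemma homogeneous_negative:
  fixes f :: "'a::euclidean_space \<Rightarrow> complex"
  assumes "homogeneous k f" "continuous_on UNIV f" "k < 0"
  shows "f y = 0"
proof -
  have k: "k = - int (nat (- k))" "nat (- k) > 0" using assms(3) by auto
  have *: "f y = of_real t ^ nat (- k) * f (t *\<^sub>R y)" if "t > 0" for t
    using that homogeneousD[OF assms(1), of t y] assms(3) by (simp add: power_int_def power_inverse)
  have "isCont f 0" using assms(2) by (simp add: continuous_on_eq_continuous_at)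
  moreover have "((\<lambda>t. t *\<^sub>R y) \<longlongrightarrow> 0 *\<^sub>R y) (at_right 0)" by (intro tendsto_intros)
  ultimately have "((\<lambda>t. f (t *\<^sub>R y)) \<longlongrightarrow> f 0) (at_right 0)"
    using isCont_tendsto_compose[of 0 f] by simp
  moreover have "((\<lambda>t::real. of_real t ^ nat (- k)) \<longlongrightarrow> (of_real 0 ^ nat (- k) :: complex)) (at_right 0)"
    by (intro tendsto_intros)
  ultimately have "((\<lambda>t. of_real t ^ nat (- k) * f (t *\<^sub>R y)) \<longlongrightarrow> of_real 0 ^ nat (- k) * f 0) (at_right 0)"
    by (intro tendsto_mult)
  then have "((\<lambda>t::real. f y) \<longlongrightarrow> 0) (at_right 0)"
    using k(2) by (rule_tac Lim_transform_eventually)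
      (auto simp: zero_power eventually_at_right_field *[symmetric] intro!: exI[of _ 1])
  then show ?thesis by (simp add: tendsto_const_iff)
qed

lemma homogeneous_dderiv_dderiv:
  assumes "homogeneous k f" "smooth f" "t \<noteq> 0"
  shows "dderiv v (dderiv v f) (t *\<^sub>R y) = of_real t powi (k - 2) * dderiv v (dderiv v f) y"
proof -
  have bl: "bounded_linear (\<lambda>y. t *\<^sub>R y)" by (rule bounded_linear_scaleR_right)
  have "(\<lambda>y. f (t *\<^sub>R y)) = (\<lambda>y. of_real t powi k * f y)"
    using assms homogeneousD by (intro ext) blast
  then have "dderiv v (dderiv v (\<lambda>y. f (t *\<^sub>R y))) y = of_real t powi k * dderiv v (dderiv v f) y"
    using assms by (simp add: smooth_dderiv_cmult smooth_dderiv)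
  moreover have "dderiv v (\<lambda>y. f (t *\<^sub>R y)) = (\<lambda>y. of_real t * dderiv v f (t *\<^sub>R y))"
    if "smooth f" for f :: "'a \<Rightarrow> complex"
    using that dderiv_linear[OF bl that, of v]
    by (simp add: fun_eq_iff dderiv_scaleR smooth_differentiable scaleR_conv_of_real)
  then have "dderiv v (dderiv v (\<lambda>y. f (t *\<^sub>R y))) y = of_real t ^ 2 * dderiv v (dderiv v f) (t *\<^sub>R y)"
    using assms smooth_dderiv_cmult[OF smooth_linear[OF bl smooth_dderiv[OF assms(2)]]]
    by (simp add: smooth_dderiv power2_eq_square)
  ultimately have "of_real t ^ 2 * dderiv v (dderiv v f) (t *\<^sub>R y) = of_real t powi k * dderiv v (dderiv v f) y"
    by simp
  then show ?thesis using assms(3) by (simp add: power_int_diff field_simps)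
qed

lemma homogeneous_laplacian:
  fixes f :: "'a::euclidean_space \<Rightarrow> complex"
  assumes "homogeneous k f" "smooth f"
  shows "homogeneous (k - 2) (laplacian f)"
  using homogeneous_dderiv_dderiv[OF assms]
  by (simp add: homogeneous_def laplacian_def sum_distrib_left)

lemma homogeneous_euler:
  fixes f :: "'a::euclidean_space \<Rightarrow> complex"
  assumes "homogeneous (int d) f" "smooth f"
  shows "euler f y = of_nat d * f y"
proof -
  have "((\<lambda>t. f (t *\<^sub>R y)) has_vector_derivative dderiv y f (1 *\<^sub>R y)) (at 1)"
    using assms(2) by (rule has_vector_derivative_ray)
  moreover have "((\<lambda>t. f (t *\<^sub>R y)) has_vector_derivative of_nat d * f y) (at 1)"
  proof (rule has_vector_derivative_transform_within_open[of "\<lambda>t. of_real (t ^ d) * f y" _ _ "{0<..}"])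
    have "((\<lambda>t::real. t ^ d) has_real_derivative of_nat d) (at 1)"
      by (auto intro!: derivative_eq_intros)
    from has_vector_derivative_mult_left[OF has_vector_derivative_of_real[OF this], of "f y"]
    show "((\<lambda>t. of_real (t ^ d) * f y) has_vector_derivative of_nat d * f y) (at 1)" by simp
    show "complex_of_real (t ^ d) * f y = f (t *\<^sub>R y)" if "t \<in> {0<..}" for t
      using that homogeneousD[OF assms(1), of t y] by simp
  qed auto
  ultimately show ?thesis
    using assms(2) vector_derivative_unique_at by (metis euler_eq_dderiv scaleR_one)
qed

section \<open>Products of a homogeneous function with a radial function\<close>

lemma deriv_holomorphic_UNIV: "\<phi> holomorphic_on UNIV \<Longrightarrow> deriv \<phi> holomorphic_on UNIV"
  by (intro holomorphic_deriv) auto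

lemma laplacian_cmult:
  "smooth f \<Longrightarrow> laplacian (\<lambda>y. c * f y) y = c * laplacian f y"
  by (simp add: laplacian_def smooth_dderiv_cmult smooth_dderiv sum_distrib_left)

lemma dderiv_radial:
  assumes "\<phi> holomorphic_on UNIV"
  shows "dderiv v (\<lambda>y. \<phi> (norm_sq y)) = (\<lambda>y. deriv \<phi> (norm_sq y) * (2 * coord v y))"
  using assms by (intro ext)
    (simp add: dderiv_holomorphic smooth_differentiable smooth_norm_sq dderiv_norm_sq coord_def)

lemma euler_radial:
  fixes y :: "'a::euclidean_space"
  assumes "\<phi> holomorphic_on UNIV"
  shows "euler (\<lambda>y. \<phi> (norm_sq y)) y = 2 * norm_sq y * deriv \<phi> (norm_sq y)"
  unfolding euler_def dderiv_radial[OF assms] norm_sq_eq[of y]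
  by (simp add: sum_distrib_left sum_distrib_right mult_ac)

lemma laplacian_radial:
  fixes y :: "'a::euclidean_space"
  assumes "\<phi> holomorphic_on UNIV"
  shows "laplacian (\<lambda>y. \<phi> (norm_sq y)) y
    = 4 * norm_sq y * deriv (deriv \<phi>) (norm_sq y) + 2 * of_nat DIM('a) * deriv \<phi> (norm_sq y)"
proof -
  let ?x = "\<lambda>b. coord b y"
  have h: "deriv \<phi> holomorphic_on UNIV" using assms by (rule deriv_holomorphic_UNIV)
  have "dderiv b (dderiv b (\<lambda>y. \<phi> (norm_sq y))) y
    = 4 * (?x b * ?x b) * deriv (deriv \<phi>) (norm_sq y) + 2 * deriv \<phi> (norm_sq y)" if "b \<in> Basis" for b
  proof -
    have s: "smooth (\<lambda>y. deriv \<phi> (norm_sq y))" "smooth (\<lambda>y. 2 * coord b y)"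
      using h by (auto intro: smooth_holomorphic)
    show ?thesis
      unfolding dderiv_radial[OF assms] smooth_dderiv_mult[OF s]
      using that by (simp add: dderiv_radial[OF h] smooth_dderiv_cmult smooth_coord coord_Basis algebra_simps)
  qed
  then have "laplacian (\<lambda>y. \<phi> (norm_sq y)) y
    = (\<Sum>b\<in>(Basis::'a set). 4 * (?x b * ?x b) * deriv (deriv \<phi>) (norm_sq y) + 2 * deriv \<phi> (norm_sq y))"
    unfolding laplacian_def by (intro sum.cong refl)
  then show ?thesis
    by (simp add: sum.distrib norm_sq_eq[of y] sum_distrib_left sum_distrib_right)
qed

lemma euler_homogeneous_radial:
  fixes h :: "'a::euclidean_space \<Rightarrow> complex"
  assumes "\<phi> holomorphic_on UNIV" "homogeneous (int d) h" "smooth h"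
  shows "euler (\<lambda>y. h y * \<phi> (norm_sq y)) y
    = h y * (2 * norm_sq y * deriv \<phi> (norm_sq y) + of_nat d * \<phi> (norm_sq y))"
  using assms by (simp add: euler_mult smooth_holomorphic smooth_norm_sq homogeneous_euler euler_radial algebra_simps)

text \<open>The gradient of the radial function is a multiple of the position vector, so the cross
  term is 4 \<phi>'(\<rho>^2) times the Euler derivative of h. This is the source of
  \<open>4 * of_nat d\<close>.\<close>

lemma laplacian_homogeneous_radial:
  fixes h :: "'a::euclidean_space \<Rightarrow> complex"
  assumes "\<phi> holomorphic_on UNIV" "homogeneous (int d) h" "smooth h"
  shows "laplacian (\<lambda>y. h y * \<phi> (norm_sq y)) y
    = laplacian h y * \<phi> (norm_sq y) + h y * (4 * norm_sq y * deriv (deriv \<phi>) (norm_sq y)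
      + (4 * of_nat d + 2 * of_nat DIM('a)) * deriv \<phi> (norm_sq y))"
proof -
  have "(\<Sum>b\<in>Basis. dderiv b h y * dderiv b (\<lambda>y. \<phi> (norm_sq y)) y)
    = 2 * deriv \<phi> (norm_sq y) * euler h y"
    by (simp add: dderiv_radial[OF assms(1)] euler_def sum_distrib_left algebra_simps)
  then show ?thesis
    using assms by (simp add: laplacian_mult smooth_holomorphic smooth_norm_sq laplacian_radial
        homogeneous_euler algebra_simps)
qed

lemma continuous_eq_zero_off_origin:
  fixes f :: "'a::euclidean_space \<Rightarrow> complex"
  assumes "continuous_on UNIV f" "\<And>y. y \<noteq> 0 \<Longrightarrow> f y = 0"
  shows "f y = 0"
proof (cases "y = 0")
  case True
  have "f \<midarrow>0\<rightarrow> f 0" using assms(1) by (simp add: continuous_on_eq_continuous_at isCont_def)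
  moreover have "f \<midarrow>0\<rightarrow> 0"
    by (rule Lim_transform_eventually[OF tendsto_const]) (auto simp: assms(2) eventually_at_filter)
  ultimately show ?thesis using True LIM_unique by blast
qed (rule assms(2))

lemma norm_sq_eq_0_iff [simp]: "norm_sq y = 0 \<longleftrightarrow> y = 0"
  by (simp add: norm_sq_def)

lemma harmonic_polyI:
  "polynomial_function h \<Longrightarrow> (\<And>y. laplacian h y = 0) \<Longrightarrow> homogeneous k h \<Longrightarrow> h \<in> harmonic_poly k"
  by (simp add: harmonic_poly_def homogeneous_def)

lemma harmonic_polyD:
  assumes "h \<in> harmonic_poly k"
  shows "polynomial_function h" "smooth h" "laplacian h y = 0" "homogeneous k h"
  using assms smooth_polynomial_function by (auto simp: harmonic_poly_def homogeneous_def)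

text \<open>Descent on the degree: if \<open>\<nu> \<noteq> 0\<close>, then \<open>h\<close> is \<open>\<rho>\<^sup>2\<close> times its Laplacian, which is again an
  eigenvector.\<close>

lemma eigenpolynomial_decomposition:
  fixes h :: "real^'n \<Rightarrow> complex"
  assumes "polynomial_function h" "homogeneous (int d) h"
    "\<And>y. norm_sq y * laplacian h y = \<nu> * h y" "h y0 \<noteq> 0"
  shows "\<exists>l k p. d = 2 * l + k \<and> p \<in> harmonic_poly (int k) \<and> h = (\<lambda>y. norm_sq y ^ l * p y) \<and>
    \<nu> = 2 * of_nat l * (2 * of_nat l + 2 * of_nat k + of_nat CARD('n) - 2)"
  using assms
proof (induction d arbitrary: h \<nu> y0 rule: less_induct)
  case (less d)
  let ?q = "laplacian h"
  have h: "smooth h" using less.prems(1) by (rule smooth_polynomial_function)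
  show ?case
  proof (cases "\<nu> = 0")
    case True
    then have "?q y = 0" if "y \<noteq> 0" for y
      using less.prems(3)[of y] that by simp
    then have "?q y = 0" for y
      using continuous_eq_zero_off_origin[OF smooth_continuous_on[OF smooth_laplacian[OF h]]] by blast
    then have "h \<in> harmonic_poly (int d)"
      using less.prems by (intro harmonic_polyI)
    then show ?thesis using True
      by (intro exI[of _ 0] exI[of _ d] exI[of _ h]) auto
  next
    case False
    have q: "polynomial_function ?q" "smooth ?q" "homogeneous (int d - 2) ?q"
      using less.prems h by (auto intro: polynomial_function_laplacian homogeneous_laplacian)
    have h_eq: "h = (\<lambda>y. ?q y * (norm_sq y / \<nu>))"
      using less.prems(3) False by (auto simp: fun_eq_iff field_simps)
    have q0: "?q y0 \<noteq> 0" using less.prems(4) h_eq by (metis mult_zero_left)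
    \<comment> \<open>A continuous homogeneous function of negative degree is 0, which
      \<open>?q\<close> is not.\<close>
    then have "int d - 2 \<ge> 0"
      using homogeneous_negative[OF q(3) smooth_continuous_on[OF q(2)]] by force
    then obtain d' where d': "d = d' + 2" using le_Suc_ex[of 2 d] by (auto simp: add.commute)
    have q3: "homogeneous (int d') ?q" using q(3) d' by simp
    have hol: "(\<lambda>x. x / \<nu>) holomorphic_on UNIV" by (intro holomorphic_intros) (use False in auto)
    have dv: "deriv (\<lambda>x. x / \<nu>) = (\<lambda>x. 1 / \<nu>)"
      by (intro ext DERIV_imp_deriv) (use False in \<open>auto intro!: derivative_eq_intros\<close>)
    \<comment> \<open>The Laplacian of q \<phi>(\<rho>^2) with \<phi>(x) = x/\<nu> is q again.
      Solving for the Laplacian of q shows that q has the eigenvalue \<nu> - 4d' - 2n.\<close>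
    have "?q y = laplacian (\<lambda>y. ?q y * (norm_sq y / \<nu>)) y" for y
      using h_eq by simp
    also have "\<dots> y = laplacian ?q y * (norm_sq y / \<nu>)
        + ?q y * ((4 * of_nat d' + 2 * of_nat DIM(real^'n)) * (1 / \<nu>))" for y
      using laplacian_homogeneous_radial[OF hol q3 q(2), of y] by (simp add: dv)
    finally have q_eq: "norm_sq y * laplacian ?q y = (\<nu> - 4 * of_nat d' - 2 * of_nat CARD('n)) * ?q y" for y
      using False by (simp add: field_simps)
    obtain l k p where lk: "d' = 2 * l + k" "p \<in> harmonic_poly (int k)" "?q = (\<lambda>y. norm_sq y ^ l * p y)"
      "\<nu> - 4 * of_nat d' - 2 * of_nat CARD('n) = 2 * of_nat l * (2 * of_nat l + 2 * of_nat k + of_nat CARD('n) - 2)"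
      using less.IH[OF _ q(1) q3 q_eq q0] d' by auto
    have "homogeneous (int k) p" "smooth p" "polynomial_function p" using lk(2) harmonic_polyD by auto
    have "(\<lambda>y. p y / \<nu>) \<in> harmonic_poly (int k)"
    proof (rule harmonic_polyI)
      show "polynomial_function (\<lambda>y. p y / \<nu>)"
        using polynomial_function_compose[OF \<open>polynomial_function p\<close>
            polynomial_function_bounded_linear[OF bounded_linear_divide[of \<nu>]]]
        by (simp add: o_def)
      have "laplacian (\<lambda>y. p y / \<nu>) y = laplacian p y / \<nu>" for y
        using laplacian_cmult[OF \<open>smooth p\<close>, of "1 / \<nu>"] by simp
      then show "laplacian (\<lambda>y. p y / \<nu>) y = 0" for y by (simp add: harmonic_polyD(3)[OF lk(2)])
      show "homogeneous (int k) (\<lambda>y. p y / \<nu>)"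
        using \<open>homogeneous (int k) p\<close> by (simp add: homogeneous_def)
    qed
    moreover have "h = (\<lambda>y. norm_sq y ^ Suc l * (p y / \<nu>))"
      by (subst h_eq) (simp add: lk(3) mult_ac)
    \<comment> \<open>With d' = 2l + k, the shift 4d' + 2n is the increment of 2l(2l + 2k + n - 2)
      from l to l + 1.\<close>
    moreover have "\<nu> = 2 * of_nat (Suc l) * (2 * of_nat (Suc l) + 2 * of_nat k + of_nat CARD('n) - 2)"
    proof -
      have "\<nu> = 2 * of_nat l * (2 * of_nat l + 2 * of_nat k + of_nat CARD('n) - 2) + 4 * of_nat d' + 2 * of_nat CARD('n)"
        using lk(4) by (simp add: algebra_simps)
      then show ?thesis unfolding lk(1) by (simp add: algebra_simps)
    qed
    moreover have "d = 2 * Suc l + k" using d' lk(1) by simp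
    ultimately show ?thesis by blast
  qed
qed

section \<open>The confluent hypergeometric equation\<close>

definition hyp1F1_coeff :: "complex \<Rightarrow> complex \<Rightarrow> nat \<Rightarrow> complex" where
  "hyp1F1_coeff a b j = pochhammer a j / pochhammer b j / fact j"

lemma hyp1F1_eq: "hyp1F1 a b z = (\<Sum>j. hyp1F1_coeff a b j * z ^ j)"
  by (simp add: hyp1F1_def hyp1F1_coeff_def)

lemma hyp1F1_0 [simp]: "hyp1F1 a b 0 = 1"
  using powser_zero[of "hyp1F1_coeff a b"] by (simp add: hyp1F1_eq hyp1F1_coeff_def)

lemma hyp1F1_coeff_Suc:
  assumes "Re b > 0"
  shows "(of_nat j + b) * of_nat (Suc j) * hyp1F1_coeff a b (Suc j) = (of_nat j + a) * hyp1F1_coeff a b j"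
proof -
  have nz: "b + of_nat i \<noteq> 0" for i
  proof
    assume "b + of_nat i = 0"
    then have "Re (b + of_nat i) = 0" by (simp only: zero_complex.sel)
    then show False using assms by simp
  qed
  have "pochhammer b j \<noteq> 0" using nz by (auto simp: pochhammer_prod)
  moreover have "x * y * (p * u / (r * x) / (y * f)) = u * (p / r / f)"
    if "x \<noteq> 0" "y \<noteq> 0" for x y p u r f :: complex
    using that by simp
  from this[of "b + of_nat j" "of_nat (Suc j)"] show ?thesis
    using nz[of j] by (simp only: hyp1F1_coeff_def pochhammer_Suc fact_Suc of_nat_mult of_nat_fact
        add.commute[of _ "of_nat j"] of_nat_eq_0_iff) simp
qed

lemma summable_hyp1F1:
  assumes "Re b > 0"
  shows "summable (\<lambda>j. hyp1F1_coeff a b j * z ^ j)"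
proof -
  \<comment> \<open>From here on |j + a| \<le> 2j and 4|z| \<le> j + 1, so the ratio of consecutive
    terms is at most 2|z|/(j + 1) \<le> 1/2.\<close>
  obtain N :: nat where N: "real N \<ge> norm a + 4 * norm z + 1" using real_arch_simple by blast
  show ?thesis
  proof (rule summable_ratio_test[of "1/2" N])
    fix j assume "j \<ge> N"
    then have j: "real j \<ge> norm a + 4 * norm z + 1" using N by linarith
    let ?c = "hyp1F1_coeff a b"
    have jpos: "real j > 0" using j norm_ge_zero[of a] norm_ge_zero[of z] by linarith
    have "real j \<le> Re (of_nat j + b)" using assms by simp
    also have "\<dots> \<le> norm (of_nat j + b)" by (rule complex_Re_le_cmod)
    finally have b: "real j \<le> norm (of_nat j + b)" .
    have "norm (of_nat j + a) \<le> real j + norm a"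
      using norm_triangle_ineq[of "of_nat j" a] by simp
    also have "\<dots> \<le> 2 * real j" using j norm_ge_zero[of z] by linarith
    finally have a: "norm (of_nat j + a) \<le> 2 * real j" .
    have "real j * real (Suc j) * norm (?c (Suc j)) \<le> norm (of_nat j + b) * real (Suc j) * norm (?c (Suc j))"
      using b by (intro mult_right_mono) auto
    also have "\<dots> = norm (of_nat j + a) * norm (?c j)"
      using arg_cong[OF hyp1F1_coeff_Suc[OF assms, of j a], of norm]
      by (simp only: norm_mult norm_of_nat)
    also have "\<dots> \<le> 2 * real j * norm (?c j)"
      using a by (intro mult_right_mono) auto
    finally have "real (Suc j) * norm (?c (Suc j)) \<le> 2 * norm (?c j)"
      using jpos by (simp add: mult.assoc)
    then have "real (Suc j) * norm (?c (Suc j)) * (norm z * norm z ^ j) \<le> 2 * norm (?c j) * (norm z * norm z ^ j)"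
      by (intro mult_right_mono) auto
    also have "\<dots> = (4 * norm z) * (norm (?c j) * norm z ^ j / 2)" by simp
    also have "\<dots> \<le> real (Suc j) * (norm (?c j) * norm z ^ j / 2)"
    proof (intro mult_right_mono)
      show "4 * norm z \<le> real (Suc j)"
        unfolding of_nat_Suc using j norm_ge_zero[of a] by linarith
    qed simp
    finally have "real (Suc j) * (norm (?c (Suc j)) * (norm z * norm z ^ j)) \<le> real (Suc j) * (norm (?c j) * norm z ^ j / 2)"
      by (simp only: mult.assoc)
    then have "norm (?c (Suc j)) * (norm z * norm z ^ j) \<le> norm (?c j) * norm z ^ j / 2"
      by (rule mult_left_le_imp_le) simp
    then show "norm (?c (Suc j) * z ^ Suc j) \<le> 1 / 2 * norm (?c j * z ^ j)"
      by (simp add: norm_mult norm_power)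
  qed simp
qed

text \<open>The coefficient of z^n in Kummer's equation is (n + b)(n + 1) c(n + 1) - (n + a) c(n),
  which is zero by the recursion \<open>hyp1F1_coeff_Suc\<close>.\<close>

lemma hyp1F1_kummer:
  assumes b: "Re b > 0"
  obtains w' w'' where
    "\<And>z. (hyp1F1 a b has_field_derivative w' z) (at z)"
    "\<And>z. (w' has_field_derivative w'' z) (at z)"
    "\<And>z. z * w'' z + (b - z) * w' z - a * hyp1F1 a b z = 0"
proof -
  let ?c = "hyp1F1_coeff a b"
  define w' where "w' z = (\<Sum>n. diffs ?c n * z ^ n)" for z
  define w'' where "w'' z = (\<Sum>n. diffs (diffs ?c) n * z ^ n)" for z
  have s0: "summable (\<lambda>n. ?c n * z ^ n)" for z using b by (rule summable_hyp1F1)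
  have s1: "summable (\<lambda>n. diffs ?c n * z ^ n)" for z
    using s0 by (rule termdiff_converges_all)
  have s2: "summable (\<lambda>n. diffs (diffs ?c) n * z ^ n)" for z
    using s1 by (rule termdiff_converges_all)
  have d1: "(hyp1F1 a b has_field_derivative w' z) (at z)" for z
    using termdiffs_strong_converges_everywhere[OF s0] by (simp add: w'_def hyp1F1_eq[abs_def])
  have d2: "(w' has_field_derivative w'' z) (at z)" for z
    using termdiffs_strong_converges_everywhere[OF s1] by (simp add: w'_def[abs_def] w''_def)
  have "z * w'' z + (b - z) * w' z - a * hyp1F1 a b z = 0" for z
  proof -
    have "(\<lambda>n. of_nat (Suc n) * of_nat (Suc (Suc n)) * ?c (Suc (Suc n)) * z ^ Suc n) sums (z * w'' z)"
      using sums_mult[OF summable_sums[OF s2[of z]], of z]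
      by (simp add: w''_def diffs_def mult_ac)
    \<comment> \<open>Shifts the index back to z^n. The added zeroth term vanishes through its
      factor n; hence the \<open>+ 0\<close>.\<close>
    then have "(\<lambda>n. of_nat n * of_nat (Suc n) * ?c (Suc n) * z ^ n) sums (z * w'' z + 0)"
      by (subst (asm) sums_Suc_iff) simp
    moreover have "(\<lambda>n. of_nat (Suc n) * ?c (Suc n) * z ^ Suc n) sums (z * w' z)"
      using sums_mult[OF summable_sums[OF s1[of z]], of z]
      by (simp add: w'_def diffs_def mult_ac)
    then have "(\<lambda>n. of_nat n * ?c n * z ^ n) sums (z * w' z + 0)"
      by (subst (asm) sums_Suc_iff) simp
    moreover have "(\<lambda>n. b * (of_nat (Suc n) * ?c (Suc n) * z ^ n)) sums (b * w' z)"
      using sums_mult[OF summable_sums[OF s1[of z]], of b]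
      by (simp add: w'_def diffs_def mult_ac)
    moreover have "(\<lambda>n. a * (?c n * z ^ n)) sums (a * hyp1F1 a b z)"
      unfolding hyp1F1_eq by (intro sums_mult summable_sums s0)
    ultimately have "(\<lambda>n. of_nat n * of_nat (Suc n) * ?c (Suc n) * z ^ n + b * (of_nat (Suc n) * ?c (Suc n) * z ^ n)
        - of_nat n * ?c n * z ^ n - a * (?c n * z ^ n)) sums
      ((z * w'' z + 0) + b * w' z - (z * w' z + 0) - a * hyp1F1 a b z)"
      by (intro sums_add sums_diff)
    moreover have "of_nat n * of_nat (Suc n) * ?c (Suc n) * z ^ n + b * (of_nat (Suc n) * ?c (Suc n) * z ^ n)
        - of_nat n * ?c n * z ^ n - a * (?c n * z ^ n) = 0" for n
    proof -
      have "of_nat n * of_nat (Suc n) * ?c (Suc n) * z ^ n + b * (of_nat (Suc n) * ?c (Suc n) * z ^ n)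
        - of_nat n * ?c n * z ^ n - a * (?c n * z ^ n)
        = ((of_nat n + b) * of_nat (Suc n) * ?c (Suc n) - (of_nat n + a) * ?c n) * z ^ n"
        by (simp only: algebra_simps)
      then show ?thesis by (simp only: hyp1F1_coeff_Suc[OF b] diff_self mult_zero_left)
    qed
    ultimately have "(\<lambda>n. 0) sums ((z * w'' z + 0) + b * w' z - (z * w' z + 0) - a * hyp1F1 a b z)"
      by (simp only:)
    then have "(z * w'' z + 0) + b * w' z - (z * w' z + 0) - a * hyp1F1 a b z = 0"
      using sums_unique2 sums_zero by blast
    then show ?thesis by (simp add: algebra_simps)
  qed
  with d1 d2 show thesis by (rule that)
qed

text \<open>The radial factor of \<open>F_fun\<close>; it depends on \<open>l\<close> and \<open>k\<close> only through the degree \<open>d = 2l + k\<close>.\<close>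

definition radial_factor :: "nat \<Rightarrow> complex \<Rightarrow> int \<Rightarrow> nat \<Rightarrow> complex \<Rightarrow> complex" where
  "radial_factor n s m d x = exp (- \<i> * s * x) *
     hyp1F1 ((of_int m + 2 * of_nat d + of_nat n) / 4) (of_nat d + of_nat n / 2) (2 * \<i> * s * x)"

lemma radial_factor_0 [simp]: "radial_factor n s m d 0 = 1"
  by (simp add: radial_factor_def)

text \<open>This is the condition that h \<phi>(\<rho>^2) absorbs the potential 4s^2\<rho>^2 - 2ims.
  Splitting off exp(-isx) and substituting z = 2isx turns it into Kummer's equation, which dictates
  both parameters.\<close>

lemma radial_factor_ode:
  assumes "n > 0"
  shows "radial_factor n s m d holomorphic_on UNIV"
    and "4 * x * deriv (deriv (radial_factor n s m d)) x
      + (4 * of_nat d + 2 * of_nat n) * deriv (radial_factor n s m d) x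
      = (2 * \<i> * of_int m * s - 4 * s\<^sup>2 * x) * radial_factor n s m d x"
proof -
  define A :: complex where "A = (of_int m + 2 * of_nat d + of_nat n) / 4"
  define B :: complex where "B = of_nat d + of_nat n / 2"
  have "Re B > 0" using assms by (simp add: B_def)
  then obtain w' w'' where w: "\<And>z. (hyp1F1 A B has_field_derivative w' z) (at z)"
    "\<And>z. (w' has_field_derivative w'' z) (at z)"
    "\<And>z. z * w'' z + (B - z) * w' z - A * hyp1F1 A B z = 0"
    using hyp1F1_kummer by blast
  let ?\<Phi> = "radial_factor n s m d"
  have \<Phi>: "?\<Phi> = (\<lambda>x. exp (- \<i> * s * x) * hyp1F1 A B (2 * \<i> * s * x))"
    by (simp add: fun_eq_iff radial_factor_def A_def B_def)
  note [derivative_intros] = DERIV_chain2[OF w(1)] DERIV_chain2[OF w(2)]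
  have D1: "(?\<Phi> has_field_derivative exp (- \<i> * s * x) *
      (2 * \<i> * s * w' (2 * \<i> * s * x) - \<i> * s * hyp1F1 A B (2 * \<i> * s * x))) (at x)" for x
    unfolding \<Phi> by (auto intro!: derivative_eq_intros simp: algebra_simps)
  then show "?\<Phi> holomorphic_on UNIV"
    by (auto simp: holomorphic_on_open)
  have dv: "deriv ?\<Phi> = (\<lambda>x. exp (- \<i> * s * x) *
      (2 * \<i> * s * w' (2 * \<i> * s * x) - \<i> * s * hyp1F1 A B (2 * \<i> * s * x)))"
    by (intro ext DERIV_imp_deriv D1)
  have D2: "(deriv ?\<Phi> has_field_derivative exp (- \<i> * s * x) *
      (- 4 * s\<^sup>2 * w'' (2 * \<i> * s * x) + 4 * s\<^sup>2 * w' (2 * \<i> * s * x) - s\<^sup>2 * hyp1F1 A B (2 * \<i> * s * x))) (at x)" for x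
    unfolding dv by (auto intro!: derivative_eq_intros simp: algebra_simps power2_eq_square)
  have dv2: "deriv (deriv ?\<Phi>) x = exp (- \<i> * s * x) *
      (- 4 * s\<^sup>2 * w'' (2 * \<i> * s * x) + 4 * s\<^sup>2 * w' (2 * \<i> * s * x) - s\<^sup>2 * hyp1F1 A B (2 * \<i> * s * x))"
    by (intro DERIV_imp_deriv D2)
  let ?z = "2 * \<i> * s * x"
  \<comment> \<open>The difference of the two sides is Kummer's expression at z = 2isx, multiplied
    by 8is exp(-isx).\<close>
  have "4 * x * deriv (deriv ?\<Phi>) x + (4 * of_nat d + 2 * of_nat n) * deriv ?\<Phi> x
      - (2 * \<i> * of_int m * s - 4 * s\<^sup>2 * x) * ?\<Phi> x
    = exp (- \<i> * s * x) * (8 * \<i> * s) * (?z * w'' ?z + (B - ?z) * w' ?z - A * hyp1F1 A B ?z)"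
    unfolding dv2 unfolding dv unfolding \<Phi>
    by (simp add: A_def B_def algebra_simps power2_eq_square add_divide_distrib)
  then show "4 * x * deriv (deriv ?\<Phi>) x + (4 * of_nat d + 2 * of_nat n) * deriv ?\<Phi> x
      = (2 * \<i> * of_int m * s - 4 * s\<^sup>2 * x) * ?\<Phi> x"
    by (simp only: w(3) mult_zero_right) (simp add: algebra_simps)
qed

section \<open>Solutions of the radial equation\<close>

text \<open>The eigenvalue equation of \<open>Omega\<close> for exp(-im\<theta>/2) G(y): the term 4s
  d/d\<theta> becomes -2ims.\<close>

definition slice_pde :: "complex \<Rightarrow> complex \<Rightarrow> int \<Rightarrow> ('a::euclidean_space \<Rightarrow> complex) \<Rightarrow> bool" where
  "slice_pde s lam m G \<longleftrightarrow>
     (\<forall>y. norm_sq y * (laplacian G y + (4 * s\<^sup>2 * norm_sq y - 2 * \<i> * of_int m * s) * G y) = 2 * lam * G y)"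

text \<open>Only differentiation along rays remains once the angular part is collected on the left.
  The parameter \<mu> is free: the bracket vanishes for an eigenvector and is the inhomogeneity for
  a Jordan block.\<close>

lemma slice_pde_radial_ode:
  fixes G :: "'a::euclidean_space \<Rightarrow> complex"
  assumes "slice_pde s lam m G"
  shows "euler (euler G) y + (of_nat DIM('a) - 2) * euler G y + (sph_laplacian G y - \<mu> * G y)
    = ((2 * lam - \<mu>) + (2 * \<i> * of_int m * s) * norm_sq y + (- 4 * s\<^sup>2) * (norm_sq y)\<^sup>2) * G y"
  using assms[unfolded slice_pde_def, rule_format, of y]
  unfolding sph_laplacian_def by (simp add: algebra_simps power2_eq_square)

text \<open>Two distinct roots add up to 2 - n, and distinct natural numbers have sum at least 1.
  This leaves n = 1 with the roots 0 and 1, which differ in parity.\<close>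

lemma indicial_parity:
  assumes "n > 0" "i \<noteq> d"
    "of_nat i * of_nat i + (of_nat n - 2) * of_nat i = of_nat d * of_nat d + (of_nat n - 2) * (of_nat d :: complex)"
  shows "(-1) ^ i \<noteq> ((-1) ^ d :: complex)"
proof -
  have "of_int (int i * int i + (int n - 2) * int i) = (of_int (int d * int d + (int n - 2) * int d) :: complex)"
    using assms(3) by simp
  then have "int i * int i + (int n - 2) * int i = int d * int d + (int n - 2) * int d"
    by (simp only: of_int_eq_iff)
  then have "(int i - int d) * (int i + int d + int n - 2) = 0" by (simp add: algebra_simps)
  then have "int i + int d + int n = 2" using assms(2) by simp
  then have "i + d = 1" using assms(1,2) by linarith
  then have "i = 0 \<and> d = 1 \<or> i = 1 \<and> d = 0" by arith
  then show ?thesis by auto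
qed

lemma jet_indicial:
  fixes G :: "'a::euclidean_space \<Rightarrow> complex"
  assumes G: "smooth G"
    and ode: "\<And>y. euler (euler G) y + b * euler G y
      = (\<kappa> + \<alpha> * norm_sq y + \<beta> * (norm_sq y)\<^sup>2) * G y"
    and low: "\<And>i. i < j \<Longrightarrow> jet i G w = 0"
  shows "(of_nat j * of_nat j + b * of_nat j - \<kappa>) * jet j G w = 0"
proof -
  have "jet j (\<lambda>y. 0) w = 0"
    using jet_cmult[OF smooth_const, of j 0 0 w] by simp
  then show ?thesis
    using jet_leading[OF G smooth_const[of 0], of b \<kappa> \<alpha> \<beta> j w] ode low by simp
qed

text \<open>The order is minimal over all directions at once, so everything below it vanishes
  identically.\<close>

lemma nonzero_jet_least:
  assumes "jet j G w \<noteq> 0"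
  obtains d w0 where "jet d G w0 \<noteq> 0" "\<And>i w. i < d \<Longrightarrow> jet i G w = 0"
proof -
  define d where "d = (LEAST j. \<exists>w. jet j G w \<noteq> 0)"
  have "\<exists>w. jet d G w \<noteq> 0"
    unfolding d_def using assms by (rule_tac LeastI_ex) blast
  moreover have "jet i G w = 0" if "i < d" for i w
    using not_less_Least[OF that[unfolded d_def]] by blast
  ultimately show thesis using that by blast
qed

text \<open>A Jordan block would be a resonance: the leading Taylor coefficient of the eigenvector would
  have to vanish by the indicial equation.\<close>

lemma sph_laplacian_semisimple:
  fixes G :: "'a::euclidean_space \<Rightarrow> complex"
  assumes G: "smooth G" "slice_pde s lam m G" "\<And>y. G (- y) = \<epsilon> * G y"
    and H: "smooth H" "slice_pde s lam m H" "\<And>y. H (- y) = \<epsilon> * H y"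
    and GH: "\<And>y. sph_laplacian G y - \<mu> * G y = H y" "\<And>y. sph_laplacian H y = \<mu> * H y"
  shows "H y = 0"
proof (rule ccontr)
  assume "H y \<noteq> 0"
  define b :: complex where "b = of_nat DIM('a) - 2"
  define \<kappa> where "\<kappa> = 2 * lam - \<mu>"
  have odeG: "euler (euler G) y + b * euler G y + H y
    = (\<kappa> + (2 * \<i> * of_int m * s) * norm_sq y + (- 4 * s\<^sup>2) * (norm_sq y)\<^sup>2) * G y" for y
    using slice_pde_radial_ode[OF G(2), of y \<mu>] by (simp add: GH b_def \<kappa>_def)
  have odeH: "euler (euler H) y + b * euler H y
    = (\<kappa> + (2 * \<i> * of_int m * s) * norm_sq y + (- 4 * s\<^sup>2) * (norm_sq y)\<^sup>2) * H y" for y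
    using slice_pde_radial_ode[OF H(2), of y \<mu>] by (simp add: GH b_def \<kappa>_def)
  obtain j w where "jet j H w \<noteq> 0"
    using flat_solution_zero[OF H(1) odeH] \<open>H y \<noteq> 0\<close> by blast
  then obtain d w0 where d: "jet d H w0 \<noteq> 0" "\<And>i w. i < d \<Longrightarrow> jet i H w = 0"
    using nonzero_jet_least by blast
  have \<kappa>: "of_nat d * of_nat d + b * of_nat d = \<kappa>"
    using jet_indicial[OF H(1) odeH, of d w0] d by simp
  have par: "(-1) ^ d = \<epsilon>" using jet_parity[of H \<epsilon> d w0, OF H(1,3)] d(1) by simp
  \<comment> \<open>Below \<open>d\<close> the inhomogeneity has no jet, so the indicial equation
    kills the jets of \<open>G\<close> except at a second root, where parity does.\<close>
  have "jet i G w0 = 0" if "i < d" for i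
    using that
  proof (induction i rule: less_induct)
    case (less i)
    then have "(of_nat i * of_nat i + b * of_nat i - \<kappa>) * jet i G w0 = 0"
      using jet_leading[OF G(1) H(1) odeG, of i w0] d(2)[of i w0] by simp
    moreover have "jet i G w0 = 0" if "of_nat i * of_nat i + b * of_nat i = \<kappa>"
    proof -
      have "(-1) ^ i \<noteq> \<epsilon>"
        using indicial_parity[of "DIM('a)" i d] less.prems that \<kappa> par by (simp add: b_def)
      then show ?thesis using jet_parity[of G \<epsilon> i w0, OF G(1,3)] by simp
    qed
    ultimately show ?case by auto
  qed
  \<comment> \<open>At order \<open>d\<close> the indicial factor is zero, and the jet of
    \<open>H\<close> is all that remains.\<close>
  then have "(of_nat d * of_nat d + b * of_nat d - \<kappa>) * jet d G w0 + jet d H w0 = 0"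
    by (intro jet_leading[OF G(1) H(1) odeG])
  then show False using \<kappa> d(1) by simp
qed

section \<open>The model solution: leading polynomial times radial factor\<close>

lemma derivative_chain_power:
  assumes "derivative_chain g"
  shows "\<exists>k. derivative_chain k \<and> (\<forall>t. k 0 t = of_real t ^ d * g 0 t) \<and> k d 0 = fact d * g 0 0"
proof (induction d)
  case 0
  then show ?case using assms by (intro exI[of _ g]) auto
next
  case (Suc d)
  then obtain k where k: "derivative_chain k" "\<forall>t. k 0 t = of_real t ^ d * g 0 t" "k d 0 = fact d * g 0 0"
    by blast
  show ?case
    using derivative_chain_times_id[OF k(1)] k(2,3)
    by (intro exI[of _ "\<lambda>j t. of_real t * k j t + of_nat j * k (j - 1) t"]) (auto simp: algebra_simps)
qed

text \<open>At t = 0 only the Leibniz term in which all d derivatives hit t^d survives.\<close>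

lemma jet_power_mult:
  assumes "smooth f" "smooth e" "\<And>t. e (t *\<^sub>R w) = of_real t ^ d * f (t *\<^sub>R w)"
  shows "jet d e w = fact d * f 0"
proof -
  obtain k where "derivative_chain k" "\<forall>t. k 0 t = of_real t ^ d * (dderiv w ^^ 0) f (t *\<^sub>R w)"
    "k d 0 = fact d * (dderiv w ^^ 0) f (0 *\<^sub>R w)"
    using derivative_chain_power[OF derivative_chain_ray[OF assms(1), of w], of d] by blast
  then show ?thesis using jet_eq_chain[OF assms(2), of k w d] assms(3) by simp
qed

text \<open>The radial factor is continuous with value 1 at the origin but may vanish elsewhere. It
  can be cancelled at some point of each ray, from where homogeneity extends the conclusion.\<close>

lemma radial_factor_nonzero_near_origin:
  fixes y :: "'a::euclidean_space"
  assumes "n > 0"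
  shows "\<exists>t. t \<noteq> 0 \<and> radial_factor n s m d (norm_sq (t *\<^sub>R y)) \<noteq> 0"
proof -
  let ?\<Phi> = "radial_factor n s m d"
  have "continuous_on UNIV ?\<Phi>"
    using radial_factor_ode(1)[OF assms] by (rule holomorphic_on_imp_continuous_on)
  moreover have "continuous_on UNIV (\<lambda>t. norm_sq (t *\<^sub>R y))"
    unfolding norm_sq_def by (intro continuous_intros)
  ultimately have "continuous_on UNIV (\<lambda>t. ?\<Phi> (norm_sq (t *\<^sub>R y)))"
    by (rule continuous_on_compose2) simp
  then have "isCont (\<lambda>t. ?\<Phi> (norm_sq (t *\<^sub>R y))) 0"
    by (simp add: continuous_on_eq_continuous_at)
  then have "((\<lambda>t. ?\<Phi> (norm_sq (t *\<^sub>R y))) \<longlongrightarrow> 1) (at 0)"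
    by (simp add: isCont_def)
  then have "eventually (\<lambda>t. ?\<Phi> (norm_sq (t *\<^sub>R y)) \<noteq> 0) (at 0)"
    by (rule tendsto_imp_eventually_ne) simp
  then have "eventually (\<lambda>t. t \<noteq> 0 \<and> ?\<Phi> (norm_sq (t *\<^sub>R y)) \<noteq> 0) (at 0)"
    by (auto simp: eventually_at_filter elim: eventually_mono)
  then show ?thesis
    using eventually_happens' trivial_limit_at by blast
qed

text \<open>The potential and all derivatives of the radial factor cancel. What remains is an
  equation for \<open>h\<close> alone.\<close>

lemma slice_operator_homogeneous_radial:
  fixes h :: "'a::euclidean_space \<Rightarrow> complex" and s :: complex and m :: int
  defines "\<Phi> \<equiv> radial_factor DIM('a) s m"
  assumes "homogeneous (int d) h" "smooth h"
  shows "laplacian (\<lambda>y. h y * \<Phi> d (norm_sq y)) y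
      + (4 * s\<^sup>2 * norm_sq y - 2 * \<i> * of_int m * s) * (h y * \<Phi> d (norm_sq y))
    = laplacian h y * \<Phi> d (norm_sq y)"
proof -
  have "h y * (4 * norm_sq y * deriv (deriv (\<Phi> d)) (norm_sq y)
      + (4 * of_nat d + 2 * of_nat DIM('a)) * deriv (\<Phi> d) (norm_sq y))
    = h y * ((2 * \<i> * of_int m * s - 4 * s\<^sup>2 * norm_sq y) * \<Phi> d (norm_sq y))"
    unfolding \<Phi>_def by (simp only: radial_factor_ode(2)[OF DIM_positive])
  moreover have "\<Phi> d holomorphic_on UNIV"
    unfolding \<Phi>_def by (rule radial_factor_ode(1)) simp
  ultimately show ?thesis
    using laplacian_homogeneous_radial[OF _ assms(2,3), of "\<Phi> d" y]
    by (simp add: left_diff_distrib right_diff_distrib mult_ac)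
qed

text \<open>In contrast to the slice equation this holds for every homogeneous \<open>h\<close>, so
  a solution can be compared with the model before anything is known about the Laplacian of
  \<open>h\<close>. One Euler derivative replaces the radial factor \<phi> by \<Psi>(x) =
  2x\<phi>'(x) + d\<phi>(x).\<close>

lemma radial_ode_homogeneous_radial:
  fixes h :: "'a::euclidean_space \<Rightarrow> complex" and s :: complex and m :: int
  defines "\<Phi> \<equiv> radial_factor DIM('a) s m"
  assumes h: "homogeneous (int d) h" "smooth h"
  defines "T \<equiv> (\<lambda>y. h y * \<Phi> d (norm_sq y))"
  shows "euler (euler T) y + (of_nat DIM('a) - 2) * euler T y
    = ((of_nat d * of_nat d + (of_nat DIM('a) - 2) * of_nat d)
       + (2 * \<i> * of_int m * s) * norm_sq y + (- 4 * s\<^sup>2) * (norm_sq y)\<^sup>2) * T y"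
proof -
  let ?P = "\<Phi> d" and ?x = "norm_sq y"
  have hol: "?P holomorphic_on UNIV" "deriv ?P holomorphic_on UNIV"
    using radial_factor_ode(1)[of "DIM('a)" s m d] deriv_holomorphic_UNIV by (auto simp: \<Phi>_def)
  define \<Psi> where "\<Psi> x = 2 * x * deriv ?P x + of_nat d * ?P x" for x
  have d: "(\<Psi> has_field_derivative 2 * deriv ?P x + 2 * x * deriv (deriv ?P) x + of_nat d * deriv ?P x) (at x)" for x
    unfolding \<Psi>_def[abs_def]
    by (auto intro!: derivative_eq_intros holomorphic_derivI[OF hol(1)] holomorphic_derivI[OF hol(2)])
  have dv: "deriv \<Psi> x = 2 * deriv ?P x + 2 * x * deriv (deriv ?P) x + of_nat d * deriv ?P x" for x
    by (intro DERIV_imp_deriv d)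
  have "\<Psi> holomorphic_on UNIV" using d by (auto simp: holomorphic_on_open)
  have E: "euler T = (\<lambda>y. h y * \<Psi> (norm_sq y))"
    unfolding T_def \<Psi>_def by (intro ext euler_homogeneous_radial hol h)
  have EE: "euler (euler T) y = h y * (2 * ?x * deriv \<Psi> ?x + of_nat d * \<Psi> ?x)"
    unfolding E by (intro euler_homogeneous_radial h \<open>\<Psi> holomorphic_on UNIV\<close>)
  have "euler (euler T) y + (of_nat DIM('a) - 2) * euler T y
    = h y * (?x * (4 * ?x * deriv (deriv ?P) ?x + (4 * of_nat d + 2 * of_nat DIM('a)) * deriv ?P ?x)
      + (of_nat d * of_nat d + (of_nat DIM('a) - 2) * of_nat d) * ?P ?x)"
  proof -
    have "u * (2 * x * (2 * P1 + 2 * x * P2 + e * P1) + e * (2 * x * P1 + e * P)) + (n - 2) * (u * (2 * x * P1 + e * P))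
      = u * (x * (4 * x * P2 + (4 * e + 2 * n) * P1) + (e * e + (n - 2) * e) * P)" for u x P P1 P2 e n :: complex
      by (simp add: algebra_simps)
    from this[of "h y" ?x "deriv ?P ?x" "deriv (deriv ?P) ?x" "of_nat d" "?P ?x" "of_nat DIM('a)"]
    show ?thesis
      unfolding EE unfolding E dv \<Psi>_def .
  qed
  also have "4 * ?x * deriv (deriv ?P) ?x + (4 * of_nat d + 2 * of_nat DIM('a)) * deriv ?P ?x
    = (2 * \<i> * of_int m * s - 4 * s\<^sup>2 * ?x) * ?P ?x"
    unfolding \<Phi>_def by (rule radial_factor_ode(2)) simp
  finally show ?thesis by (simp add: T_def algebra_simps power2_eq_square)
qed

lemma smooth_homogeneous_radial:
  fixes h :: "'a::euclidean_space \<Rightarrow> complex"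
  assumes "smooth h"
  shows "smooth (\<lambda>y. h y * radial_factor DIM('a) s m d (norm_sq y))"
  by (rule smooth_mult[OF assms smooth_holomorphic[OF radial_factor_ode(1) smooth_norm_sq]]) simp

lemma norm_sq_minus [simp]: "norm_sq (- y) = norm_sq y"
  by (simp add: norm_sq_def)

lemma euler_diff:
  assumes "smooth f" "smooth g"
  shows "euler (\<lambda>y. f y - g y) y = euler f y - euler g y"
proof -
  have "dderiv b (\<lambda>y. f y - g y) y = dderiv b f y - dderiv b g y" for b
    using assms by (intro dderiv_eq has_derivative_diff smooth_has_derivative)
  then show ?thesis by (simp only: euler_def right_diff_distrib sum_subtractf)
qed

text \<open>The leading Taylor polynomial \<open>h\<close> of \<open>G\<close> has an indicial root \<open>d\<close> as its degree, and parity leaves no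
  second root. Hence \<open>G\<close> and \<open>h\<close> times the radial factor solve the same equation along rays and have
  the same Taylor coefficients.\<close>

lemma eigenvector_classification:
  fixes G :: "real^'n \<Rightarrow> complex"
  assumes G: "smooth G" "slice_pde s lam m G" "\<And>y. G (- y) = \<epsilon> * G y"
    and eig: "\<And>y. sph_laplacian G y = \<mu> * G y" and "G y0 \<noteq> 0"
  shows "\<exists>l k p. p \<in> harmonic_poly (int k) \<and> (\<exists>y. p y \<noteq> 0) \<and> \<epsilon> = (-1) ^ k \<and>
    lam = of_nat l * (2 * of_nat l + 2 * of_nat k + of_nat CARD('n) - 2) \<and>
    G = (\<lambda>y. norm_sq y ^ l * p y * radial_factor CARD('n) s m (2 * l + k) (norm_sq y))"
proof -
  define b :: complex where "b = of_nat CARD('n) - 2"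
  define \<kappa> where "\<kappa> = 2 * lam - \<mu>"
  have odeG: "euler (euler G) y + b * euler G y
    = (\<kappa> + (2 * \<i> * of_int m * s) * norm_sq y + (- 4 * s\<^sup>2) * (norm_sq y)\<^sup>2) * G y" for y
    using slice_pde_radial_ode[OF G(2), of y \<mu>] by (simp add: eig b_def \<kappa>_def)
  obtain j w where "jet j G w \<noteq> 0"
    using flat_solution_zero[OF G(1) odeG] \<open>G y0 \<noteq> 0\<close> by blast
  then obtain d w0 where d: "jet d G w0 \<noteq> 0" "\<And>i w. i < d \<Longrightarrow> jet i G w = 0"
    using nonzero_jet_least by blast
  have \<kappa>: "of_nat d * of_nat d + b * of_nat d = \<kappa>"
    using jet_indicial[OF G(1) odeG, of d w0] d by simp
  have par: "(-1) ^ d = \<epsilon>" using jet_parity[of G \<epsilon> d w0, OF G(1,3)] d(1) by simp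
  \<comment> \<open>The factor d! compensates for the unnormalised jets. As the radial factor is 1
    at the origin, \<open>T\<close> then has the same jet of order \<open>d\<close> as
    \<open>G\<close>.\<close>
  define h where "h w = jet d G w / fact d" for w
  have "polynomial_function ((\<lambda>z. z / fact d) \<circ> jet d G)"
    by (intro polynomial_function_compose polynomial_function_jet G(1)
        polynomial_function_bounded_linear bounded_linear_divide)
  then have h: "polynomial_function h" by (simp add: h_def[abs_def] o_def)
  have h_smooth: "smooth h" using h by (rule smooth_polynomial_function)
  have h_scale: "h (t *\<^sub>R w) = of_real t ^ d * h w" for t w
    using jet_scaleR[OF G(1)] by (simp add: h_def)
  then have h_hom: "homogeneous (int d) h" by (simp add: homogeneous_def)
  have h0: "h w0 \<noteq> 0" using d(1) by (simp add: h_def)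
  let ?\<Phi> = "radial_factor CARD('n) s m d"
  define T where "T y = h y * ?\<Phi> (norm_sq y)" for y
  have T_eq: "(\<lambda>y. h y * radial_factor DIM(real^'n) s m d (norm_sq y)) = T"
    by (simp add: T_def fun_eq_iff)
  have DIM_b: "of_nat DIM(real^'n) - 2 = b" by (simp add: b_def)
  have T_smooth: "smooth T"
    using smooth_homogeneous_radial[OF h_smooth, of s m d] unfolding T_eq .
  have odeT: "euler (euler T) y + b * euler T y
    = (\<kappa> + (2 * \<i> * of_int m * s) * norm_sq y + (- 4 * s\<^sup>2) * (norm_sq y)\<^sup>2) * T y" for y
    using radial_ode_homogeneous_radial[OF h_hom h_smooth, of s m y] unfolding T_eq DIM_b \<kappa> by (simp add: T_def)
  have T_par: "T (- y) = \<epsilon> * T y" for y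
    using h_scale[of "-1" y] par by (simp add: T_def)
  have T_jet: "jet d T w = jet d G w" for w
  proof -
    have "jet d T w = fact d * (h w * ?\<Phi> (norm_sq (0 :: real^'n)))"
    proof (rule jet_power_mult[of "\<lambda>y. h w * ?\<Phi> (norm_sq y)" T w d, OF _ T_smooth])
      show "smooth (\<lambda>y. h w * ?\<Phi> (norm_sq y))"
        by (rule smooth_mult[OF smooth_const smooth_holomorphic[OF radial_factor_ode(1) smooth_norm_sq]]) simp
      show "T (t *\<^sub>R w) = of_real t ^ d * (h w * ?\<Phi> (norm_sq (t *\<^sub>R w)))" for t
        by (simp add: T_def h_scale)
    qed
    then show ?thesis by (simp add: h_def)
  qed
  define D where "D y = G y - T y" for y
  have D_smooth: "smooth D" unfolding D_def[abs_def] using G(1) T_smooth by (rule smooth_minus)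
  have ED: "euler D = (\<lambda>y. euler G y - euler T y)"
    unfolding D_def[abs_def] using G(1) T_smooth by (intro ext euler_diff)
  have odeD: "euler (euler D) y + b * euler D y
    = (\<kappa> + (2 * \<i> * of_int m * s) * norm_sq y + (- 4 * s\<^sup>2) * (norm_sq y)\<^sup>2) * D y" for y
  proof -
    have "euler (euler D) y = euler (euler G) y - euler (euler T) y"
      unfolding ED using G(1) T_smooth by (intro euler_diff smooth_euler)
    then have "euler (euler D) y + b * euler D y
      = (euler (euler G) y + b * euler G y) - (euler (euler T) y + b * euler T y)"
      by (simp add: fun_cong[OF ED] right_diff_distrib)
    then show ?thesis
      unfolding odeG odeT D_def by (simp only: right_diff_distrib)
  qed
  have D_par: "D (- y) = \<epsilon> * D y" for y by (simp add: D_def G(3) T_par algebra_simps)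
  have "jet i D w = 0" for i w
  proof (induction i rule: less_induct)
    case (less i)
    have *: "(of_nat i * of_nat i + b * of_nat i - \<kappa>) * jet i D w = 0"
      by (rule jet_indicial[OF D_smooth odeD less.IH])
    show ?case
    proof (cases "i = d")
      case True
      then show ?thesis using G(1) T_smooth T_jet by (simp add: D_def[abs_def] jet_diff)
    next
      case False
      have "jet i D w = 0" if "of_nat i * of_nat i + b * of_nat i = \<kappa>"
      proof -
        have "(-1) ^ i \<noteq> \<epsilon>"
          using indicial_parity[of "CARD('n)" i d] False that \<kappa> par by (simp add: b_def)
        then show ?thesis using jet_parity[of D \<epsilon> i w, OF D_smooth D_par] by simp
      qed
      then show ?thesis using * by auto
    qed
  qed
  then have "D y = 0" for y using flat_solution_zero[OF D_smooth odeD] by blast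
  then have GT: "G = T" by (simp add: fun_eq_iff D_def)
  \<comment> \<open>Inserting G = T into the slice equation leaves the equation for
    \<open>h\<close>, still multiplied by the radial factor.\<close>
  have key: "?\<Phi> (norm_sq y) * (norm_sq y * laplacian h y - 2 * lam * h y) = 0" for y
  proof -
    have S: "laplacian T y + (4 * s\<^sup>2 * norm_sq y - 2 * \<i> * of_int m * s) * T y = laplacian h y * ?\<Phi> (norm_sq y)"
      using slice_operator_homogeneous_radial[OF h_hom h_smooth, of s m y, unfolded T_eq]
      by (simp add: T_def)
    have "norm_sq y * (laplacian h y * ?\<Phi> (norm_sq y)) = 2 * lam * (h y * ?\<Phi> (norm_sq y))"
      using G(2)[unfolded slice_pde_def GT, rule_format, of y] unfolding S by (simp add: T_def)
    then show ?thesis by (simp add: algebra_simps)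
  qed
  have lap_h: "norm_sq y * laplacian h y = 2 * lam * h y" for y
  proof -
    \<comment> \<open>The factor is cancelled close to the origin. Both sides are homogeneous of
      degree \<open>d\<close>, so the equation returns to \<open>y\<close>.\<close>
    obtain t where t: "?\<Phi> (norm_sq (t *\<^sub>R y)) \<noteq> 0" "t \<noteq> 0"
      using radial_factor_nonzero_near_origin[of "CARD('n)" s m d y] by auto
    have "norm_sq (t *\<^sub>R y) * laplacian h (t *\<^sub>R y) = 2 * lam * h (t *\<^sub>R y)"
      using key[of "t *\<^sub>R y"] t(1) by simp
    moreover have "laplacian h (t *\<^sub>R y) = of_real t powi (int d - 2) * laplacian h y"
      using homogeneousD[OF homogeneous_laplacian[OF h_hom h_smooth] t(2)] .
    ultimately show ?thesis using t(2) by (simp add: norm_sq_scaleR h_scale power_int_diff)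
  qed
  obtain l k p where lk: "d = 2 * l + k" "p \<in> harmonic_poly (int k)" "h = (\<lambda>y. norm_sq y ^ l * p y)"
    "2 * lam = 2 * of_nat l * (2 * of_nat l + 2 * of_nat k + of_nat CARD('n) - 2)"
    using eigenpolynomial_decomposition[OF h h_hom lap_h h0] by blast
  have "\<epsilon> = (-1) ^ k" using par lk(1) by (simp add: power_add power_mult)
  moreover have "p w0 \<noteq> 0" using h0 lk(3) by auto
  moreover have "lam = of_nat l * (2 * of_nat l + 2 * of_nat k + of_nat CARD('n) - 2)"
    using lk(4) by simp
  moreover have "G = (\<lambda>y. norm_sq y ^ l * p y * radial_factor CARD('n) s m (2 * l + k) (norm_sq y))"
    unfolding GT T_def[abs_def] lk(3) lk(1) ..
  ultimately show ?thesis using lk(2) by blast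
qed

section \<open>Finiteness under rotations\<close>

text \<open>Subspaces of finite-dimensional spaces are finite-dimensional. Finiteness can thus be
  tested by inclusion, which is inherited more easily than an equality of spans.\<close>

lemma finite_spanning_set:
  assumes "finite B" "S \<subseteq> cfun.span B"
  shows "\<exists>B'. finite B' \<and> cfun.span B' = cfun.span S"
proof -
  obtain B' where B': "B' \<subseteq> S" "cfun.independent B'" "S \<subseteq> cfun.span B'"
    using cfun.maximal_independent_subset[of S] by blast
  then have "finite B'"
    using cfun.independent_span_bound[OF assms(1) B'(2)] assms(2) by blast
  moreover have "cfun.span B' = cfun.span S"
    using B' cfun.span_mono cfun.span_minimal[OF B'(3) cfun.subspace_span] by blast
  ultimately show ?thesis by blast
qed

text \<open>Composing with \<open>u\<close> instead of its inverse gives the same set, since the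
  orthogonal transformations form a group.\<close>

definition rot_orbit :: "('a::euclidean_space \<Rightarrow> complex) \<Rightarrow> ('a \<Rightarrow> complex) set" where
  "rot_orbit G = {\<lambda>y. G (u y) | u. orthogonal_transformation u}"

lemma self_in_rot_orbit: "G \<in> rot_orbit G"
  unfolding rot_orbit_def by (rule CollectI, intro exI[of _ "\<lambda>x. x"]) simp

lemma span_rot_orbit_rotate:
  fixes G :: "'a::euclidean_space \<Rightarrow> complex"
  assumes "H \<in> cfun.span (rot_orbit G)" "orthogonal_transformation u"
  shows "(\<lambda>y. H (u y)) \<in> cfun.span (rot_orbit G)"
proof (rule cfun_span_image[where T = "\<lambda>f y. f (u y)", OF _ _ assms(1)])
  fix f assume "f \<in> rot_orbit G"
  then obtain w where w: "f = (\<lambda>y. G (w y))" "orthogonal_transformation w"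
    by (auto simp: rot_orbit_def)
  have "(\<lambda>y. f (u y)) \<in> rot_orbit G"
    unfolding rot_orbit_def
    using orthogonal_transformation_compose[OF w(2) assms(2)] by (auto simp: w(1) o_def)
  then show "(\<lambda>y. f (u y)) \<in> cfun.span (rot_orbit G)" by (rule cfun.span_base)
qed (auto simp: fun_eq_iff cscale_apply)

lemma span_rot_orbit_subset:
  assumes "H \<in> cfun.span (rot_orbit G)"
  shows "cfun.span (rot_orbit H) \<subseteq> cfun.span (rot_orbit G)"
  using span_rot_orbit_rotate[OF assms]
  by (intro cfun.span_minimal cfun.subspace_span) (auto simp: rot_orbit_def)

text \<open>Rotation by the angle \<open>t\<close> in the plane of \<open>b\<close> and
  \<open>c\<close>, written as the identity plus a correction. Its derivative at t = 0 is the vector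
  field of \<open>rot_gen b c\<close>.\<close>

definition plane_rotation :: "'a::euclidean_space \<Rightarrow> 'a \<Rightarrow> real \<Rightarrow> 'a \<Rightarrow> 'a" where
  "plane_rotation b c t y = y + ((cos t - 1) * (y \<bullet> b) - sin t * (y \<bullet> c)) *\<^sub>R b
     + (sin t * (y \<bullet> b) + (cos t - 1) * (y \<bullet> c)) *\<^sub>R c"

lemma orthogonal_plane_rotation:
  fixes b c :: "'a::euclidean_space"
  assumes "b \<in> Basis" "c \<in> Basis" "b \<noteq> c"
  shows "orthogonal_transformation (plane_rotation b c t)"
  unfolding orthogonal_transformation
proof (intro conjI allI)
  show "linear (plane_rotation b c t)"
    by (rule linearI) (simp_all add: plane_rotation_def inner_add_left algebra_simps)
  fix y
  have bc: "b \<bullet> b = 1" "c \<bullet> c = 1" "b \<bullet> c = 0" "c \<bullet> b = 0" using assms by (auto simp: inner_Basis)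
  define p where "p = (cos t - 1) * (y \<bullet> b) - sin t * (y \<bullet> c)"
  define q where "q = sin t * (y \<bullet> b) + (cos t - 1) * (y \<bullet> c)"
  have "plane_rotation b c t y \<bullet> plane_rotation b c t y
    = y \<bullet> y + 2 * p * (y \<bullet> b) + 2 * q * (y \<bullet> c) + p\<^sup>2 + q\<^sup>2"
    unfolding plane_rotation_def p_def[symmetric] q_def[symmetric]
    by (simp add: inner_add_left inner_add_right bc inner_commute[of b y] inner_commute[of c y]
        power2_eq_square algebra_simps)
  moreover have "2 * p * (y \<bullet> b) + 2 * q * (y \<bullet> c) + p\<^sup>2 + q\<^sup>2
    = ((cos t)\<^sup>2 + (sin t)\<^sup>2 - 1) * ((y \<bullet> b)\<^sup>2 + (y \<bullet> c)\<^sup>2)"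
  proof -
    have "2 * ((C - 1) * v - S * w) * v + 2 * (S * v + (C - 1) * w) * w + ((C - 1) * v - S * w)\<^sup>2
        + (S * v + (C - 1) * w)\<^sup>2 = (C\<^sup>2 + S\<^sup>2 - 1) * (v\<^sup>2 + w\<^sup>2)" for C S v w :: real
      by (simp add: power2_eq_square algebra_simps)
    then show ?thesis unfolding p_def q_def .
  qed
  ultimately have "plane_rotation b c t y \<bullet> plane_rotation b c t y = y \<bullet> y" by simp
  then show "norm (plane_rotation b c t y) = norm y" by (simp add: norm_eq_sqrt_inner)
qed

section \<open>Infinitesimal rotations as limits of orbit elements\<close>

lemma difference_quotient_sequence:
  fixes h :: "real \<Rightarrow> complex"
  assumes "(h has_vector_derivative h') (at 0)"
  shows "(\<lambda>n. of_nat (Suc n) * (h (inverse (of_nat (Suc n))) - h 0)) \<longlonglongrightarrow> h'"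
proof -
  have "((\<lambda>t. (h t - h 0) /\<^sub>R t) \<longlongrightarrow> h') (at 0)"
  proof (rule LIM_zero_cancel, rule tendsto_norm_zero_cancel)
    have "((\<lambda>t. norm (h t - h 0 - t *\<^sub>R h') / norm t) \<longlongrightarrow> 0) (at 0)"
      using assms unfolding has_vector_derivative_def has_derivative_at by simp
    then show "((\<lambda>t. norm ((h t - h 0) /\<^sub>R t - h')) \<longlongrightarrow> 0) (at 0)"
    proof (rule Lim_transform_eventually)
      have "norm (h t - h 0 - t *\<^sub>R h') / norm t = norm ((h t - h 0) /\<^sub>R t - h')" if "t \<noteq> 0" for t
      proof -
        have "(h t - h 0) /\<^sub>R t - h' = (h t - h 0 - t *\<^sub>R h') /\<^sub>R t"
          using that by (simp add: scaleR_right_diff_distrib)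
        then show ?thesis by (simp add: divide_inverse mult.commute)
      qed
      then show "\<forall>\<^sub>F t in at 0. norm (h t - h 0 - t *\<^sub>R h') / norm t = norm ((h t - h 0) /\<^sub>R t - h')"
        by (simp add: eventually_at_filter)
    qed
  qed
  moreover have "filterlim (\<lambda>n. inverse (of_nat (Suc n)) :: real) (at 0) sequentially"
    using LIMSEQ_inverse_real_of_nat by (auto simp: filterlim_at)
  ultimately have "(\<lambda>n. (h (inverse (of_nat (Suc n))) - h 0) /\<^sub>R inverse (of_nat (Suc n))) \<longlonglongrightarrow> h'"
    by (rule filterlim_compose)
  then show ?thesis by (simp add: scaleR_conv_of_real del: of_nat_Suc)
qed

lemma rot_gen_in_span_rot_orbit:
  fixes G :: "'a::euclidean_space \<Rightarrow> complex"
  assumes G: "smooth G" and fin: "finite B" "rot_orbit G \<subseteq> cfun.span B" and bc: "b \<in> Basis" "c \<in> Basis"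
  shows "rot_gen b c G \<in> cfun.span (rot_orbit G)"
proof (cases "b = c")
  case True
  then have 0: "rot_gen b c G = 0" by (simp add: rot_gen_def fun_eq_iff)
  show ?thesis unfolding 0 by (rule cfun.span_zero)
next
  case False
  obtain B' where B': "finite B'" "cfun.span B' = cfun.span (rot_orbit G)"
    using finite_spanning_set[OF fin] by blast
  define f where "f n = cscale (of_nat (Suc n)) ((\<lambda>y. G (plane_rotation b c (inverse (of_nat (Suc n))) y)) - G)" for n
  have "f n \<in> cfun.span B'" for n
    unfolding f_def B'(2)
    using orthogonal_plane_rotation[OF bc False] self_in_rot_orbit[of G]
    by (intro cfun.span_scale cfun.span_diff cfun.span_base) (auto simp: rot_orbit_def)
  moreover have "(\<lambda>n. f n y) \<longlonglongrightarrow> rot_gen b c G y" for y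
  proof -
    have p0: "plane_rotation b c 0 y = y" by (simp add: plane_rotation_def)
    have "((\<lambda>t. plane_rotation b c t y) has_derivative (\<lambda>h. h *\<^sub>R ((y \<bullet> b) *\<^sub>R c - (y \<bullet> c) *\<^sub>R b))) (at 0)"
      unfolding plane_rotation_def
      by (auto intro!: derivative_eq_intros simp: algebra_simps)
    from has_derivative_compose[OF this smooth_has_derivative[OF G]]
    have "((\<lambda>t. G (plane_rotation b c t y)) has_vector_derivative dderiv ((y \<bullet> b) *\<^sub>R c - (y \<bullet> c) *\<^sub>R b) G y) (at 0)"
      using G by (simp add: has_vector_derivative_def p0 dderiv_scaleR smooth_differentiable)
    moreover have "dderiv ((y \<bullet> b) *\<^sub>R c - (y \<bullet> c) *\<^sub>R b) G y = rot_gen b c G y"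
    proof -
      have "linear (\<lambda>v. dderiv v G y)"
        using smooth_has_derivative[OF G] has_derivative_linear by blast
      from linear_diff[OF this] linear_cmul[OF this] show ?thesis
        by (simp add: rot_gen_def coord_def scaleR_conv_of_real)
    qed
    ultimately have "((\<lambda>t. G (plane_rotation b c t y)) has_vector_derivative rot_gen b c G y) (at 0)"
      by simp
    from difference_quotient_sequence[OF this]
    show ?thesis by (simp add: f_def cscale_apply p0 del: of_nat_Suc)
  qed
  ultimately have "rot_gen b c G \<in> cfun.span B'"
    by (rule cfun_span_pointwise_limit[OF B'(1)])
  then show ?thesis by (simp add: B'(2))
qed

text \<open>One application stays in the span of the orbit, and so does the orbit of the result. It
  is therefore finite-dimensional again and admits a second application.\<close>

lemma rot_gen_span_closed:
  fixes G :: "'a::euclidean_space \<Rightarrow> complex"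
  assumes "smooth G" "finite B" "rot_orbit G \<subseteq> cfun.span B" "b \<in> Basis" "c \<in> Basis"
  shows "rot_gen b c (rot_gen b c G) \<in> cfun.span (rot_orbit G)"
proof -
  have 1: "rot_gen b c G \<in> cfun.span (rot_orbit G)"
    using assms by (rule rot_gen_in_span_rot_orbit)
  have sub: "cfun.span (rot_orbit (rot_gen b c G)) \<subseteq> cfun.span (rot_orbit G)"
    using 1 by (rule span_rot_orbit_subset)
  also have "\<dots> \<subseteq> cfun.span B"
    using assms(3) by (rule cfun.span_minimal[OF _ cfun.subspace_span])
  finally have "rot_orbit (rot_gen b c G) \<subseteq> cfun.span B"
    using order_trans[OF cfun.span_superset[of "rot_orbit (rot_gen b c G)"]] by simp
  then have "rot_gen b c (rot_gen b c G) \<in> cfun.span (rot_orbit (rot_gen b c G))"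
    by (rule rot_gen_in_span_rot_orbit[OF smooth_rot_gen[OF assms(1)] assms(2) _ assms(4,5)])
  with sub show ?thesis by blast
qed

lemma sum_fun_apply: "(\<Sum>i\<in>A. f i) x = (\<Sum>i\<in>A. f i x)"
  for f :: "'i \<Rightarrow> 'a \<Rightarrow> complex"
  by (induction A rule: infinite_finite_induct) auto

lemma sph_laplacian_in_span_rot_orbit:
  fixes G :: "'a::euclidean_space \<Rightarrow> complex"
  assumes "smooth G" "finite B" "rot_orbit G \<subseteq> cfun.span B"
  shows "sph_laplacian G \<in> cfun.span (rot_orbit G)"
proof -
  have eq: "sph_laplacian G = cscale (1 / 2) (\<Sum>b\<in>Basis. \<Sum>c\<in>Basis. rot_gen b c (rot_gen b c G))"
  proof
    fix y
    show "sph_laplacian G y = cscale (1 / 2) (\<Sum>b\<in>Basis. \<Sum>c\<in>Basis. rot_gen b c (rot_gen b c G)) y"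
      unfolding cscale_apply sum_fun_apply sph_laplacian_eq_rot_gen[OF assms(1), of y, symmetric] by simp
  qed
  show ?thesis
    unfolding eq by (intro cfun.span_scale cfun.span_sum rot_gen_span_closed[OF assms])
qed

text \<open>The functions \<open>G\<close> for which \<open>exp(-im\<theta>/2) G(y)\<close> lies in the kernel and is finite under rotations;
  equivariance becomes the parity condition with \<open>\<epsilon> = i^(m - q)\<close>.\<close>

definition slice_space :: "complex \<Rightarrow> complex \<Rightarrow> int \<Rightarrow> complex \<Rightarrow> ('a::euclidean_space \<Rightarrow> complex) set" where
  "slice_space s lam m \<epsilon> = {G. smooth G \<and> slice_pde s lam m G \<and> (\<forall>y. G (- y) = \<epsilon> * G y) \<and>
     (\<exists>B. finite B \<and> rot_orbit G \<subseteq> cfun.span B)}"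

lemma slice_spaceD:
  assumes "G \<in> slice_space s lam m \<epsilon>"
  shows "smooth G" "slice_pde s lam m G" "G (- y) = \<epsilon> * G y"
  using assms by (simp_all add: slice_space_def)

section \<open>Invariance of the slice spaces\<close>

lemma smooth_zero: "smooth (0 :: 'a::euclidean_space \<Rightarrow> complex)"
  using smooth_const[of 0] by (simp add: zero_fun_def)

lemma dderiv_zero: "dderiv v (0 :: 'a::real_normed_vector \<Rightarrow> 'b::real_normed_vector) = 0"
  using dderiv_const[of v 0] by (simp only: zero_fun_def)

lemma laplacian_add:
  "smooth f \<Longrightarrow> smooth g \<Longrightarrow> laplacian (\<lambda>y. f y + g y) y = laplacian f y + laplacian g y"
  by (simp add: laplacian_def smooth_dderiv_add smooth_dderiv sum.distrib)

lemma slice_pde_add: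
  fixes f g :: "'a::euclidean_space \<Rightarrow> complex"
  assumes "smooth f" "smooth g" "slice_pde s lam m f" "slice_pde s lam m g"
  shows "slice_pde s lam m (\<lambda>y. f y + g y)"
  unfolding slice_pde_def
proof
  fix y :: 'a
  let ?P = "4 * s\<^sup>2 * norm_sq y - 2 * \<i> * of_int m * s"
  have "norm_sq y * (laplacian (\<lambda>y. f y + g y) y + ?P * (f y + g y))
    = norm_sq y * (laplacian f y + ?P * f y) + norm_sq y * (laplacian g y + ?P * g y)"
    unfolding laplacian_add[OF assms(1,2)] by (simp only: distrib_left add_ac)
  then show "norm_sq y * (laplacian (\<lambda>y. f y + g y) y + ?P * (f y + g y)) = 2 * lam * (f y + g y)"
    using assms(3,4) by (simp only: slice_pde_def distrib_left)
qed

lemma slice_pde_cmult: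
  fixes f :: "'a::euclidean_space \<Rightarrow> complex"
  assumes "smooth f" "slice_pde s lam m f"
  shows "slice_pde s lam m (\<lambda>y. c * f y)"
  unfolding slice_pde_def
proof
  fix y :: 'a
  let ?P = "4 * s\<^sup>2 * norm_sq y - 2 * \<i> * of_int m * s"
  have "norm_sq y * (laplacian (\<lambda>y. c * f y) y + ?P * (c * f y)) = c * (norm_sq y * (laplacian f y + ?P * f y))"
    unfolding laplacian_cmult[OF assms(1)] by (simp only: distrib_left mult_ac)
  then show "norm_sq y * (laplacian (\<lambda>y. c * f y) y + ?P * (c * f y)) = 2 * lam * (c * f y)"
    using assms(2) by (simp only: slice_pde_def mult_ac)
qed

lemma slice_pde_orthogonal:
  fixes G :: "'a::euclidean_space \<Rightarrow> complex" and u :: "'a \<Rightarrow> 'a"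
  assumes "smooth G" "slice_pde s lam m G" "orthogonal_transformation u"
  shows "slice_pde s lam m (\<lambda>y. G (u y))"
  unfolding slice_pde_def
proof
  fix y
  have "norm_sq (u y) = norm_sq y"
    using assms(3) by (simp add: norm_sq_def orthogonal_transformation_norm)
  then show "norm_sq y * (laplacian (\<lambda>y. G (u y)) y + (4 * s\<^sup>2 * norm_sq y - 2 * \<i> * of_int m * s) * G (u y))
    = 2 * lam * G (u y)"
    using assms(2)[unfolded slice_pde_def, rule_format, of "u y"] laplacian_orthogonal[OF assms(1,3)] by simp
qed

text \<open>Smoothness, \<open>slice_pde\<close> and parity define a subspace that rotations
  preserve; parity because orthogonal transformations are linear.\<close>

lemma span_rot_orbit_slice:
  fixes G :: "'a::euclidean_space \<Rightarrow> complex"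
  assumes G: "G \<in> slice_space s lam m \<epsilon>" and H: "H \<in> cfun.span (rot_orbit G)"
  shows "H \<in> slice_space s lam m \<epsilon>"
proof -
  let ?Z = "{H :: 'a \<Rightarrow> complex. smooth H \<and> slice_pde s lam m H \<and> (\<forall>y. H (- y) = \<epsilon> * H y)}"
  have "cfun.subspace ?Z"
  proof (rule cfun.subspaceI)
    show "0 \<in> ?Z" by (simp add: slice_pde_def laplacian_def smooth_zero dderiv_zero)
  next
    fix f g :: "'a \<Rightarrow> complex" assume "f \<in> ?Z" "g \<in> ?Z"
    moreover have "f + g = (\<lambda>y. f y + g y)" by (simp add: fun_eq_iff)
    ultimately show "f + g \<in> ?Z"
      by (auto intro: slice_pde_add simp: distrib_left)
  next
    fix c :: complex and f :: "'a \<Rightarrow> complex" assume "f \<in> ?Z"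
    moreover have "cscale c f = (\<lambda>y. c * f y)" by (simp add: fun_eq_iff cscale_apply)
    ultimately show "cscale c f \<in> ?Z"
      by (auto intro: slice_pde_cmult simp: mult.left_commute)
  qed
  moreover have "rot_orbit G \<subseteq> ?Z"
  proof
    fix f assume "f \<in> rot_orbit G"
    then obtain u where u: "f = (\<lambda>y. G (u y))" "orthogonal_transformation u" by (auto simp: rot_orbit_def)
    have "linear u" using u(2) by (rule orthogonal_transformation_linear)
    then have "bounded_linear u" "u (- y) = - u y" for y
      by (simp_all add: linear_conv_bounded_linear linear_neg)
    then show "f \<in> ?Z"
      using G u slice_pde_orthogonal by (auto simp: slice_space_def smooth_linear)
  qed
  ultimately have "cfun.span (rot_orbit G) \<subseteq> ?Z" by (intro cfun.span_minimal)
  with H have HZ: "H \<in> ?Z" by blast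
  obtain B where B: "finite B" "rot_orbit G \<subseteq> cfun.span B"
    using G by (auto simp: slice_space_def)
  have "rot_orbit H \<subseteq> cfun.span (rot_orbit G)"
    using span_rot_orbit_subset[OF H] cfun.span_superset by blast
  also have "\<dots> \<subseteq> cfun.span B"
    using B(2) by (rule cfun.span_minimal[OF _ cfun.subspace_span])
  finally show ?thesis using B(1) HZ by (auto simp: slice_space_def)
qed

lemma subspace_slice_space: "cfun.subspace (slice_space s lam m \<epsilon> :: ('a::euclidean_space \<Rightarrow> complex) set)"
proof (rule cfun.subspaceI)
  have "rot_orbit (0 :: 'a \<Rightarrow> complex) \<subseteq> cfun.span {}" by (auto simp: rot_orbit_def fun_eq_iff)
  then have "\<exists>B. finite B \<and> rot_orbit (0 :: 'a \<Rightarrow> complex) \<subseteq> cfun.span B" by blast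
  then show "0 \<in> (slice_space s lam m \<epsilon> :: ('a \<Rightarrow> complex) set)"
    by (simp add: slice_space_def slice_pde_def laplacian_def smooth_zero dderiv_zero)
next
  fix f g :: "'a \<Rightarrow> complex" assume fg: "f \<in> slice_space s lam m \<epsilon>" "g \<in> slice_space s lam m \<epsilon>"
  have p: "f + g = (\<lambda>y. f y + g y)" by (simp add: fun_eq_iff)
  obtain B C where B: "finite B" "rot_orbit f \<subseteq> cfun.span B" and C: "finite C" "rot_orbit g \<subseteq> cfun.span C"
    using fg by (auto simp: slice_space_def)
  have "rot_orbit (f + g) \<subseteq> cfun.span (B \<union> C)"
  proof
    fix h assume "h \<in> rot_orbit (f + g)"
    then obtain u where u: "h = (\<lambda>y. f (u y)) + (\<lambda>y. g (u y))" "orthogonal_transformation u"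
      by (auto simp: rot_orbit_def fun_eq_iff)
    have "(\<lambda>y. f (u y)) \<in> cfun.span (B \<union> C)" "(\<lambda>y. g (u y)) \<in> cfun.span (B \<union> C)"
      using B C u(2) cfun.span_mono[of B "B \<union> C"] cfun.span_mono[of C "B \<union> C"]
      by (auto simp: rot_orbit_def)
    then show "h \<in> cfun.span (B \<union> C)" unfolding u(1) by (rule cfun.span_add)
  qed
  then have "\<exists>B. finite B \<and> rot_orbit (f + g) \<subseteq> cfun.span B"
    using B(1) C(1) by blast
  moreover have "smooth (f + g)" "slice_pde s lam m (f + g)" "(f + g) (- y) = \<epsilon> * (f + g) y" for y
    using fg unfolding p by (auto simp: slice_space_def distrib_left intro: slice_pde_add)
  ultimately show "f + g \<in> slice_space s lam m \<epsilon>"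
    by (simp add: slice_space_def)
next
  fix c :: complex and f :: "'a \<Rightarrow> complex" assume f: "f \<in> slice_space s lam m \<epsilon>"
  have "cscale c f \<in> cfun.span (rot_orbit f)"
    by (intro cfun.span_scale cfun.span_base self_in_rot_orbit)
  with f show "cscale c f \<in> slice_space s lam m \<epsilon>" by (rule span_rot_orbit_slice)
qed

lemma slice_space_semisimple:
  "semisimple_operator (slice_space s lam m \<epsilon> :: ('a::euclidean_space \<Rightarrow> complex) set) sph_laplacian"
proof (unfold_locales)
  let ?Y = "slice_space s lam m \<epsilon> :: ('a \<Rightarrow> complex) set"
  show Y: "cfun.subspace ?Y" by (rule subspace_slice_space)
  show closed: "sph_laplacian v \<in> ?Y" if v: "v \<in> ?Y" for v
  proof -
    obtain B where "finite B" "rot_orbit v \<subseteq> cfun.span B" "smooth v"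
      using v by (auto simp: slice_space_def)
    then have "sph_laplacian v \<in> cfun.span (rot_orbit v)" by (intro sph_laplacian_in_span_rot_orbit)
    with v show ?thesis by (rule span_rot_orbit_slice)
  qed
  have sm: "smooth v" if "v \<in> ?Y" for v using that by (simp add: slice_space_def)
  have eadd: "euler (\<lambda>y. f y + g y) = (\<lambda>y. euler f y + euler g y)" if "smooth f" "smooth g" for f g :: "'a \<Rightarrow> complex"
    using that by (auto simp: fun_eq_iff euler_def smooth_dderiv_add sum.distrib algebra_simps)
  have escale: "euler (\<lambda>y. c * f y) = (\<lambda>y. c * euler f y)" if "smooth f" for c and f :: "'a \<Rightarrow> complex"
    using that by (auto simp: fun_eq_iff euler_def smooth_dderiv_cmult sum_distrib_left algebra_simps)
  show "sph_laplacian (v + w) = sph_laplacian v + sph_laplacian w" if "v \<in> ?Y" "w \<in> ?Y" for v w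
  proof -
    have p: "v + w = (\<lambda>y. v y + w y)" by (simp add: fun_eq_iff)
    show ?thesis unfolding p using sm that
      by (auto simp: fun_eq_iff sph_laplacian_def eadd laplacian_add smooth_euler algebra_simps)
  qed
  show "sph_laplacian (cscale c v) = cscale c (sph_laplacian v)" if "v \<in> ?Y" for v c
  proof -
    have p: "cscale c v = (\<lambda>y. c * v y)" by (simp add: fun_eq_iff cscale_apply)
    show ?thesis unfolding p using sm that
      by (auto simp: fun_eq_iff cscale_apply sph_laplacian_def escale laplacian_cmult smooth_euler algebra_simps)
  qed
  show "sph_laplacian v = cscale a v"
    if v: "v \<in> ?Y" and 2: "sph_laplacian (sph_laplacian v - cscale a v) = cscale a (sph_laplacian v - cscale a v)"
    for v a
  proof -
    define w where "w = sph_laplacian v - cscale a v"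
    have w: "w \<in> ?Y" unfolding w_def
      using Y v closed by (intro cfun.subspace_diff cfun.subspace_scale)
    note v' = slice_spaceD[OF v] and w' = slice_spaceD[OF w]
    have e: "sph_laplacian v y - a * v y = w y" for y by (simp add: w_def cscale_apply)
    have e': "sph_laplacian w y = a * w y" for y
      unfolding w_def 2 by (simp only: cscale_apply)
    have "w y = 0" for y
      by (rule sph_laplacian_semisimple[of v s lam m \<epsilon> w a, OF v' w' e e'])
    then have "w = 0" by (simp add: fun_eq_iff)
    then show ?thesis by (simp add: w_def)
  qed
qed

text \<open>All iterates of \<open>sph_laplacian\<close> on \<open>G\<close> remain in the
  finite-dimensional span of its rotation orbit, so \<open>G\<close> is a sum of eigenvectors, each
  of which is classified.\<close>

lemma slice_space_span:
  fixes G :: "real^'n \<Rightarrow> complex"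
  assumes G: "G \<in> slice_space s lam m \<epsilon>"
  shows "G \<in> cfun.span {\<lambda>y. norm_sq y ^ l * p y * radial_factor CARD('n) s m (2 * l + k) (norm_sq y) | l k p.
    p \<in> harmonic_poly (int k) \<and> (\<exists>y. p y \<noteq> 0) \<and> \<epsilon> = (-1) ^ k \<and>
    lam = of_nat l * (2 * of_nat l + 2 * of_nat k + of_nat CARD('n) - 2)}" (is "_ \<in> cfun.span ?E")
proof -
  interpret semisimple_operator "slice_space s lam m \<epsilon> :: (real^'n \<Rightarrow> complex) set" sph_laplacian
    by (rule slice_space_semisimple)
  obtain B where B: "finite B" "rot_orbit G \<subseteq> cfun.span B" using G by (auto simp: slice_space_def)
  have BB: "cfun.span (rot_orbit G) \<subseteq> cfun.span B"
    using B(2) by (rule cfun.span_minimal[OF _ cfun.subspace_span])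
  have "(sph_laplacian ^^ i) G \<in> cfun.span (rot_orbit G)" for i
  proof (induction i)
    case 0
    show ?case using self_in_rot_orbit cfun.span_base by simp blast
  next
    case (Suc i)
    let ?H = "(sph_laplacian ^^ i) G"
    have sub: "cfun.span (rot_orbit ?H) \<subseteq> cfun.span (rot_orbit G)"
      using Suc by (rule span_rot_orbit_subset)
    have "?H \<in> slice_space s lam m \<epsilon>" using G Suc by (rule span_rot_orbit_slice)
    moreover have "rot_orbit ?H \<subseteq> cfun.span B"
      using sub BB cfun.span_superset by blast
    ultimately have "sph_laplacian ?H \<in> cfun.span (rot_orbit ?H)"
      using B(1) by (intro sph_laplacian_in_span_rot_orbit) (auto simp: slice_space_def)
    with sub show ?case by auto
  qed
  then have "G \<in> cfun.span eigenvectors"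
    using G B(1) BB by (intro in_span_eigenvectors) auto
  moreover have "eigenvectors \<subseteq> cfun.span ?E"
  proof
    fix v assume "v \<in> eigenvectors"
    then obtain a where v: "v \<in> slice_space s lam m \<epsilon>" "sph_laplacian v = cscale a v"
      by (auto simp: eigenvectors_def)
    show "v \<in> cfun.span ?E"
    proof (cases "v = 0")
      case True
      show ?thesis unfolding True by (rule cfun.span_zero)
    next
      case False
      then obtain y0 where "v y0 \<noteq> 0" by (auto simp: fun_eq_iff)
      moreover have "sph_laplacian v y = a * v y" for y using v(2) by (simp add: cscale_apply)
      moreover have "smooth v" "slice_pde s lam m v" "\<And>y. v (- y) = \<epsilon> * v y"
        using v(1) by (simp_all add: slice_space_def)
      ultimately have "v \<in> ?E"
        using eigenvector_classification[of v s lam m \<epsilon> a y0] by blast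
      then show ?thesis by (rule cfun.span_base)
    qed
  qed
  ultimately show ?thesis
    using cfun.span_minimal[OF _ cfun.subspace_span] by blast
qed

section \<open>Finiteness under angular translations\<close>

definition K_orbit :: "(real \<times> (real^'n) \<Rightarrow> complex) \<Rightarrow> (real \<times> (real^'n) \<Rightarrow> complex) set" where
  "K_orbit F = {K_act \<alpha> u F | \<alpha> u. orthogonal_transformation u}"

lemma K_finite_iff: "K_finite F \<longleftrightarrow> (\<exists>B. finite B \<and> K_orbit F \<subseteq> cfun.span B)"
proof
  assume "K_finite F"
  then obtain B where "finite B" "cfun.span (K_orbit F) = cfun.span B"
    by (auto simp: K_finite_def K_orbit_def)
  then show "\<exists>B. finite B \<and> K_orbit F \<subseteq> cfun.span B"
    using cfun.span_superset[of "K_orbit F"] by auto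
next
  assume "\<exists>B. finite B \<and> K_orbit F \<subseteq> cfun.span B"
  then obtain B' where "finite B'" "cfun.span B' = cfun.span (K_orbit F)"
    using finite_spanning_set by blast
  then show "K_finite F"
    unfolding K_finite_def K_orbit_def[symmetric] by (intro exI[of _ B'] conjI) simp_all
qed

lemma K_act_apply: "K_act \<alpha> u F (\<theta>, y) = F (\<theta> - \<alpha>, inv u y)"
  by (simp add: K_act_def)

lemma K_act_translation: "K_act \<alpha> (\<lambda>x. x) F = (\<lambda>(\<theta>, y). F (\<theta> - \<alpha>, y))"
  using inv_f_f[of "\<lambda>x. x"] by (simp add: K_act_def fun_eq_iff)

lemma K_act_in_orbit: "orthogonal_transformation u \<Longrightarrow> K_act \<alpha> u F \<in> K_orbit F"
  by (auto simp: K_orbit_def)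

lemma self_in_K_orbit: "F \<in> K_orbit F"
proof -
  have "K_act 0 (\<lambda>x. x) F = F" unfolding K_act_translation by (simp add: fun_eq_iff)
  then show ?thesis using K_act_in_orbit[of "\<lambda>x. x" 0 F] by simp
qed

lemma K_act_add: "K_act \<alpha> u (f + g) = K_act \<alpha> u f + K_act \<alpha> u g"
  and K_act_scale: "K_act \<alpha> u (cscale c f) = cscale c (K_act \<alpha> u f)"
  by (auto simp: K_act_def fun_eq_iff cscale_apply)

lemma K_act_K_act:
  fixes u w :: "real^'n \<Rightarrow> real^'n"
  assumes "orthogonal_transformation u" "orthogonal_transformation w"
  shows "K_act \<alpha> u (K_act \<beta> w F) = K_act (\<alpha> + \<beta>) (u \<circ> w) F"
  using o_inv_distrib[OF orthogonal_transformation_bij[OF assms(1)] orthogonal_transformation_bij[OF assms(2)]]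
  by (simp add: K_act_def fun_eq_iff algebra_simps)

lemma span_K_orbit_act:
  fixes F :: "real \<times> (real^'n) \<Rightarrow> complex"
  assumes "H \<in> cfun.span (K_orbit F)" "orthogonal_transformation u"
  shows "K_act \<alpha> u H \<in> cfun.span (K_orbit F)"
proof (rule cfun_span_image[where T = "K_act \<alpha> u", OF K_act_add K_act_scale assms(1)])
  fix f assume "f \<in> K_orbit F"
  then obtain \<beta> w where "f = K_act \<beta> w F" "orthogonal_transformation w" by (auto simp: K_orbit_def)
  then have "K_act \<alpha> u f \<in> K_orbit F"
    using assms(2) by (simp add: K_act_K_act K_act_in_orbit orthogonal_transformation_compose)
  then show "K_act \<alpha> u f \<in> cfun.span (K_orbit F)" by (rule cfun.span_base)
qed

lemma span_K_orbit_subset: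
  assumes "H \<in> cfun.span (K_orbit F)"
  shows "cfun.span (K_orbit H) \<subseteq> cfun.span (K_orbit F)"
  using span_K_orbit_act[OF assms]
  by (intro cfun.span_minimal cfun.subspace_span) (auto simp: K_orbit_def)

lemma smooth_slice:
  fixes F :: "real \<times> (real^'n) \<Rightarrow> complex"
  assumes "smooth F"
  shows "smooth (\<lambda>z. F (\<theta>, z))"
proof -
  have "bounded_linear (\<lambda>z::real^'n. (0::real, z))"
    by (intro bounded_linear_Pair bounded_linear_zero bounded_linear_ident)
  from smooth_affine[OF this assms, of "(\<theta>, 0)"] show ?thesis by simp
qed

section \<open>The kernel of \<open>Omega\<close> and its invariance under \<open>K\<close>\<close>

lemma Omega_apply:
  "Omega s F (\<theta>, y) = norm_sq y * (4 * s * dderiv (1, 0) F (\<theta>, y) + 4 * s\<^sup>2 * norm_sq y * F (\<theta>, y)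
     + laplacian (\<lambda>z. F (\<theta>, z)) y)"
  by (simp add: Omega_def norm_sq_def)

lemma Omega_add:
  fixes F G :: "real \<times> (real^'n) \<Rightarrow> complex"
  assumes "smooth F" "smooth G"
  shows "Omega s (\<lambda>p. F p + G p) p = Omega s F p + Omega s G p"
proof (cases p)
  case (Pair \<theta> y)
  show ?thesis unfolding Pair Omega_apply
    using laplacian_add[OF smooth_slice[OF assms(1)] smooth_slice[OF assms(2)], of \<theta> \<theta> y]
      fun_cong[OF smooth_dderiv_add[OF assms], of "(1, 0)" "(\<theta>, y)"]
    by (simp add: algebra_simps)
qed

lemma Omega_cmult:
  fixes F :: "real \<times> (real^'n) \<Rightarrow> complex"
  assumes "smooth F"
  shows "Omega s (\<lambda>p. c * F p) p = c * Omega s F p"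
proof (cases p)
  case (Pair \<theta> y)
  show ?thesis unfolding Pair Omega_apply
    using laplacian_cmult[OF smooth_slice[OF assms], of c \<theta> y]
      fun_cong[OF smooth_dderiv_cmult[OF assms], of "(1, 0)" c "(\<theta>, y)"]
    by (simp add: algebra_simps)
qed

lemma Omega_zero: "Omega s (0 :: real \<times> (real^'n) \<Rightarrow> complex) p = 0"
  using Omega_cmult[OF smooth_zero, of s 0 p] by (simp add: zero_fun_def)

lemma Omega_kernelD:
  assumes "F \<in> Omega_kernel q s lam"
  shows "smooth F" "F (\<theta> + of_int j * pi, ((-1) powi j) *\<^sub>R y) = \<i> powi (- j * q) * F (\<theta>, y)"
    "Omega s F p = 2 * lam * F p"
  using assms by (cases p; auto simp: Omega_kernel_def I_space_def)+

lemma Omega_kernelI: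
  assumes "smooth F" "\<And>j \<theta> y. F (\<theta> + of_int j * pi, ((-1) powi j) *\<^sub>R y) = \<i> powi (- j * q) * F (\<theta>, y)"
    "\<And>p. Omega s F p = 2 * lam * F p"
  shows "F \<in> Omega_kernel q s lam"
  using assms by (auto simp: Omega_kernel_def I_space_def)

lemma subspace_Omega_kernel: "cfun.subspace (Omega_kernel q s lam :: (real \<times> (real^'n) \<Rightarrow> complex) set)"
proof (rule cfun.subspaceI)
  show "(0 :: real \<times> (real^'n) \<Rightarrow> complex) \<in> Omega_kernel q s lam"
    by (rule Omega_kernelI) (simp_all add: smooth_zero Omega_zero)
next
  fix F G :: "real \<times> (real^'n) \<Rightarrow> complex"
  assume F: "F \<in> Omega_kernel q s lam" and G: "G \<in> Omega_kernel q s lam"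
  have p: "F + G = (\<lambda>p. F p + G p)" by (simp add: fun_eq_iff)
  show "F + G \<in> Omega_kernel q s lam"
    unfolding p
    by (rule Omega_kernelI)
      (simp_all only: smooth_add Omega_kernelD[OF F] Omega_kernelD[OF G] Omega_add distrib_left)
next
  fix c :: complex and F :: "real \<times> (real^'n) \<Rightarrow> complex"
  assume F: "F \<in> Omega_kernel q s lam"
  have p: "cscale c F = (\<lambda>p. c * F p)" by (simp add: fun_eq_iff cscale_apply)
  show "cscale c F \<in> Omega_kernel q s lam"
    unfolding p
    by (rule Omega_kernelI)
      (simp_all only: smooth_mult smooth_const Omega_kernelD[OF F] Omega_cmult mult.left_commute)
qed

text \<open>Translations commute with d/d\<theta>, rotations preserve \<rho> and the Laplacian, and
  linear maps commute with the sign in the equivariance condition.\<close>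

lemma K_act_Omega_kernel:
  fixes F :: "real \<times> (real^'n) \<Rightarrow> complex"
  assumes F: "F \<in> Omega_kernel q s lam" and u: "orthogonal_transformation u"
  shows "K_act \<alpha> u F \<in> Omega_kernel q s lam"
proof (rule Omega_kernelI)
  define w where "w = inv u"
  have w: "orthogonal_transformation w" unfolding w_def using u by (rule orthogonal_transformation_inv)
  then have lin: "linear w" by (rule orthogonal_transformation_linear)
  define A where "A p = (fst p, w (snd p))" for p :: "real \<times> (real^'n)"
  have A: "bounded_linear A"
    unfolding A_def using lin
    by (intro bounded_linear_Pair bounded_linear_fst bounded_linear_compose[OF _ bounded_linear_snd])
      (simp add: linear_conv_bounded_linear)
  have K: "K_act \<alpha> u F = (\<lambda>p. F ((-\<alpha>, 0) + A p))"
    by (simp add: fun_eq_iff K_act_def A_def w_def)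
  note smF = Omega_kernelD(1)[OF F]
  show "smooth (K_act \<alpha> u F)" unfolding K using A smF by (rule smooth_affine)
  show "K_act \<alpha> u F (\<theta> + of_int j * pi, ((-1) powi j) *\<^sub>R y) = \<i> powi (- j * q) * K_act \<alpha> u F (\<theta>, y)" for j \<theta> y
    using Omega_kernelD(2)[OF F, of "\<theta> - \<alpha>" j "w y"]
    by (simp add: K_act_apply w_def[symmetric] linear_cmul[OF lin] algebra_simps)
  show "Omega s (K_act \<alpha> u F) p = 2 * lam * K_act \<alpha> u F p" for p
  proof (cases p)
    case (Pair \<theta> y)
    have "dderiv (1, 0) (K_act \<alpha> u F) (\<theta>, y) = dderiv (A (1, 0)) F ((-\<alpha>, 0) + A (\<theta>, y))"
      unfolding K by (rule dderiv_affine[OF A smooth_differentiable[OF smF]])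
    then have d: "dderiv (1, 0) (K_act \<alpha> u F) (\<theta>, y) = dderiv (1, 0) F (\<theta> - \<alpha>, w y)"
      by (simp add: A_def linear_0[OF lin])
    have l: "laplacian (\<lambda>z. F (\<theta> - \<alpha>, w z)) y = laplacian (\<lambda>z. F (\<theta> - \<alpha>, z)) (w y)"
      by (rule laplacian_orthogonal[OF smooth_slice[OF smF] w])
    have n: "norm_sq (w y) = norm_sq y"
      using w by (simp add: norm_sq_def orthogonal_transformation_norm)
    show ?thesis
      using Omega_kernelD(3)[OF F, of "(\<theta> - \<alpha>, w y)"]
      unfolding Pair Omega_apply d K_act_apply w_def[symmetric] l n .
  qed
qed

lemma K_finite_kernel_iff:
  "F \<in> K_finite_kernel q s lam \<longleftrightarrow> F \<in> Omega_kernel q s lam \<and> (\<exists>B. finite B \<and> K_orbit F \<subseteq> cfun.span B)"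
  by (simp add: K_finite_kernel_def K_finite_iff)

lemma span_K_orbit_K_finite_kernel:
  fixes F :: "real \<times> (real^'n) \<Rightarrow> complex"
  assumes F: "F \<in> K_finite_kernel q s lam" and H: "H \<in> cfun.span (K_orbit F)"
  shows "H \<in> K_finite_kernel q s lam"
proof -
  obtain B where B: "finite B" "K_orbit F \<subseteq> cfun.span B" and FO: "F \<in> Omega_kernel q s lam"
    using F by (auto simp: K_finite_kernel_iff)
  have "K_orbit F \<subseteq> Omega_kernel q s lam"
    using K_act_Omega_kernel[OF FO] by (auto simp: K_orbit_def)
  then have "H \<in> Omega_kernel q s lam"
    using H cfun.span_minimal[OF _ subspace_Omega_kernel] by blast
  moreover have "K_orbit H \<subseteq> cfun.span (K_orbit F)"
    using order_trans[OF cfun.span_superset span_K_orbit_subset[OF H]] .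
  then have "K_orbit H \<subseteq> cfun.span B"
    using order_trans[OF _ cfun.span_minimal[OF B(2) cfun.subspace_span]] by blast
  ultimately show ?thesis using B(1) by (auto simp: K_finite_kernel_iff)
qed

lemma subspace_K_finite_kernel:
  "cfun.subspace (K_finite_kernel q s lam :: (real \<times> (real^'n) \<Rightarrow> complex) set)"
proof (rule cfun.subspaceI)
  have "K_orbit (0 :: real \<times> (real^'n) \<Rightarrow> complex) \<subseteq> cfun.span {}"
    by (auto simp: K_orbit_def K_act_def fun_eq_iff)
  then have "\<exists>B. finite B \<and> K_orbit (0 :: real \<times> (real^'n) \<Rightarrow> complex) \<subseteq> cfun.span B" by blast
  then show "(0 :: real \<times> (real^'n) \<Rightarrow> complex) \<in> K_finite_kernel q s lam"
    by (simp add: K_finite_kernel_iff cfun.subspace_0[OF subspace_Omega_kernel])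
next
  fix F G :: "real \<times> (real^'n) \<Rightarrow> complex"
  assume FG: "F \<in> K_finite_kernel q s lam" "G \<in> K_finite_kernel q s lam"
  then obtain B C where B: "finite B" "K_orbit F \<subseteq> cfun.span B" and C: "finite C" "K_orbit G \<subseteq> cfun.span C"
    by (auto simp: K_finite_kernel_iff)
  have "K_orbit (F + G) \<subseteq> cfun.span (B \<union> C)"
  proof
    fix h assume "h \<in> K_orbit (F + G)"
    then obtain \<alpha> u where u: "h = K_act \<alpha> u F + K_act \<alpha> u G" "orthogonal_transformation u"
      by (auto simp: K_orbit_def K_act_add)
    have "K_act \<alpha> u F \<in> cfun.span (B \<union> C)"
      using B(2) K_act_in_orbit[OF u(2)] cfun.span_mono[of B "B \<union> C"] by blast
    moreover have "K_act \<alpha> u G \<in> cfun.span (B \<union> C)"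
      using C(2) K_act_in_orbit[OF u(2)] cfun.span_mono[of C "B \<union> C"] by blast
    ultimately show "h \<in> cfun.span (B \<union> C)" unfolding u(1) by (rule cfun.span_add)
  qed
  then have "\<exists>B. finite B \<and> K_orbit (F + G) \<subseteq> cfun.span B"
    using finite_UnI[OF B(1) C(1)] by blast
  then show "F + G \<in> K_finite_kernel q s lam"
    using FG by (simp add: K_finite_kernel_iff cfun.subspace_add[OF subspace_Omega_kernel])
next
  fix c :: complex and F :: "real \<times> (real^'n) \<Rightarrow> complex"
  assume F: "F \<in> K_finite_kernel q s lam"
  have "cscale c F \<in> cfun.span (K_orbit F)"
    by (intro cfun.span_scale cfun.span_base self_in_K_orbit)
  with F show "cscale c F \<in> K_finite_kernel q s lam" by (rule span_K_orbit_K_finite_kernel)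
qed

section \<open>Diagonalising the angular derivative\<close>

lemma has_vector_derivative_angle:
  fixes F :: "real \<times> (real^'n) \<Rightarrow> complex"
  assumes "smooth F"
  shows "((\<lambda>t. F (t, y)) has_vector_derivative dderiv (1, 0) F (\<theta>, y)) (at \<theta>)"
proof -
  have "((\<lambda>t::real. (t, y)) has_derivative (\<lambda>h. (h, 0))) (at \<theta>)"
    by (rule has_derivative_Pair[OF has_derivative_ident has_derivative_const])
  from has_derivative_compose[OF this smooth_has_derivative[OF assms]]
  have "((\<lambda>t. F (t, y)) has_derivative (\<lambda>h. dderiv (h, 0) F (\<theta>, y))) (at \<theta>)" .
  moreover have "dderiv (h, 0) F (\<theta>, y) = h *\<^sub>R dderiv (1, 0) F (\<theta>, y)" for h
  proof -
    have "(h, 0) = h *\<^sub>R (1::real, 0::real^'n)" by simp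
    then show ?thesis
      using dderiv_scaleR[OF smooth_differentiable[OF assms], of h "(1, 0)" "(\<theta>, y)"] by (simp only:)
  qed
  then have "(\<lambda>h. dderiv (h, 0) F (\<theta>, y)) = (\<lambda>h. h *\<^sub>R dderiv (1, 0) F (\<theta>, y))"
    by (rule ext)
  ultimately show ?thesis unfolding has_vector_derivative_def by metis
qed

lemma angle_derivative_in_span_K_orbit:
  fixes F :: "real \<times> (real^'n) \<Rightarrow> complex"
  assumes "smooth F" and fin: "finite B" "K_orbit F \<subseteq> cfun.span B"
  shows "dderiv (1, 0) F \<in> cfun.span (K_orbit F)"
proof -
  obtain B' where B': "finite B'" "cfun.span B' = cfun.span (K_orbit F)"
    using finite_spanning_set[OF fin] by blast
  \<comment> \<open>\<open>K_act\<close> subtracts its angle, so the negative angle gives the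
    forward difference quotient.\<close>
  define f where "f n = cscale (of_nat (Suc n)) (K_act (- inverse (of_nat (Suc n))) (\<lambda>x. x) F - F)" for n
  have "f n \<in> cfun.span B'" for n
    unfolding f_def B'(2)
    by (rule cfun.span_scale[OF cfun.span_diff[OF cfun.span_base[OF K_act_in_orbit]
          cfun.span_base[OF self_in_K_orbit]]]) simp
  moreover have "(\<lambda>n. f n p) \<longlonglongrightarrow> dderiv (1, 0) F p" for p
  proof (cases p)
    case (Pair \<theta> y)
    have "((\<lambda>t. F (\<theta> + t, y)) has_vector_derivative dderiv (1, 0) F (\<theta>, y)) (at 0)"
    proof -
      have "((\<lambda>t. \<theta> + t) has_vector_derivative 1) (at 0)"
        by (auto intro!: derivative_eq_intros)
      from vector_diff_chain_at[OF this, of "\<lambda>t. F (t, y)" "dderiv (1, 0) F (\<theta>, y)"]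
      show ?thesis using has_vector_derivative_angle[OF assms(1), of y \<theta>] by (simp add: o_def)
    qed
    from difference_quotient_sequence[OF this]
    have "(\<lambda>n. of_nat (Suc n) * (F (\<theta> + inverse (of_nat (Suc n)), y) - F (\<theta>, y)))
      \<longlonglongrightarrow> dderiv (1, 0) F (\<theta>, y)" by (simp only: add_0_right)
    moreover have "f n (\<theta>, y) = of_nat (Suc n) * (F (\<theta> + inverse (of_nat (Suc n)), y) - F (\<theta>, y))" for n
      unfolding f_def cscale_apply minus_apply K_act_translation by (simp only: prod.case diff_minus_eq_add)
    ultimately show ?thesis unfolding Pair by (simp only:)
  qed
  ultimately have "dderiv (1, 0) F \<in> cfun.span B'"
    by (rule cfun_span_pointwise_limit[OF B'(1)])
  then show ?thesis by (simp add: B'(2))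
qed

lemma vector_derivative_zero_constant_real:
  fixes f :: "real \<Rightarrow> complex"
  assumes "\<And>t. (f has_vector_derivative 0) (at t)"
  shows "f t = f 0"
proof -
  obtain c where "\<And>x. x \<in> UNIV \<Longrightarrow> f x = c"
    by (rule has_vector_derivative_zero_constant[of UNIV f]) (simp_all add: assms)
  then show ?thesis by simp
qed

lemma exp_solution:
  fixes f :: "real \<Rightarrow> complex"
  assumes "\<And>t. (f has_vector_derivative a * f t) (at t)"
  shows "f t = exp (a * of_real t) * f 0"
proof -
  have e: "((\<lambda>t. exp (- a * of_real t)) has_vector_derivative - a * exp (- a * of_real t)) (at t)" for t
    by (rule has_vector_derivative_real_field) (auto intro!: derivative_eq_intros)
  have "((\<lambda>t. exp (- a * of_real t) * f t) has_vector_derivative 0) (at t)" for t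
    using has_vector_derivative_mult[OF e assms, of t] by (simp add: algebra_simps)
  from vector_derivative_zero_constant_real[OF this, of t]
  show ?thesis by (simp add: exp_minus field_simps)
qed

text \<open>Take j = 4: the sign of y returns to 1 and i^(-4q) = 1.\<close>

lemma Omega_kernel_periodic:
  assumes "F \<in> Omega_kernel q s lam"
  shows "F (\<theta> + 4 * pi, y) = F (\<theta>, y)"
proof -
  have "\<i> powi (- (4 * q)) = 1"
    by (simp only: power_int_minus power_int_mult) simp
  then show ?thesis using Omega_kernelD(2)[OF assms, of \<theta> 4 y] by simp
qed

text \<open>A Jordan block would produce the secular term \<open>\<theta> exp(a\<theta>)\<close>, which is not periodic.\<close>

lemma angle_derivative_semisimple:
  assumes F: "F \<in> Omega_kernel q s lam" and H: "H \<in> Omega_kernel q s lam"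
    and FH: "\<And>p. dderiv (1, 0) F p = a * F p + H p" "\<And>p. dderiv (1, 0) H p = a * H p"
  shows "H p = 0"
proof (cases p)
  case (Pair \<theta> y)
  have dH: "((\<lambda>t. H (t, y)) has_vector_derivative a * H (t, y)) (at t)" for t
    using has_vector_derivative_angle[OF Omega_kernelD(1)[OF H], of y t] by (simp add: FH)
  have Hexp: "H (t, y) = exp (a * of_real t) * H (0, y)" for t
    by (rule exp_solution[of "\<lambda>t. H (t, y)", OF dH])
  \<comment> \<open>Removing the secular term leaves a solution of f' = a f.\<close>
  define f where "f t = F (t, y) - of_real t * H (t, y)" for t
  have "(f has_vector_derivative a * f t) (at t)" for t
  proof -
    have dF: "((\<lambda>t. F (t, y)) has_vector_derivative a * F (t, y) + H (t, y)) (at t)"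
      using has_vector_derivative_angle[OF Omega_kernelD(1)[OF F], of y t] by (simp add: FH)
    from has_vector_derivative_diff[OF dF has_vector_derivative_mult[OF has_vector_derivative_of_real[OF DERIV_ident] dH[of t]]]
    show ?thesis unfolding f_def by (simp add: algebra_simps)
  qed
  from exp_solution[OF this]
  have Fexp: "F (t, y) - of_real t * H (t, y) = exp (a * of_real t) * F (0, y)" for t
    by (simp add: f_def)
  \<comment> \<open>If H(0, y) were nonzero, periodicity of \<open>H\<close> would give
    \<open>?e = 1\<close>, and periodicity of \<open>F\<close> would then leave 4 pi H(0, y) =
    0.\<close>
  let ?e = "exp (a * of_real (4 * pi))"
  have 1: "H (0, y) = ?e * H (0, y)"
    using Hexp[of "4 * pi"] Omega_kernel_periodic[OF H, of 0 y] by simp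
  have 2: "F (0, y) - of_real (4 * pi) * H (0, y) = ?e * F (0, y)"
    using Fexp[of "4 * pi"] Omega_kernel_periodic[OF F, of 0 y] Omega_kernel_periodic[OF H, of 0 y] by simp
  have "H (0, y) = 0"
  proof (rule ccontr)
    assume nz: "H (0, y) \<noteq> 0"
    then have "?e = 1" using 1 by simp
    then have "of_real (4 * pi) * H (0, y) = 0" using 2 by simp
    then show False using nz by simp
  qed
  then show ?thesis using Hexp[of \<theta>] Pair by simp
qed

lemma K_finite_kernel_semisimple:
  "semisimple_operator (K_finite_kernel q s lam :: (real \<times> (real^'n) \<Rightarrow> complex) set) (dderiv (1, 0))"
proof (unfold_locales)
  let ?X = "K_finite_kernel q s lam :: (real \<times> (real^'n) \<Rightarrow> complex) set"
  show X: "cfun.subspace ?X" by (rule subspace_K_finite_kernel)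
  have O: "v \<in> Omega_kernel q s lam" if "v \<in> ?X" for v using that by (simp add: K_finite_kernel_iff)
  have sm: "smooth v" if "v \<in> ?X" for v using Omega_kernelD(1)[OF O[OF that]] .
  show closed: "dderiv (1, 0) v \<in> ?X" if v: "v \<in> ?X" for v
  proof -
    obtain B where "finite B" "K_orbit v \<subseteq> cfun.span B"
      using v by (auto simp: K_finite_kernel_iff)
    then have "dderiv (1, 0) v \<in> cfun.span (K_orbit v)"
      by (rule angle_derivative_in_span_K_orbit[OF sm[OF v]])
    with v show ?thesis by (rule span_K_orbit_K_finite_kernel)
  qed
  show "dderiv (1, 0) (v + w) = dderiv (1, 0) v + dderiv (1, 0) w" if "v \<in> ?X" "w \<in> ?X" for v w
    using smooth_dderiv_add[OF sm[OF that(1)] sm[OF that(2)], of "(1, 0)"] by (simp add: plus_fun_def)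
  show "dderiv (1, 0) (cscale c v) = cscale c (dderiv (1, 0) v)" if "v \<in> ?X" for v c
    using smooth_dderiv_cmult[OF sm[OF that], of "(1, 0)" c] by (simp add: cscale_def)
  show "dderiv (1, 0) v = cscale a v"
    if v: "v \<in> ?X" and 2: "dderiv (1, 0) (dderiv (1, 0) v - cscale a v) = cscale a (dderiv (1, 0) v - cscale a v)"
    for v a
  proof -
    define w where "w = dderiv (1, 0) v - cscale a v"
    have w: "w \<in> ?X" unfolding w_def
      by (rule cfun.subspace_diff[OF X closed[OF v] cfun.subspace_scale[OF X v]])
    have e: "dderiv (1, 0) v p = a * v p + w p" for p by (simp add: w_def cscale_apply)
    have e': "dderiv (1, 0) w p = a * w p" for p
      unfolding w_def 2 by (simp only: cscale_apply)
    have "w p = 0" for p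
      by (rule angle_derivative_semisimple[OF O[OF v] O[OF w] e e'])
    then have "w = 0" by (simp add: fun_eq_iff)
    then show ?thesis by (simp add: w_def)
  qed
qed

section \<open>The kernel is spanned by the functions \<open>F_fun\<close>\<close>

lemma i_powi_eq_1_iff: "\<i> powi n = 1 \<longleftrightarrow> 4 dvd n"
proof -
  have "\<i> powi n = \<i> powi (4 * (n div 4)) * \<i> powi (n mod 4)"
    by (subst power_int_add[symmetric]) simp_all
  also have "\<i> powi (4 * (n div 4)) = 1" by (simp only: power_int_mult) simp
  finally have *: "\<i> powi n = \<i> powi (n mod 4)" by simp
  have "n mod 4 = 0 \<or> n mod 4 = 1 \<or> n mod 4 = 2 \<or> n mod 4 = 3" by presburger
  moreover have "\<i> powi 3 = - \<i>" "\<i> powi 2 = - 1"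
    by (simp_all add: power3_eq_cube)
  ultimately show ?thesis unfolding * dvd_eq_mod_eq_0
    by (auto simp: complex_eq_iff)
qed

lemma exp_quarter_turns: "exp (- \<i> * of_int m * of_real (of_int j * pi) / 2) = \<i> powi (- m * j)"
proof -
  have i: "\<i> = exp (\<i> * of_real (pi / 2))" by (simp only: cis_conv_exp[symmetric] cis_pi_half)
  have "\<i> powi (- m * j) = exp (of_int (- m * j) * (\<i> * of_real (pi / 2)))"
    by (subst i) (simp only: exp_power_int)
  also have "of_int (- m * j) * (\<i> * of_real (pi / 2)) = - \<i> * of_int m * of_real (of_int j * pi) / 2"
    by simp
  finally show ?thesis by simp
qed

lemma F_fun_eq:
  fixes h :: "real^'n \<Rightarrow> complex"
  shows "F_fun s m (int l) (int k) h = (\<lambda>(\<theta>, y). exp (- \<i> * of_int m * of_real \<theta> / 2) *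
    (norm_sq y ^ l * h y * radial_factor CARD('n) s m (2 * l + k) (norm_sq y)))"
proof (rule ext, clarify)
  fix \<theta> :: real and y :: "real^'n"
  have "norm y powi (2 * int l) = (norm y) ^ (2 * l)"
    by (metis of_nat_mult of_nat_numeral power_int_of_nat)
  then have p: "of_real (norm y powi (2 * int l)) = norm_sq y ^ l"
    by (simp add: norm_sq_def power_mult)
  have a: "of_int (m + 4 * int l + 2 * int k + int CARD('n))
    = (of_int m + 2 * of_nat (2 * l + k) + of_nat CARD('n) :: complex)" by simp
  have b: "2 * of_int (int l) + of_int (int k) = (of_nat (2 * l + k) :: complex)" by simp
  show "F_fun s m (int l) (int k) h (\<theta>, y) = exp (- \<i> * of_int m * of_real \<theta> / 2) *
    (norm_sq y ^ l * h y * radial_factor CARD('n) s m (2 * l + k) (norm_sq y))"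
    unfolding F_fun_def radial_factor_def prod.case p a b norm_sq_def[symmetric]
    by (simp only: mult_ac)
qed

text \<open>For n = 1 the angular part and the Laplacian of \<open>h\<close> both vanish, so E^2 - E
  does as well, and k^2 = k.\<close>

lemma harmonic_poly_dim_1:
  fixes h :: "real^'n \<Rightarrow> complex"
  assumes "CARD('n) = 1" "h \<in> harmonic_poly (int k)" "h y \<noteq> 0"
  shows "k = 0 \<or> k = 1"
proof -
  note h = harmonic_polyD[OF assms(2)]
  have e: "euler h = (\<lambda>y. of_nat k * h y)" using homogeneous_euler[OF h(4,2)] by (simp add: fun_eq_iff)
  have "euler (\<lambda>y. of_nat k * h y) y = of_nat k * euler h y"
    using h(2) by (simp add: euler_def smooth_dderiv_cmult sum_distrib_left algebra_simps)
  moreover have "sph_laplacian h y = 0" by (rule sph_laplacian_dim1[OF h(2)]) (simp add: assms(1))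
  ultimately show ?thesis
    using assms(3) by (auto simp: sph_laplacian_def h(3) e assms(1))
qed

text \<open>For n = 1 both forms of the eigenvalue agree: (2l + k)(2l + k - 1)/2 exceeds l(2l + 2k -
  1) by k(k - 1)/2, which is 0 for k = 0 and k = 1.\<close>

lemma admissible_pairI:
  fixes h :: "real^'n \<Rightarrow> complex"
  assumes "h \<in> harmonic_poly (int k)" "h y \<noteq> 0"
    and lam: "lam = of_nat l * (2 * of_nat l + 2 * of_nat k + of_nat CARD('n) - 2)"
  shows "admissible_pair CARD('n) lam (int l) (int k)"
proof (cases "CARD('n) = 1")
  case True
  then have "k = 0 \<or> k = 1" using harmonic_poly_dim_1 assms(1,2) by blast
  then show ?thesis
    unfolding lam admissible_pair_def using True by (auto simp: field_simps)
next
  case False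
  then show ?thesis using lam by (auto simp: admissible_pair_def)
qed

lemma admissible_pair_eigenvalue:
  assumes "admissible_pair n lam (int l) (int k)"
  shows "lam = of_nat l * (2 * of_nat l + 2 * of_nat k + of_nat n - 2)"
proof (cases "n = 1")
  case True
  then have "k = 0 \<or> k = 1" and L: "lam = of_int ((2 * int l + int k) * (2 * int l + int k - 1)) / 2"
    using assms by (auto simp: admissible_pair_def)
  then show ?thesis unfolding L using True by (auto simp: field_simps)
next
  case False
  then show ?thesis using assms by (simp add: admissible_pair_def)
qed

lemma admissible_pair_imp_admissible:
  assumes "n > 0" "admissible_pair n lam (int l) (int k)"
  shows "admissible n lam"
proof (cases "n = 1")
  case True
  then show ?thesis using assms
    by (auto simp: admissible_pair_def admissible_def intro!: exI[of _ "2 * int l + int k"])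
next
  case False
  show ?thesis
  proof (cases "l = 0")
    case True
    then show ?thesis using assms False by (simp add: admissible_pair_def admissible_def)
  next
    case l: False
    \<comment> \<open>With j = l + k - 1 the condition l \<le> j + 1 says that k is
      nonnegative.\<close>
    have "int l * (int n + 2 * (int l + int k - 1)) \<in> A_set n"
      unfolding A_set_def using l by (intro CollectI exI[of _ "int l"] exI[of _ "int l + int k - 1"]) auto
    moreover have "lam = of_int (int l * (int n + 2 * (int l + int k - 1)))"
      using assms False by (simp add: admissible_pair_def algebra_simps)
    ultimately have "lam \<in> of_int ` A_set n" by blast
    then show ?thesis using False by (simp only: admissible_def) simp
  qed
qed

lemma admissible_imp_admissible_pair:
  assumes "n > 0" "admissible n lam"
  shows "\<exists>l k. admissible_pair n lam (int l) (int k) \<and> (n = 1 \<longrightarrow> k \<le> 1)"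
proof (cases "n = 1")
  case True
  then obtain L :: int where L: "L \<ge> 0" "lam = of_int (L * (L - 1)) / 2"
    using assms(2) by (auto simp: admissible_def)
  \<comment> \<open>For n = 1 the order L = 2l + k is split into its even part and its
    parity.\<close>
  have "L = 2 * int (nat (L div 2)) + int (nat (L mod 2))" using L(1) by simp
  then have "admissible_pair n lam (int (nat (L div 2))) (int (nat (L mod 2)))"
    using L True by (auto simp: admissible_pair_def)
  moreover have "nat (L mod 2) \<le> 1" by simp
  ultimately show ?thesis by blast
next
  case False
  show ?thesis
  proof (cases "lam = 0")
    case True
    then show ?thesis using False
      by (intro exI[of _ 0]) (auto simp: admissible_pair_def)
  next
    case nz: False
    then obtain l j where lj: "lam = of_int (l * (int n + 2 * j))" "1 \<le> l" "l \<le> j + 1"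
      using assms(2) False by (auto simp: admissible_def A_set_def)
    \<comment> \<open>k = j + 1 - l turns n + 2j into 2l + 2k + n - 2; it is nonnegative by the
      upper bound on l.\<close>
    then have "admissible_pair n lam (int (nat l)) (int (nat (j + 1 - l)))"
      using False by (auto simp: admissible_pair_def algebra_simps)
    then show ?thesis using False by blast
  qed
qed

lemma angle_eigenfunction:
  fixes F :: "real \<times> (real^'n) \<Rightarrow> complex"
  assumes F: "F \<in> K_finite_kernel q s lam" and eig: "\<And>p. dderiv (1, 0) F p = a * F p" and "F p0 \<noteq> 0"
  shows "\<exists>m G. F = (\<lambda>(\<theta>, y). exp (- \<i> * of_int m * of_real \<theta> / 2) * G y) \<and>
    G \<in> slice_space s lam m (\<i> powi (m - q))"
proof -
  define G where "G y = F (0, y)" for y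
  have FO: "F \<in> Omega_kernel q s lam" using F by (simp add: K_finite_kernel_iff)
  note smF = Omega_kernelD(1)[OF FO]
  have dF: "((\<lambda>t. F (t, y)) has_vector_derivative a * F (t, y)) (at t)" for t y
    using has_vector_derivative_angle[OF smF, of y t] by (simp add: eig)
  have Fexp: "F (t, y) = exp (a * of_real t) * G y" for t y
    unfolding G_def by (rule exp_solution[of "\<lambda>t. F (t, y)", OF dF])
  obtain y0 where y0: "G y0 \<noteq> 0" using assms(3) Fexp by (cases p0) auto
  \<comment> \<open>The period 4 pi quantises the eigenvalue: a = in/2 with an integer n. The sign
    in exp(-im\<theta>/2) makes m = -n.\<close>
  have "exp (a * of_real (4 * pi)) = 1"
    using Omega_kernel_periodic[OF FO, of 0 y0] Fexp[of "4 * pi" y0] y0 by (simp add: G_def)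
  then obtain n :: int where n: "Re (a * of_real (4 * pi)) = 0" "Im (a * of_real (4 * pi)) = of_int (2 * n) * pi"
    unfolding exp_eq_1 by blast
  define m where "m = - n"
  have a: "a = - \<i> * of_int m / 2"
    using n by (simp add: m_def complex_eq_iff)
  have Fm: "F = (\<lambda>(\<theta>, y). exp (- \<i> * of_int m * of_real \<theta> / 2) * G y)"
    by (simp add: fun_eq_iff Fexp a)
  have smG: "smooth G" unfolding G_def[abs_def] using smF by (rule smooth_slice)
  have "slice_pde s lam m G"
    unfolding slice_pde_def
  proof
    fix y
    have "(\<lambda>z. F (0, z)) = G" by (simp add: G_def fun_eq_iff)
    then show "norm_sq y * (laplacian G y + (4 * s\<^sup>2 * norm_sq y - 2 * \<i> * of_int m * s) * G y) = 2 * lam * G y"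
      using Omega_kernelD(3)[OF FO, of "(0, y)"] unfolding Omega_apply eig a
      by (simp add: G_def[symmetric] algebra_simps)
  qed
  moreover have "G (- y) = \<i> powi (m - q) * G y" for y
  proof -
    \<comment> \<open>Equivariance for j = 1 at \<theta> = 0; \<open>of_int 1\<close> fits the shape
      of \<open>exp_quarter_turns\<close>.\<close>
    have "exp (- \<i> * of_int m * of_real (of_int 1 * pi) / 2) * G (- y) = \<i> powi (- q) * G y"
      using Omega_kernelD(2)[OF FO, of 0 1 y] by (simp add: Fm)
    then have "\<i> powi (- m) * G (- y) = \<i> powi (- q) * G y" unfolding exp_quarter_turns by simp
    then have "\<i> powi m * (\<i> powi (- m) * G (- y)) = \<i> powi m * (\<i> powi (- q) * G y)" by simp
    then show ?thesis
      by (simp only: mult.assoc[symmetric] power_int_add[symmetric] i_squared) (simp add: power_int_add[symmetric])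
  qed
  moreover obtain B where B: "finite B" "K_orbit F \<subseteq> cfun.span B"
    using F by (auto simp: K_finite_kernel_iff)
  define T :: "(real \<times> (real^'n) \<Rightarrow> complex) \<Rightarrow> real^'n \<Rightarrow> complex" where "T f = (\<lambda>y. f (0, y))" for f
  \<comment> \<open>Rotating \<open>G\<close> is restricting a \<open>K\<close>-translate of
    \<open>F\<close> to \<theta> = 0. Since \<open>K_act\<close> inverts its rotation,
    \<open>inv u\<close> is used to obtain \<open>u\<close>.\<close>
  have "rot_orbit G \<subseteq> cfun.span (T ` B)"
  proof
    fix g assume "g \<in> rot_orbit G"
    then obtain u where u: "g = (\<lambda>y. G (u y))" "orthogonal_transformation u" by (auto simp: rot_orbit_def)
    have iu: "orthogonal_transformation (inv u)" using u(2) by (rule orthogonal_transformation_inv)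
    have "inv (inv u) = u" using u(2) orthogonal_transformation_bij inv_inv_eq by blast
    then have g: "g = T (K_act 0 (inv u) F)" by (simp add: T_def u(1) G_def K_act_apply)
    have "K_act 0 (inv u) F \<in> cfun.span B" using B(2) K_act_in_orbit[OF iu] by blast
    then show "g \<in> cfun.span (T ` B)"
      unfolding g
      by (rule cfun_span_image[of T, rotated 2])
        (auto simp: T_def fun_eq_iff cscale_apply intro: cfun.span_base)
  qed
  then have "\<exists>B. finite B \<and> rot_orbit G \<subseteq> cfun.span B" using B(1) by blast
  ultimately have "G \<in> slice_space s lam m (\<i> powi (m - q))"
    using smG by (simp add: slice_space_def)
  with Fm show ?thesis by blast
qed

lemma K_finite_kernel_span:
  fixes F :: "real \<times> (real^'n) \<Rightarrow> complex"
  assumes F: "F \<in> K_finite_kernel q s lam"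
  shows "F \<in> cfun.span {F_fun s m (int l) (int k) h | m l k h.
    admissible_pair CARD('n) lam (int l) (int k) \<and> h \<in> harmonic_poly (int k) \<and> m mod 4 = (2 * int k + q) mod 4}"
    (is "_ \<in> cfun.span ?E")
proof -
  interpret semisimple_operator "K_finite_kernel q s lam :: (real \<times> (real^'n) \<Rightarrow> complex) set" "dderiv (1, 0)"
    by (rule K_finite_kernel_semisimple)
  obtain B where B: "finite B" "K_orbit F \<subseteq> cfun.span B" using F by (auto simp: K_finite_kernel_iff)
  have BB: "cfun.span (K_orbit F) \<subseteq> cfun.span B"
    using B(2) by (rule cfun.span_minimal[OF _ cfun.subspace_span])
  have "(dderiv (1, 0) ^^ i) F \<in> cfun.span (K_orbit F)" for i
  proof (induction i)
    case 0
    show ?case using cfun.span_base[OF self_in_K_orbit] by simp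
  next
    case (Suc i)
    let ?H = "(dderiv (1, 0) ^^ i) F"
    have sub: "cfun.span (K_orbit ?H) \<subseteq> cfun.span (K_orbit F)"
      using Suc by (rule span_K_orbit_subset)
    have "?H \<in> K_finite_kernel q s lam" using F Suc by (rule span_K_orbit_K_finite_kernel)
    then have "smooth ?H" by (auto simp: K_finite_kernel_iff Omega_kernelD)
    moreover have "K_orbit ?H \<subseteq> cfun.span B"
      using order_trans[OF cfun.span_superset order_trans[OF sub BB]] .
    ultimately have "dderiv (1, 0) ?H \<in> cfun.span (K_orbit ?H)"
      using B(1) by (intro angle_derivative_in_span_K_orbit)
    with sub show ?case by auto
  qed
  then have "F \<in> cfun.span eigenvectors"
    using F B(1) BB by (intro in_span_eigenvectors) auto
  moreover have "eigenvectors \<subseteq> cfun.span ?E"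
  proof
    fix v assume "v \<in> eigenvectors"
    then obtain a where v: "v \<in> K_finite_kernel q s lam" "dderiv (1, 0) v = cscale a v"
      by (auto simp: eigenvectors_def)
    show "v \<in> cfun.span ?E"
    proof (cases "v = 0")
      case True
      show ?thesis unfolding True by (rule cfun.span_zero)
    next
      case False
      then obtain p0 where p0: "v p0 \<noteq> 0" by (auto simp: fun_eq_iff)
      have "dderiv (1, 0) v p = a * v p" for p using v(2) by (simp add: cscale_apply)
      from angle_eigenfunction[OF v(1) this p0] obtain m G where
        vG: "v = (\<lambda>(\<theta>, y). exp (- \<i> * of_int m * of_real \<theta> / 2) * G y)"
        and G: "G \<in> slice_space s lam m (\<i> powi (m - q))" by blast
      define T where "T g = (\<lambda>(\<theta>, y). exp (- \<i> * of_int m * of_real \<theta> / 2) * g y)" for g :: "real^'n \<Rightarrow> complex"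
      have T_add: "T (f + g) = T f + T g" and T_scale: "T (cscale c f) = cscale c (T f)" for f g :: "real^'n \<Rightarrow> complex" and c
        by (auto simp: T_def fun_eq_iff cscale_apply algebra_simps)
      have "T G \<in> cfun.span ?E"
      proof (rule cfun_span_image[of T, OF T_add T_scale slice_space_span[OF G]])
        fix f :: "real^'n \<Rightarrow> complex"
        assume "f \<in> {\<lambda>y. norm_sq y ^ l * p y * radial_factor CARD('n) s m (2 * l + k) (norm_sq y) | l k p.
          p \<in> harmonic_poly (int k) \<and> (\<exists>y. p y \<noteq> 0) \<and> \<i> powi (m - q) = (-1) ^ k \<and>
          lam = of_nat l * (2 * of_nat l + 2 * of_nat k + of_nat CARD('n) - 2)}"
        then obtain l k p y where f: "f = (\<lambda>y. norm_sq y ^ l * p y * radial_factor CARD('n) s m (2 * l + k) (norm_sq y))"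
          and p: "p \<in> harmonic_poly (int k)" "p y \<noteq> 0" "\<i> powi (m - q) = (-1) ^ k"
          "lam = of_nat l * (2 * of_nat l + 2 * of_nat k + of_nat CARD('n) - 2)" by blast
        \<comment> \<open>Writing both signs as powers of i turns the parity condition into the
          congruence for m.\<close>
        have "\<i> powi (2 * int k) = (-1) ^ k"
          by (simp only: power_int_mult power_int_of_nat) simp
        then have "\<i> powi (m - q - 2 * int k) = 1"
          using p(3) by (simp add: power_int_diff)
        then have "m mod 4 = (2 * int k + q) mod 4"
          unfolding i_powi_eq_1_iff by presburger
        moreover have "T f = F_fun s m (int l) (int k) p"
          unfolding F_fun_eq T_def f ..
        moreover have "admissible_pair CARD('n) lam (int l) (int k)"
          by (rule admissible_pairI[OF p(1,2,4)])
        ultimately have "T f \<in> ?E" using p(1) by blast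
        then show "T f \<in> cfun.span ?E" by (rule cfun.span_base)
      qed
      then show ?thesis unfolding vG T_def .
    qed
  qed
  ultimately show ?thesis
    using cfun.span_minimal[OF _ cfun.subspace_span] by blast
qed

section \<open>The functions \<open>F_fun\<close> lie in the kernel\<close>

lemma mult_in_span_products:
  fixes f g :: "'a \<Rightarrow> complex"
  assumes f: "f \<in> cfun.span A" and g: "g \<in> cfun.span B"
  shows "(\<lambda>y. f y * g y) \<in> cfun.span ((\<lambda>(a, b) y. a y * b y) ` (A \<times> B))"
proof (rule cfun_span_image[where T = "\<lambda>f y. f y * g y", OF _ _ f])
  fix a assume a: "a \<in> A"
  show "(\<lambda>y. a y * g y) \<in> cfun.span ((\<lambda>(a, b) y. a y * b y) ` (A \<times> B))"
  proof (rule cfun_span_image[where T = "\<lambda>g y. a y * g y", OF _ _ g])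
    fix b assume "b \<in> B"
    with a have "(\<lambda>y. a y * b y) \<in> (\<lambda>(a, b) y. a y * b y) ` (A \<times> B)" by force
    then show "(\<lambda>y. a y * b y) \<in> cfun.span ((\<lambda>(a, b) y. a y * b y) ` (A \<times> B))"
      by (rule cfun.span_base)
  qed (auto simp: fun_eq_iff cscale_apply algebra_simps)
qed (auto simp: fun_eq_iff cscale_apply algebra_simps)

text \<open>The same \<open>B\<close> serves all \<open>u\<close>. It is built along the
  construction of the polynomial: coordinates for linear forms, unions for sums, pairwise products
  for products.\<close>

lemma real_polynomial_function_linear_orbit:
  fixes p :: "'a::euclidean_space \<Rightarrow> real"
  assumes "real_polynomial_function p"
  shows "\<exists>B. finite B \<and> (\<forall>u :: 'a \<Rightarrow> 'a. linear u \<longrightarrow> (\<lambda>y. of_real (p (u y)) :: complex) \<in> cfun.span B)"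
  using assms
proof induction
  case (linear f)
  have "(\<lambda>y. of_real (f (u y)) :: complex) \<in> cfun.span (coord ` Basis)" if u: "linear u" for u :: "'a \<Rightarrow> 'a"
  proof -
    have lin: "linear (\<lambda>y. f (u y))"
      using linear_compose[OF u bounded_linear.linear[OF linear]] by (simp add: o_def)
    have E: "f (u y) = (\<Sum>b\<in>Basis. (y \<bullet> b) * f (u b))" for y
    proof -
      have "f (u y) = f (u (\<Sum>b\<in>Basis. (y \<bullet> b) *\<^sub>R b))" by (simp only: euclidean_representation)
      also have "\<dots> = (\<Sum>b\<in>Basis. f (u ((y \<bullet> b) *\<^sub>R b)))" by (rule linear_sum[OF lin])
      also have "\<dots> = (\<Sum>b\<in>Basis. (y \<bullet> b) * f (u b))" by (simp only: linear_cmul[OF lin] real_scaleR_def)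
      finally show ?thesis .
    qed
    have eq: "(\<lambda>y. of_real (f (u y)) :: complex) = (\<Sum>b\<in>Basis. cscale (of_real (f (u b))) (coord b))"
    proof
      fix y
      show "of_real (f (u y)) = (\<Sum>b\<in>Basis. cscale (of_real (f (u b))) (coord b)) y"
        unfolding E[of y] sum_fun_apply cscale_apply coord_def by (simp add: mult.commute)
    qed
    show ?thesis
      unfolding eq by (intro cfun.span_sum cfun.span_scale cfun.span_base) auto
  qed
  then show ?case by (intro exI[of _ "coord ` Basis"]) auto
next
  case (const c)
  have eq: "(\<lambda>y. of_real c :: complex) = cscale (of_real c) (\<lambda>y::'a. 1)"
    by (simp add: fun_eq_iff cscale_apply)
  have "(\<lambda>y::'a. of_real c :: complex) \<in> cfun.span {\<lambda>y. 1}"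
    unfolding eq by (intro cfun.span_scale cfun.span_base) auto
  then show ?case by (intro exI[of _ "{\<lambda>y. 1}"]) auto
next
  case (add f g)
  then obtain A B where A: "finite A" "\<And>u :: 'a \<Rightarrow> 'a. linear u \<Longrightarrow> (\<lambda>y. of_real (f (u y)) :: complex) \<in> cfun.span A"
    and B: "finite B" "\<And>u :: 'a \<Rightarrow> 'a. linear u \<Longrightarrow> (\<lambda>y. of_real (g (u y)) :: complex) \<in> cfun.span B" by blast
  have "(\<lambda>y. of_real (f (u y) + g (u y)) :: complex) \<in> cfun.span (A \<union> B)" if u: "linear u" for u :: "'a \<Rightarrow> 'a"
  proof -
    have eq: "(\<lambda>y. of_real (f (u y) + g (u y)) :: complex) = (\<lambda>y. of_real (f (u y))) + (\<lambda>y. of_real (g (u y)))"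
      by (simp add: fun_eq_iff)
    show ?thesis
      unfolding eq
      using A(2)[OF u] B(2)[OF u] cfun.span_mono[of A "A \<union> B"] cfun.span_mono[of B "A \<union> B"]
      by (intro cfun.span_add) auto
  qed
  then show ?case using A(1) B(1) by (intro exI[of _ "A \<union> B"]) auto
next
  case (mult f g)
  then obtain A B where A: "finite A" "\<And>u :: 'a \<Rightarrow> 'a. linear u \<Longrightarrow> (\<lambda>y. of_real (f (u y)) :: complex) \<in> cfun.span A"
    and B: "finite B" "\<And>u :: 'a \<Rightarrow> 'a. linear u \<Longrightarrow> (\<lambda>y. of_real (g (u y)) :: complex) \<in> cfun.span B" by blast
  let ?C = "(\<lambda>(a, b) y. a y * b y) ` (A \<times> B)"
  have "(\<lambda>y. of_real (f (u y) * g (u y)) :: complex) \<in> cfun.span ?C" if u: "linear u" for u :: "'a \<Rightarrow> 'a"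
    using mult_in_span_products[OF A(2)[OF u] B(2)[OF u]] by simp
  then show ?case using A(1) B(1) by (intro exI[of _ ?C]) auto
qed

lemma polynomial_function_linear_orbit:
  fixes h :: "'a::euclidean_space \<Rightarrow> complex"
  assumes "polynomial_function h"
  shows "\<exists>B. finite B \<and> (\<forall>u :: 'a \<Rightarrow> 'a. linear u \<longrightarrow> (\<lambda>y. h (u y)) \<in> cfun.span B)"
proof -
  obtain A B where A: "finite A" "\<And>u :: 'a \<Rightarrow> 'a. linear u \<Longrightarrow> (\<lambda>y. of_real (Re (h (u y))) :: complex) \<in> cfun.span A"
    and B: "finite B" "\<And>u :: 'a \<Rightarrow> 'a. linear u \<Longrightarrow> (\<lambda>y. of_real (Im (h (u y))) :: complex) \<in> cfun.span B"
    using polynomial_function_Re_Im[OF assms, THEN real_polynomial_function_linear_orbit] by blast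
  have "(\<lambda>y. h (u y)) \<in> cfun.span (A \<union> B)" if u: "linear u" for u :: "'a \<Rightarrow> 'a"
  proof -
    have eq: "(\<lambda>y. h (u y)) = (\<lambda>y. of_real (Re (h (u y)))) + cscale \<i> (\<lambda>y. of_real (Im (h (u y))))"
      by (simp add: fun_eq_iff cscale_apply complex_eq)
    show ?thesis
      unfolding eq
      using A(2)[OF u] B(2)[OF u] cfun.span_mono[of A "A \<union> B"] cfun.span_mono[of B "A \<union> B"]
      by (intro cfun.span_add cfun.span_scale) auto
  qed
  then show ?thesis using A(1) B(1) by (intro exI[of _ "A \<union> B"]) auto
qed

text \<open>The converse of \<open>eigenpolynomial_decomposition\<close>: a harmonic
  \<open>h\<close> times the radial function x^l.\<close>

lemma norm_sq_power_harmonic: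
  fixes h :: "real^'n \<Rightarrow> complex"
  assumes h: "h \<in> harmonic_poly (int k)"
  shows "homogeneous (int (2 * l + k)) (\<lambda>y. norm_sq y ^ l * h y)"
    and "smooth (\<lambda>y. norm_sq y ^ l * h y)"
    and "norm_sq y * laplacian (\<lambda>y. norm_sq y ^ l * h y) y
      = 2 * of_nat l * (2 * of_nat l + 2 * of_nat k + of_nat CARD('n) - 2) * (norm_sq y ^ l * h y)"
proof -
  note h' = harmonic_polyD[OF h]
  show "homogeneous (int (2 * l + k)) (\<lambda>y. norm_sq y ^ l * h y)"
    unfolding homogeneous_def
    by (auto simp: norm_sq_scaleR homogeneousD[OF h'(4)] power_mult_distrib power_add
        power_mult[symmetric] mult.commute[of l] simp del: of_nat_add)
  show "smooth (\<lambda>y. norm_sq y ^ l * h y)"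
    using h'(2) by (intro smooth_mult smooth_power smooth_norm_sq)
  have hol: "(\<lambda>x. x ^ l) holomorphic_on UNIV" by (intro holomorphic_intros)
  have d1: "deriv (\<lambda>x. x ^ l) = (\<lambda>x::complex. of_nat l * x ^ (l - 1))"
    by (intro ext DERIV_imp_deriv) (auto intro!: derivative_eq_intros)
  have d2: "deriv (\<lambda>x::complex. of_nat l * x ^ (l - 1)) x = of_nat l * (of_nat (l - 1) * x ^ (l - 1 - 1))" for x
    by (intro DERIV_imp_deriv) (auto intro!: derivative_eq_intros)
  let ?x = "norm_sq y"
  have eq: "(\<lambda>y. norm_sq y ^ l * h y) = (\<lambda>y. h y * norm_sq y ^ l)" by (simp add: mult.commute)
  have L: "laplacian (\<lambda>y. norm_sq y ^ l * h y) y
    = h y * (4 * ?x * (of_nat l * (of_nat (l - 1) * ?x ^ (l - 1 - 1)))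
      + (4 * of_nat k + 2 * of_nat CARD('n)) * (of_nat l * ?x ^ (l - 1)))"
    unfolding eq using laplacian_homogeneous_radial[OF hol h'(4,2), of y] unfolding d1 d2 h'(3)
    by (simp only: mult_zero_left add_0_left DIM_cart DIM_real mult_1_right)
  \<comment> \<open>The exponents l - 1 and l - 2 are truncated in the first two cases, where the
    coefficients l and l(l - 1) vanish accordingly.\<close>
  consider "l = 0" | "l = 1" | n where "l = Suc (Suc n)"
    by (metis One_nat_def old.nat.exhaust)
  then show "?x * laplacian (\<lambda>y. norm_sq y ^ l * h y) y
      = 2 * of_nat l * (2 * of_nat l + 2 * of_nat k + of_nat CARD('n) - 2) * (?x ^ l * h y)"
    unfolding L by cases (simp_all add: algebra_simps)
qed

lemma F_fun_in_Omega_kernel: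
  fixes h :: "real^'n \<Rightarrow> complex"
  assumes pair: "admissible_pair CARD('n) lam (int l) (int k)" and h: "h \<in> harmonic_poly (int k)"
    and m: "m mod 4 = (2 * int k + q) mod 4"
  shows "F_fun s m (int l) (int k) h \<in> Omega_kernel q s lam"
proof (rule Omega_kernelI)
  let ?d = "2 * l + k"
  define P where "P y = norm_sq y ^ l * h y" for y
  define S where "S y = P y * radial_factor CARD('n) s m ?d (norm_sq y)" for y
  have P: "homogeneous (int ?d) P" "smooth P" "norm_sq y * laplacian P y = 2 * lam * P y" for y
    using norm_sq_power_harmonic[OF h, where l = l] admissible_pair_eigenvalue[OF pair]
    unfolding P_def[abs_def] by simp_all
  have S_eq: "(\<lambda>y. P y * radial_factor DIM(real^'n) s m ?d (norm_sq y)) = S"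
    by (simp add: S_def fun_eq_iff)
  have smS: "smooth S" using smooth_homogeneous_radial[OF P(2), of s m ?d] unfolding S_eq .
  define e where "e p = exp (- \<i> * of_int m * of_real (fst p) / 2)" for p :: "real \<times> (real^'n)"
  let ?F = "F_fun s m (int l) (int k) h"
  have F: "?F = (\<lambda>p. e p * S (snd p))"
    by (simp add: F_fun_eq fun_eq_iff e_def S_def P_def)
  have "bounded_linear (\<lambda>p::real \<times> (real^'n). - \<i> * of_int m * of_real (fst p) / 2)"
    by (intro bounded_linear_divide bounded_linear_compose[OF bounded_linear_divide]
        bounded_linear_compose[OF bounded_linear_mult_right] bounded_linear_compose[OF bounded_linear_of_real]
        bounded_linear_fst)
  note bl = this
  have hol: "exp holomorphic_on (UNIV :: complex set)" by (intro holomorphic_intros)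
  have smE: "smooth e"
    unfolding e_def[abs_def] by (rule smooth_holomorphic[OF hol smooth_bounded_linear[OF bl]])
  have smS2: "smooth (\<lambda>p::real \<times> (real^'n). S (snd p))"
    by (rule smooth_linear[OF bounded_linear_snd smS])
  show "smooth ?F" unfolding F by (rule smooth_mult[OF smE smS2])
  have S_par: "S (((-1) powi j) *\<^sub>R y) = \<i> powi (2 * j * int k) * S y" for j y
  proof -
    define \<sigma> where "\<sigma> = (-1::real) powi j"
    have c: "\<sigma> = 1 \<or> \<sigma> = -1"
      by (cases "even j") (auto simp: \<sigma>_def power_int_minus_left)
    then have n: "norm_sq (\<sigma> *\<^sub>R y) = norm_sq y"
      by (auto simp: norm_sq_scaleR)
    have "P (\<sigma> *\<^sub>R y) = of_real \<sigma> powi int ?d * P y"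
      using c by (intro homogeneousD[OF P(1)]) auto
    \<comment> \<open>Write -1 as i^2; the part 2l of the degree contributes only i^(4jl) =
      1.\<close>
    also have "(of_real \<sigma> :: complex) powi int ?d = \<i> powi (2 * j * int k)"
    proof -
      have "(of_real \<sigma> :: complex) powi int ?d = (-1) powi (j * int ?d)"
        unfolding \<sigma>_def by (simp only: power_int_mult) simp
      also have "\<dots> = (\<i> powi 2) powi (j * int ?d)" by simp
      also have "\<dots> = \<i> powi (2 * j * int k + 4 * (j * int l))"
        by (simp only: power_int_mult[symmetric]) (simp add: algebra_simps)
      also have "\<dots> = \<i> powi (2 * j * int k) * \<i> powi (4 * (j * int l))"
        by (rule power_int_add) simp
      also have "\<i> powi (4 * (j * int l)) = 1" by (simp add: i_powi_eq_1_iff)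
      finally show ?thesis by simp
    qed
    finally show ?thesis unfolding \<sigma>_def[symmetric] S_def n by (simp only: mult.assoc)
  qed
  show "?F (\<theta> + of_int j * pi, ((-1) powi j) *\<^sub>R y) = \<i> powi (- j * q) * ?F (\<theta>, y)" for j \<theta> y
  proof -
    have "e (\<theta> + of_int j * pi, ((-1) powi j) *\<^sub>R y)
      = e (\<theta>, y) * exp (- \<i> * of_int m * of_real (of_int j * pi) / 2)"
      unfolding e_def exp_add[symmetric] by (simp add: algebra_simps add_divide_distrib diff_divide_distrib)
    also have "\<dots> = e (\<theta>, y) * \<i> powi (- m * j)" unfolding exp_quarter_turns ..
    finally have E: "e (\<theta> + of_int j * pi, ((-1) powi j) *\<^sub>R y) = e (\<theta>, y) * \<i> powi (- m * j)" .
    \<comment> \<open>The congruence makes -mj + 2jk and -jq differ by a multiple of 4, so both give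
      the same power of i.\<close>
    have "4 dvd (2 * int k + q) - m" using m by presburger
    then have "4 dvd j * ((2 * int k + q) - m)" by (rule dvd_mult)
    then have "\<i> powi (j * ((2 * int k + q) - m)) = 1" by (simp add: i_powi_eq_1_iff)
    moreover have "- m * j + 2 * j * int k = - j * q + j * ((2 * int k + q) - m)" by (simp add: algebra_simps)
    ultimately have "\<i> powi (- m * j) * \<i> powi (2 * j * int k) = \<i> powi (- j * q)"
      by (simp only: power_int_add[symmetric] complex_i_not_zero not_False_eq_True simp_thms)
        (simp only: power_int_add complex_i_not_zero not_False_eq_True simp_thms mult_1_right)
    then show ?thesis
      unfolding F E snd_conv S_par by (simp only: mult_ac)
  qed
  show "Omega s ?F p = 2 * lam * ?F p" for p
  proof (cases p)
    case (Pair \<theta> y)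
    have dS: "dderiv (1, 0) (\<lambda>p::real \<times> (real^'n). S (snd p)) p = 0" for p
      using fun_cong[OF dderiv_linear[OF bounded_linear_snd smS], of "(1, 0)" p]
        dderiv_scaleR[OF smooth_differentiable[OF smS], of 0 0 "snd p"] by simp
    have dE: "dderiv (1, 0) e p = (- \<i> * of_int m / 2) * e p" for p
    proof -
      let ?l = "\<lambda>p::real \<times> (real^'n). - \<i> * of_int m * of_real (fst p) / 2"
      have "dderiv (1, 0) e p = deriv exp (?l p) * dderiv (1, 0) ?l p"
        unfolding e_def[abs_def]
        by (rule dderiv_holomorphic[OF hol smooth_differentiable[OF smooth_bounded_linear[OF bl]]])
      also have "deriv exp (?l p) = e p" unfolding e_def by (rule DERIV_imp_deriv[OF DERIV_exp])
      also have "dderiv (1, 0) ?l p = - \<i> * of_int m / 2"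
        unfolding dderiv_bounded_linear[OF bl] by simp
      finally show ?thesis by (simp only: mult.commute)
    qed
    have d: "dderiv (1, 0) ?F (\<theta>, y) = (- \<i> * of_int m / 2) * e (\<theta>, y) * S y"
      unfolding F smooth_dderiv_mult[OF smE smS2] dS dE by simp
    have l: "laplacian (\<lambda>z. ?F (\<theta>, z)) y = e (\<theta>, y) * laplacian S y"
    proof -
      have "(\<lambda>z. ?F (\<theta>, z)) = (\<lambda>z. e (\<theta>, y) * S z)" unfolding F by (simp add: e_def)
      then show ?thesis using laplacian_cmult[OF smS] by simp
    qed
    have "laplacian S y + (4 * s\<^sup>2 * norm_sq y - 2 * \<i> * of_int m * s) * S y
      = laplacian P y * radial_factor CARD('n) s m ?d (norm_sq y)"
      using slice_operator_homogeneous_radial[OF P(1,2), of s m y, unfolded S_eq] by (simp add: S_def)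
    then have "norm_sq y * (laplacian S y + (4 * s\<^sup>2 * norm_sq y - 2 * \<i> * of_int m * s) * S y)
      = (norm_sq y * laplacian P y) * radial_factor CARD('n) s m ?d (norm_sq y)" by (simp only: mult.assoc)
    also have "\<dots> = 2 * lam * S y" unfolding P(3) S_def by (simp only: mult.assoc)
    finally have key: "e (\<theta>, y) * (norm_sq y * (laplacian S y + (4 * s\<^sup>2 * norm_sq y - 2 * \<i> * of_int m * s) * S y))
      = e (\<theta>, y) * (2 * lam * S y)" by (simp only:)
    have "Omega s ?F (\<theta>, y) = norm_sq y * (4 * s * ((- \<i> * of_int m / 2) * e (\<theta>, y) * S y)
      + 4 * s\<^sup>2 * norm_sq y * (e (\<theta>, y) * S y) + e (\<theta>, y) * laplacian S y)"
      unfolding Omega_apply d l unfolding F snd_conv ..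
    also have "\<dots> = e (\<theta>, y) * (norm_sq y * (laplacian S y + (4 * s\<^sup>2 * norm_sq y - 2 * \<i> * of_int m * s) * S y))"
      by (simp add: algebra_simps)
    also have "\<dots> = 2 * lam * ?F (\<theta>, y)" unfolding key F snd_conv by (simp only: mult_ac)
    finally show ?thesis unfolding Pair .
  qed
qed

text \<open>A translation in \<theta> only multiplies the function by a scalar, and a rotation only
  changes \<open>h\<close>. As \<open>F_fun\<close> is linear in \<open>h\<close>, finiteness is
  inherited from the polynomial.\<close>

lemma F_fun_in_K_finite_kernel:
  fixes h :: "real^'n \<Rightarrow> complex"
  assumes pair: "admissible_pair CARD('n) lam (int l) (int k)" and h: "h \<in> harmonic_poly (int k)"
    and m: "m mod 4 = (2 * int k + q) mod 4"
  shows "F_fun s m (int l) (int k) h \<in> K_finite_kernel q s lam"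
proof -
  define T :: "(real^'n \<Rightarrow> complex) \<Rightarrow> real \<times> (real^'n) \<Rightarrow> complex" where "T = F_fun s m (int l) (int k)"
  have T_add: "T (f + g) = T f + T g" and T_scale: "T (cscale c f) = cscale c (T f)" for f g c
    by (auto simp: T_def F_fun_eq fun_eq_iff cscale_apply algebra_simps)
  obtain B where B: "finite B" "\<And>u :: real^'n \<Rightarrow> real^'n. linear u \<Longrightarrow> (\<lambda>y. h (u y)) \<in> cfun.span B"
    using polynomial_function_linear_orbit[OF harmonic_polyD(1)[OF h]] by blast
  have "K_orbit (T h) \<subseteq> cfun.span (T ` B)"
  proof
    fix f assume "f \<in> K_orbit (T h)"
    then obtain \<alpha> u where u: "f = K_act \<alpha> u (T h)" "orthogonal_transformation u" by (auto simp: K_orbit_def)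
    define w where "w = inv u"
    have w: "orthogonal_transformation w" unfolding w_def using u(2) by (rule orthogonal_transformation_inv)
    then have n: "norm_sq (w y) = norm_sq y" for y by (simp add: norm_sq_def orthogonal_transformation_norm)
    have ex: "exp (- \<i> * of_int m * of_real (\<theta> - \<alpha>) / 2)
      = exp (\<i> * of_int m * of_real \<alpha> / 2) * exp (- \<i> * of_int m * of_real \<theta> / 2)" for \<theta>
      unfolding exp_add[symmetric] by (simp add: algebra_simps diff_divide_distrib)
    have "f = cscale (exp (\<i> * of_int m * of_real \<alpha> / 2)) (T (\<lambda>y. h (w y)))"
    proof (rule ext, clarify)
      fix \<theta> y
      show "f (\<theta>, y) = cscale (exp (\<i> * of_int m * of_real \<alpha> / 2)) (T (\<lambda>y. h (w y))) (\<theta>, y)"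
        unfolding u(1) K_act_apply cscale_apply T_def F_fun_eq prod.case w_def[symmetric] n ex
        by (simp only: mult_ac)
    qed
    moreover have "T (\<lambda>y. h (w y)) \<in> cfun.span (T ` B)"
      by (rule cfun_span_image[of T, OF T_add T_scale B(2)[OF orthogonal_transformation_linear[OF w]]])
        (auto intro: cfun.span_base)
    ultimately show "f \<in> cfun.span (T ` B)" by (simp only: cfun.span_scale)
  qed
  then have "\<exists>B. finite B \<and> K_orbit (T h) \<subseteq> cfun.span B" using B(1) by blast
  then show ?thesis
    unfolding K_finite_kernel_iff T_def using F_fun_in_Omega_kernel[OF assms] by blast
qed

lemma F_fun_zero: "F_fun s m l k (0 :: real^'n \<Rightarrow> complex) = 0"
  by (simp add: F_fun_def fun_eq_iff)

text \<open>Integer indices with k < 0, which occur for n = 2, contribute only the zero function,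
  since \<open>h\<close> vanishes.\<close>

lemma F_fun_in_K_finite_kernel_int:
  fixes h :: "real^'n \<Rightarrow> complex"
  assumes "admissible_pair CARD('n) lam l k" "h \<in> harmonic_poly k" "m mod 4 = (2 * k + q) mod 4"
  shows "F_fun s m l k h \<in> K_finite_kernel q s lam"
proof (cases "k \<ge> 0")
  case True
  have "l \<ge> 0" using assms(1) by (auto simp: admissible_pair_def split: if_splits)
  then show ?thesis
    using F_fun_in_K_finite_kernel[of lam "nat l" "nat k" h m q s] assms True by simp
next
  case False
  note h = harmonic_polyD[OF assms(2)]
  have "h y = 0" for y
    using homogeneous_negative[OF h(4) smooth_continuous_on[OF h(2)]] False by simp
  then have h0: "h = 0" by (simp add: fun_eq_iff)
  show ?thesis
    unfolding h0 F_fun_zero by (rule cfun.subspace_0[OF subspace_K_finite_kernel])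
qed

section \<open>Nonzero harmonic polynomials of prescribed degree\<close>

lemma polynomial_function_complex_mult:
  fixes f g :: "'a::euclidean_space \<Rightarrow> complex"
  assumes "polynomial_function f" "polynomial_function g"
  shows "polynomial_function (\<lambda>x. f x * g x)"
proof -
  note f = polynomial_function_Re_Im[OF assms(1)] and g = polynomial_function_Re_Im[OF assms(2)]
  note mult = real_polynomial_function.intros(4)
  have "real_polynomial_function (\<lambda>x. Re (f x) * Re (g x) - Im (f x) * Im (g x))"
    by (rule real_polynomial_function_diff[OF mult[OF f(1) g(1)] mult[OF f(2) g(2)]])
  moreover have "real_polynomial_function (\<lambda>x. Re (f x) * Im (g x) + Im (f x) * Re (g x))"
    by (rule real_polynomial_function.intros(3)[OF mult[OF f(1) g(2)] mult[OF f(2) g(1)]])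
  ultimately have "polynomial_function (\<lambda>x. Complex (Re (f x) * Re (g x) - Im (f x) * Im (g x))
    (Re (f x) * Im (g x) + Im (f x) * Re (g x)))"
    by (rule polynomial_function_Complex)
  moreover have "(\<lambda>x. Complex (Re (f x) * Re (g x) - Im (f x) * Im (g x))
    (Re (f x) * Im (g x) + Im (f x) * Re (g x))) = (\<lambda>x. f x * g x)"
    by (simp add: fun_eq_iff complex_eq_iff)
  ultimately show ?thesis by simp
qed

text \<open>The Laplacian of \<zeta>^k is k(k - 1) \<zeta>^(k - 2) times the sum of the squared
  coefficients of \<zeta>. One of the two factors vanishes by assumption.\<close>

lemma linear_power_in_harmonic_poly:
  fixes \<zeta> :: "real^'n \<Rightarrow> complex"
  assumes \<zeta>: "bounded_linear \<zeta>" and null: "k \<le> 1 \<or> (\<Sum>b\<in>Basis. \<zeta> b * \<zeta> b) = 0"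
  shows "(\<lambda>y. \<zeta> y ^ k) \<in> harmonic_poly (int k)"
proof (rule harmonic_polyI)
  have p: "polynomial_function \<zeta>" using \<zeta> by (rule polynomial_function_bounded_linear)
  show "polynomial_function (\<lambda>y. \<zeta> y ^ k)"
    by (induction k) (auto intro: polynomial_function_complex_mult p)
  show "homogeneous (int k) (\<lambda>y. \<zeta> y ^ k)"
    using linear_cmul[OF bounded_linear.linear[OF \<zeta>]]
    by (simp add: homogeneous_def scaleR_conv_of_real power_mult_distrib)
  have hol: "(\<lambda>x. x ^ k) holomorphic_on UNIV" by (intro holomorphic_intros)
  have d1: "deriv (\<lambda>x. x ^ k) = (\<lambda>x::complex. of_nat k * x ^ (k - 1))"
    by (intro ext DERIV_imp_deriv) (auto intro!: derivative_eq_intros)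
  have d2: "deriv (\<lambda>x::complex. of_nat k * x ^ (k - 1)) x = of_nat k * (of_nat (k - 1) * x ^ (k - 1 - 1))" for x
    by (intro DERIV_imp_deriv) (auto intro!: derivative_eq_intros)
  have hol': "(\<lambda>x::complex. of_nat k * x ^ (k - 1)) holomorphic_on UNIV" by (intro holomorphic_intros)
  have sm: "smooth \<zeta>" using \<zeta> by (rule smooth_bounded_linear)
  fix y
  have 1: "dderiv b (\<lambda>y. \<zeta> y ^ k) = (\<lambda>y. \<zeta> b * (of_nat k * \<zeta> y ^ (k - 1)))" for b
  proof
    fix y
    show "dderiv b (\<lambda>y. \<zeta> y ^ k) y = \<zeta> b * (of_nat k * \<zeta> y ^ (k - 1))"
      using dderiv_holomorphic[OF hol smooth_differentiable[OF sm], of b y] unfolding d1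
      by (simp add: dderiv_bounded_linear[OF \<zeta>] mult.commute)
  qed
  have 2: "dderiv b (dderiv b (\<lambda>y. \<zeta> y ^ k)) y
    = (\<zeta> b * \<zeta> b) * (of_nat k * (of_nat (k - 1) * \<zeta> y ^ (k - 1 - 1)))" for b
  proof -
    have "dderiv b (\<lambda>y. of_nat k * \<zeta> y ^ (k - 1)) y = of_nat k * (of_nat (k - 1) * \<zeta> y ^ (k - 1 - 1)) * \<zeta> b"
      using dderiv_holomorphic[OF hol' smooth_differentiable[OF sm], of b y] unfolding d2
      by (simp only: dderiv_bounded_linear[OF \<zeta>])
    moreover have sm': "smooth (\<lambda>y. of_nat k * \<zeta> y ^ (k - 1))"
      using sm by (intro smooth_mult smooth_const smooth_power)
    ultimately show ?thesis
      unfolding 1 smooth_dderiv_cmult[OF sm'] by (simp only: mult_ac)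
  qed
  have "laplacian (\<lambda>y. \<zeta> y ^ k) y
    = (\<Sum>b\<in>Basis. \<zeta> b * \<zeta> b) * (of_nat k * (of_nat (k - 1) * \<zeta> y ^ (k - 1 - 1)))"
    unfolding laplacian_def 2 by (simp only: sum_distrib_right)
  moreover have "k \<le> 1 \<Longrightarrow> of_nat k * (of_nat (k - 1) * \<zeta> y ^ (k - 1 - 1)) = 0"
    by (cases k) auto
  ultimately show "laplacian (\<lambda>y. \<zeta> y ^ k) y = 0" using null by auto
qed

lemma exists_harmonic_poly:
  assumes "CARD('n) = 1 \<longrightarrow> k \<le> 1"
  shows "\<exists>h \<in> harmonic_poly (int k). \<exists>y::real^'n. y \<noteq> 0 \<and> h y = 1"
proof -
  obtain a :: "real^'n" where a: "a \<in> Basis" using nonempty_Basis by blast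
  then have a0: "a \<noteq> 0" by auto
  show ?thesis
  proof (cases "CARD('n) = 1")
    case True
    then have "(\<lambda>y. coord a y ^ k) \<in> harmonic_poly (int k)"
      using assms by (intro linear_power_in_harmonic_poly bounded_linear_coord) simp
    moreover have "coord a a ^ k = 1" using a by (simp add: coord_Basis)
    ultimately show ?thesis
      using a0 by (intro bexI[of _ "\<lambda>y. coord a y ^ k"] exI[of _ a] conjI)
  next
    case False
    have "\<not> (Basis :: (real^'n) set) \<subseteq> {a}"
    proof
      assume "(Basis :: (real^'n) set) \<subseteq> {a}"
      then have "card (Basis :: (real^'n) set) \<le> card {a}" by (intro card_mono) auto
      then have "CARD('n) \<le> 1" by simp
      moreover have "CARD('n) > 0" by simp
      ultimately show False using False by linarith
    qed
    then obtain b :: "real^'n" where b: "b \<in> Basis" "b \<noteq> a" by blast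
    \<comment> \<open>An isotropic form: its squared coefficients add up to 1 + i^2 = 0.\<close>
    define \<zeta> where "\<zeta> y = coord a y + \<i> * coord b y" for y :: "real^'n"
    have "bounded_linear \<zeta>"
      unfolding \<zeta>_def[abs_def]
      by (intro bounded_linear_add bounded_linear_coord bounded_linear_const_mult)
    moreover have "(\<Sum>c\<in>Basis. \<zeta> c * \<zeta> c) = 0"
    proof -
      have "\<zeta> c * \<zeta> c = (if c = a then 1 else 0) - (if c = b then 1 else 0)" if "c \<in> Basis" for c
        using that a b by (auto simp: \<zeta>_def coord_Basis)
      then have "(\<Sum>c\<in>Basis. \<zeta> c * \<zeta> c) = (\<Sum>c\<in>Basis. (if c = a then 1 else 0) - (if c = b then 1 else 0))"
        by (intro sum.cong refl)
      then show ?thesis using a b(1) by (simp add: sum_subtractf)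
    qed
    ultimately have "(\<lambda>y. \<zeta> y ^ k) \<in> harmonic_poly (int k)"
      by (intro linear_power_in_harmonic_poly) auto
    moreover have "\<zeta> a ^ k = 1" using a b by (simp add: \<zeta>_def coord_Basis)
    ultimately show ?thesis
      using a0 by (intro bexI[of _ "\<lambda>y. \<zeta> y ^ k"] exI[of _ a] conjI)
  qed
qed

text \<open>Close to the origin on the ray through \<open>y\<close>, a point with nonzero radial
  factor exists. There \<rho>^(2l) and \<open>h\<close> do not vanish either.\<close>

lemma F_fun_nonzero:
  fixes h :: "real^'n \<Rightarrow> complex"
  assumes h: "h \<in> harmonic_poly (int k)" "h y \<noteq> 0" "y \<noteq> 0"
  shows "F_fun s m (int l) (int k) h \<noteq> 0"
proof
  let ?\<Phi> = "radial_factor CARD('n) s m (2 * l + k)"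
  assume "F_fun s m (int l) (int k) h = 0"
  then have "F_fun s m (int l) (int k) h (0, t *\<^sub>R y) = 0" for t by simp
  then have zero: "norm_sq (t *\<^sub>R y) ^ l * h (t *\<^sub>R y) * ?\<Phi> (norm_sq (t *\<^sub>R y)) = 0" for t
    by (simp add: F_fun_eq)
  obtain t where t: "?\<Phi> (norm_sq (t *\<^sub>R y)) \<noteq> 0" "t \<noteq> 0"
    using radial_factor_nonzero_near_origin[of "CARD('n)" s m "2 * l + k" y] by auto
  have "h (t *\<^sub>R y) \<noteq> 0" using homogeneousD[OF harmonic_polyD(4)[OF h(1)] t(2), of y] t(2) h(2) by simp
  then show False using zero[of t] t h(3) by simp
qed

theorem theorem1:
  fixes q :: int and s lam :: complex
  shows "((K_finite_kernel q s lam :: (real \<times> (real^'n) \<Rightarrow> complex) set) \<noteq> {0}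
            \<longleftrightarrow> admissible CARD('n) lam) \<and>
         (admissible CARD('n) lam \<longrightarrow>
            (K_finite_kernel q s lam :: (real \<times> (real^'n) \<Rightarrow> complex) set) =
              cfun.span {F_fun s m l k h | m l k h.
                 admissible_pair CARD('n) lam l k \<and> h \<in> harmonic_poly k \<and>
                 m mod 4 = (2 * k + q) mod 4})"
proof (intro conjI impI)
  let ?X = "K_finite_kernel q s lam :: (real \<times> (real^'n) \<Rightarrow> complex) set"
  \<comment> \<open>The classification produces natural indices, while \<open>?Z\<close> ranges over
    integers; the inclusions through the kernel show that both have the same span.\<close>
  let ?N = "{F_fun s m (int l) (int k) h | m l k (h :: real^'n \<Rightarrow> complex).
    admissible_pair CARD('n) lam (int l) (int k) \<and> h \<in> harmonic_poly (int k) \<and> m mod 4 = (2 * int k + q) mod 4}"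
  let ?Z = "{F_fun s m l k h | m l k (h :: real^'n \<Rightarrow> complex).
    admissible_pair CARD('n) lam l k \<and> h \<in> harmonic_poly k \<and> m mod 4 = (2 * k + q) mod 4}"
  have X_N: "?X \<subseteq> cfun.span ?N" using K_finite_kernel_span by blast
  show "?X \<noteq> {0} \<longleftrightarrow> admissible CARD('n) lam"
  proof
    assume "?X \<noteq> {0}"
    moreover have "0 \<in> ?X" by (rule cfun.subspace_0[OF subspace_K_finite_kernel])
    moreover have "?X \<subseteq> {0}" if "?N = {}" using X_N unfolding that by simp
    ultimately have "?N \<noteq> {}" by blast
    then obtain l k where "admissible_pair CARD('n) lam (int l) (int k)" by blast
    then show "admissible CARD('n) lam" by (intro admissible_pair_imp_admissible) simp
  next
    assume "admissible CARD('n) lam"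
    then obtain l k where pair: "admissible_pair CARD('n) lam (int l) (int k)" and k: "CARD('n) = 1 \<longrightarrow> k \<le> 1"
      using admissible_imp_admissible_pair[of "CARD('n)" lam] by auto
    obtain h and y :: "real^'n" where h: "h \<in> harmonic_poly (int k)" "y \<noteq> 0" "h y = 1"
      using exists_harmonic_poly[OF k] by blast
    \<comment> \<open>m = 2k + q is one representative of the required class modulo 4.\<close>
    have "F_fun s (2 * int k + q) (int l) (int k) h \<in> ?X"
      by (rule F_fun_in_K_finite_kernel[OF pair h(1) refl])
    moreover have "F_fun s (2 * int k + q) (int l) (int k) h \<noteq> 0"
      by (rule F_fun_nonzero[OF h(1) _ h(2)]) (simp add: h(3))
    ultimately show "?X \<noteq> {0}" by blast
  qed
  show "?X = cfun.span ?Z"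
  proof
    have "?N \<subseteq> ?Z" by blast
    then show "?X \<subseteq> cfun.span ?Z" using X_N cfun.span_mono[of ?N ?Z] by (rule_tac order_trans)
    have "?Z \<subseteq> ?X" using F_fun_in_K_finite_kernel_int by blast
    then show "cfun.span ?Z \<subseteq> ?X" by (rule cfun.span_minimal[OF _ subspace_K_finite_kernel])
  qed
qed

end
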